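(* In the Borel-space Markov decision process (MDP) described in the context, for each $\mathcal{S}_\star\in\{\mathcal{S},\mathcal{S}_m,\mathcal{S}_s\}$, the sets $\mathcal{S}_\star$ and $\mathcal{S}'_\star$ are analytic subsets of $\mathcal{P}(\Omega)$; they are Borel if the graph $\Gamma$ of the control constraint is Borel.
   Context: Conventions. A Borel space is a Borel subset of a Polish space. For a Borel space $X$, $\mathcal{B}(X)$ is its Borel $\sigma$-algebra, $\mathcal{P}(X)$ is the set of probability measures on $\mathcal{B}(X)$ with the topology of weak convergence (a Borel space), and $\mathcal{U}(X)=\bigcap_{p\in\mathcal{P}(X)}\mathcal{B}_p(X)$ is the universal $\sigma$-algebra, where $\mathcal{B}_p(X)$ is the $p$-completion of $\mathcal{B}(X)$. Universally measurable means measurable w.r.t. $\mathcal{U}(X)$. A universally (resp. Borel) measurable stochastic kernel on $Y$ given $X$ is a family $q(\cdot\mid x)\in\mathcal{P}(Y)$, $x\in X$, with $x\mapsto q(B\mid x)$ universally (resp. Borel) measurable for all $B\in\mathcal{B}(Y)$. Probabilities of universally measurable sets are w.r.t. completions. A set is analytic if it is empty or the image of a Borel subset of a Polish space under a Borel map. MDP. The state space $\mathbb{X}$ and action space $\mathbb{A}$ are Borel spaces; $q(dy\mid x,a)$ is a Borel measurable stochastic kernel on $\mathbb{X}$ given $\mathbb{X}\times\mathbb{A}$ (state transition); for each $x\in\mathbb{X}$, $A(x)\subset\mathbb{A}$ is a nonempty set of admissible actions, and $\Gamma=\{(x,a): x\in\mathbb{X},a\in A(x)\}$ is analytic. Let $\Omega=(\mathbb{X}\times\mathbb{A})^\infty$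 with elements $\omega=(x_0,a_0,x_1,a_1,\ldots)$, $h_n=(x_0,a_0,\ldots,a_{n-1},x_n)$, and $H_n=(\mathbb{X}\times\mathbb{A})^n\times\mathbb{X}$. Policies. A policy is a sequence $\pi=(\mu_0,\mu_1,\ldots)$ where $\mu_n(da_n\mid h_n)$ is a universally measurable stochastic kernel on $\mathbb{A}$ given $H_n$ with $\mu_n(A(x_n)\mid h_n)=1$ for all $h_n\in H_n$. It is nonrandomized if every $\mu_n(\cdot\mid h_n)$ is a Dirac measure; Markov if each $\mu_n(\cdot\mid h_n)$ depends only on $x_n$; stationary if it is Markov and $\mu_0=\mu_1=\cdots$. $\Pi,\Pi_m,\Pi_s$ denote the sets of all, Markov, and stationary policies, and $\Pi',\Pi'_m,\Pi'_s$ their subsets of nonrandomized policies. Strategic measures. For $\pi\in\Pi$ and $p_0\in\mathcal{P}(\mathbb{X})$, $\mathbb{P}^\pi_{p_0}$ is the unique probability measure on $\mathcal{U}(\Omega)$ determined by $p_0(dx_0),\mu_0(da_0\mid x_0),q(dx_1\mid x_0,a_0),\mu_1(da_1\mid h_1),\ldots$, and $\rho_{p_0}[\pi]$ is its restriction to $\mathcal{B}(\Omega)$. $\mathcal{S}=\{\rho_{p_0}[\pi]:\pi\in\Pi,p_0\in\mathcal{P}(\mathbb{X})\}$; $\mathcal{S}_m,\mathcal{S}_s,\mathcal{S}',\mathcal{S}'_m,\mathcal{S}'_s$ are defined in the same way with $\Pi$ replaced by $\Pi_m,\Pi_s,\Pi',\Pi'_m,\Pi'_s$, respectively. *)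

theory Defs
  imports "HOL-Probability.Probability"
begin

section \<open>Borel spaces, universal measurability, analytic sets\<close>

text \<open>A Borel space is a Borel subset of a type of class \<^class>\<open>polish_space\<close>, carrying the
  restricted Borel \<open>\<sigma>\<close>-algebra.  A Borel measurable stochastic kernel on \<open>Y\<close> given \<open>X\<close> is an element
  of \<open>borel_on X \<rightarrow>\<^sub>M prob_algebra (borel_on Y)\<close>; a universally measurable one is an element of
  \<open>universal (borel_on X) \<rightarrow>\<^sub>M prob_algebra (borel_on Y)\<close>.\<close>

abbreviation borel_on :: "'b::topological_space set \<Rightarrow> 'b measure" where
  "borel_on S \<equiv> restrict_space borel S"

definition prob_measures :: "'b::topological_space set \<Rightarrow> 'b measure set" where
  "prob_measures S = space (prob_algebra (borel_on S))"

definition universal :: "'b measure \<Rightarrow> 'b measure" where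
  "universal M = sigma (space M)
     {B. B \<subseteq> space M \<and> (\<forall>p\<in>space (prob_algebra M). B \<in> sets (completion p))}"

definition weak_topology :: "'b::topological_space set \<Rightarrow> 'b measure topology" where
  "weak_topology S = topology_generated_by
     {{p \<in> prob_measures S. (\<integral>x. f x \<partial>p) \<in> U} | (f :: 'b \<Rightarrow> real) U.
        continuous_on S f \<and> bounded (f ` S) \<and> open U}"

definition borel_of :: "'b topology \<Rightarrow> 'b measure" where
  "borel_of T = sigma (topspace T) {U. openin T U}"

text \<open>Letting the Polish space \<open>Z\<close> range over topologies on subsets of the reals is no restriction:
  a Polish space has at most continuum many points.\<close>

definition analytic_in :: "'b topology \<Rightarrow> 'b set \<Rightarrow> bool" where
  "analytic_in T S \<longleftrightarrow> S \<subseteq> topspace T \<and>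
     (S = {} \<or>
      (\<exists>(Z :: real topology) D f.
         completely_metrizable_space Z \<and> second_countable Z \<and> D \<in> sets (borel_of Z) \<and>
         f \<in> restrict_space (borel_of Z) D \<rightarrow>\<^sub>M borel_of T \<and> f ` D = S))"

section \<open>Histories and policies\<close>

text \<open>The history \<open>(x\<^sub>0, a\<^sub>0, \<dots>, a\<^sub>n\<^sub>-\<^sub>1, x\<^sub>n)\<close> is encoded as the pair of the
  function \<open>i \<mapsto> (x\<^sub>i, a\<^sub>i)\<close>, extended by \<^const>\<open>undefined\<close> from index \<open>n\<close> on, and \<open>x\<^sub>n\<close>.\<close>

type_synonym ('x, 'a) history = "(nat \<Rightarrow> 'x \<times> 'a) \<times> 'x"

type_synonym ('x, 'a) policy = "nat \<Rightarrow> ('x, 'a) history \<Rightarrow> 'a measure"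

definition trajectories :: "'x set \<Rightarrow> 'a set \<Rightarrow> (nat \<Rightarrow> 'x \<times> 'a) set" where
  "trajectories X A = {\<omega>. \<forall>n. \<omega> n \<in> X \<times> A}"

definition histories :: "'x set \<Rightarrow> 'a set \<Rightarrow> nat \<Rightarrow> ('x, 'a) history set" where
  "histories X A n = (\<Pi>\<^sub>E i\<in>{..<n}. X \<times> A) \<times> X"

definition history_of :: "nat \<Rightarrow> (nat \<Rightarrow> 'x \<times> 'a) \<Rightarrow> ('x, 'a) history" where
  "history_of n \<omega> = (restrict \<omega> {..<n}, fst (\<omega> n))"

definition policies ::
  "'x::polish_space set \<Rightarrow> 'a::polish_space set \<Rightarrow> ('x \<Rightarrow> 'a set) \<Rightarrow> ('x, 'a) policy set" where
  "policies X A Adm = {\<mu>. \<forall>n.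
     \<mu> n \<in> universal (borel_on (histories X A n)) \<rightarrow>\<^sub>M prob_algebra (borel_on A) \<and>
     (\<forall>h\<in>histories X A n. emeasure (completion (\<mu> n h)) (Adm (snd h)) = 1)}"

definition markov_policies ::
  "'x::polish_space set \<Rightarrow> 'a::polish_space set \<Rightarrow> ('x \<Rightarrow> 'a set) \<Rightarrow> ('x, 'a) policy set" where
  "markov_policies X A Adm = {\<mu> \<in> policies X A Adm.
     \<forall>n. \<exists>\<kappa>. \<forall>h\<in>histories X A n. \<mu> n h = \<kappa> (snd h)}"

definition stationary_policies ::
  "'x::polish_space set \<Rightarrow> 'a::polish_space set \<Rightarrow> ('x \<Rightarrow> 'a set) \<Rightarrow> ('x, 'a) policy set" where
  "stationary_policies X A Adm = {\<mu> \<in> policies X A Adm.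
     \<exists>\<kappa>. \<forall>n. \<forall>h\<in>histories X A n. \<mu> n h = \<kappa> (snd h)}"

definition nonrandomized ::
  "'x set \<Rightarrow> 'a::polish_space set \<Rightarrow> ('x, 'a) policy set" where
  "nonrandomized X A = {\<mu>. \<forall>n. \<forall>h\<in>histories X A n. \<exists>a\<in>A. \<mu> n h = return (borel_on A) a}"

section \<open>Strategic measures\<close>

text \<open>\<open>iter_integral q p\<^sub>0 \<mu> n f\<close> is the iterated integral
  \<open>\<integral>p\<^sub>0(dx\<^sub>0) \<integral>\<mu>\<^sub>0(da\<^sub>0|h\<^sub>0) \<integral>q(dx\<^sub>1|x\<^sub>0,a\<^sub>0) \<dots> \<integral>q(dx\<^sub>n|x\<^sub>n\<^sub>-\<^sub>1,a\<^sub>n\<^sub>-\<^sub>1) f(h\<^sub>n)\<close>.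
  The inner integrals are only universally measurable functions of the preceding variables, so
  every integral is taken with respect to the completed measure.\<close>

primrec iter_integral ::
  "('x \<times> 'a \<Rightarrow> 'x measure) \<Rightarrow> 'x measure \<Rightarrow> ('x, 'a) policy \<Rightarrow> nat \<Rightarrow>
   (('x, 'a) history \<Rightarrow> ennreal) \<Rightarrow> ennreal" where
  "iter_integral q p0 \<mu> 0 f = (\<integral>\<^sup>+ x. f (\<lambda>_. undefined, x) \<partial>completion p0)"
| "iter_integral q p0 \<mu> (Suc n) f = iter_integral q p0 \<mu> n
     (\<lambda>(h, x). \<integral>\<^sup>+ a. (\<integral>\<^sup>+ y. f (h(n := (x, a)), y) \<partial>completion (q (x, a)))
        \<partial>completion (\<mu> n (h, x)))"

definition policy_measure ::
  "'x::polish_space set \<Rightarrow> 'a::polish_space set \<Rightarrow> ('x \<times> 'a \<Rightarrow> 'x measure) \<Rightarrow> 'x measure \<Rightarrow>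
   ('x, 'a) policy \<Rightarrow> (nat \<Rightarrow> 'x \<times> 'a) measure" where
  "policy_measure X A q p0 \<mu> = (THE P.
     prob_space P \<and> sets P = sets (universal (borel_on (trajectories X A))) \<and>
     (\<forall>n. \<forall>D\<in>sets (borel_on (histories X A n)).
        emeasure P {\<omega> \<in> trajectories X A. history_of n \<omega> \<in> D} =
        iter_integral q p0 \<mu> n (indicator D)))"

definition strategic_measure ::
  "'x::polish_space set \<Rightarrow> 'a::polish_space set \<Rightarrow> ('x \<times> 'a \<Rightarrow> 'x measure) \<Rightarrow> 'x measure \<Rightarrow>
   ('x, 'a) policy \<Rightarrow> (nat \<Rightarrow> 'x \<times> 'a) measure" where
  "strategic_measure X A q p0 \<mu> =
     restr_to_subalg (policy_measure X A q p0 \<mu>) (borel_on (trajectories X A))"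

definition strategic_measures ::
  "'x::polish_space set \<Rightarrow> 'a::polish_space set \<Rightarrow> ('x \<times> 'a \<Rightarrow> 'x measure) \<Rightarrow>
   ('x, 'a) policy set \<Rightarrow> (nat \<Rightarrow> 'x \<times> 'a) measure set" where
  "strategic_measures X A q Pol =
     {strategic_measure X A q p0 \<mu> | p0 \<mu>. p0 \<in> prob_measures X \<and> \<mu> \<in> Pol}"

end

theory Submission
  imports Defs
begin

text \<open>A policy enters its strategic measure only through Borel versions of its kernels.  Hence a
  measure \<open>p\<close> on trajectories is strategic if and only if it is generated by its own conditional
  action kernels and almost all its trajectories stay in \<open>\<Gamma>\<close>; on the exceptional null sets the
  kernels are replaced by a universally measurable selector of \<open>\<Gamma>\<close>.  The conditional action
  kernels are disintegrations of the law of \<open>(h\<^sub>n, a\<^sub>n)\<close> for general policies, of the law of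
  \<open>(x\<^sub>n, a\<^sub>n)\<close> for Markov policies, and, for stationary policies, of a mixture of the laws of
  \<open>(x\<^sub>n, a\<^sub>n)\<close> over all \<open>n\<close> with positive weights.  Disintegrations can be chosen jointly measurable
  in the measure and the conditioning variable: by least-squares regression on a countable family of
  step functions.  So the first condition is Borel in \<open>p\<close>, and so is the condition that the kernels are
  point masses.  The second one, concentration on the analytic set of trajectories in \<open>\<Gamma>\<close>, is
  analytic: by measurable selection the measures concentrated on an analytic set are the images of
  measures under a parametrization of the set.  It is Borel if \<open>\<Gamma>\<close> is.\<close>

text \<open>Disintegrations exist for each measure separately, but a conditional expectation is
  fixed only up to null sets that move with the measure, so nothing can be said about its dependence
  on the measure. Least squares removes this obstacle: the first near-minimizer in a countable
  family is an explicit function of countably many integrals, each measurable in the measure, and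
  near-minimizers with summable errors converge almost surely.

  Positive weights in the mixture work in both directions. A set that is null for the mixture is
  null at every time, so one exceptional set of states can be repaired for all times at once;
  conversely a kernel that generates the process at every time disintegrates the mixture, and
  uniqueness makes it agree with the chosen one.

  Universal measurability is handled through completions: selectors and policy kernels are Borel off
  a null set of each given measure, and analytic sets lie between Borel sets of equal measure.
  Analyticity is reduced to continuous images of Baire space, where a fibre is closed and has a
  lexicographically least point.\<close>

instantiation nat :: metric_space
begin

definition dist_nat :: "nat \<Rightarrow> nat \<Rightarrow> real" where
  "dist_nat m n = \<bar>real m - real n\<bar>"

definition uniformity_nat :: "(nat \<times> nat) filter" where
  "uniformity_nat = (INF e\<in>{0<..}. principal {(x, y). dist x y < e})"

instance
proof
  show "uniformity = (INF e\<in>{0<..}. principal {(x::nat, y). dist x y < e})"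
    by (rule uniformity_nat_def)
  show "open U \<longleftrightarrow> (\<forall>x\<in>U. eventually (\<lambda>(x', y). x' = x \<longrightarrow> y \<in> U) uniformity)" for U :: "nat set"
  proof -
    have near: "y = x" if "\<bar>real x - real y\<bar> < 1" for x y
      using that by linarith
    have "\<forall>\<^sub>F (x', y) in uniformity. x' = x \<longrightarrow> y \<in> U" if "x \<in> U" for x
      unfolding uniformity_nat_def using that
      by (intro eventually_INF1[of 1]) (auto simp: eventually_principal dist_nat_def dest!: near)
    then show ?thesis by (simp add: Topological_Spaces.open_discrete)
  qed
qed (auto simp: dist_nat_def)

end

instance nat :: complete_space
proof
  fix X :: "nat \<Rightarrow> nat"
  assume "Cauchy X"
  then have "\<exists>n. \<forall>m\<ge>n. \<forall>k\<ge>n. dist (X m) (X k) < 1"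
    by (rule metric_CauchyD) simp
  then obtain n where n: "\<forall>m\<ge>n. \<forall>k\<ge>n. dist (X m) (X k) < 1" ..
  have eq: "X m = X n" if "m \<ge> n" for m
  proof -
    have "dist (X m) (X n) < 1" using n that by blast
    then show ?thesis unfolding dist_nat_def by linarith
  qed
  have "\<forall>\<^sub>F m in sequentially. X n = X m"
    by (intro eventually_sequentiallyI[of n] eq[symmetric])
  then have "X \<longlonglongrightarrow> X n"
    by (rule Lim_transform_eventually[OF tendsto_const])
  then show "convergent X" by (rule convergentI)
qed

text \<open>With this instance Baire space \<open>nat \<Rightarrow> nat\<close> and its countable
  powers belong to the class \<open>polish_space\<close>.\<close>

instance nat :: polish_space ..

instance prod :: (polish_space, polish_space) polish_space ..

lemma open_cylinder_nat: "open {\<tau>. \<forall>i\<le>k. \<tau> i = (\<sigma> :: nat \<Rightarrow> nat) i}"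
proof -
  have "{\<tau>. \<forall>i\<le>k. \<tau> i = \<sigma> i} = (\<Inter>i\<in>{..k}. (\<lambda>\<tau>. \<tau> i) -` {\<sigma> i})" by auto
  also have "open \<dots>"
    by (intro open_INT finite_atMost ballI open_vimage Topological_Spaces.open_discrete)
       (auto intro: continuous_on_product_coordinates)
  finally show ?thesis .
qed

section \<open>Polish spaces as continuous images of Baire space\<close>

context Metric_space
begin

text \<open>A sequence of indices into a dense sequence is turned into a Cauchy sequence by ignoring
  every index that would cause too long a jump.\<close>

primrec damped :: "(nat \<Rightarrow> 'a) \<Rightarrow> (nat \<Rightarrow> nat) \<Rightarrow> nat \<Rightarrow> 'a" where
  "damped D \<sigma> 0 = D (\<sigma> 0)"
| "damped D \<sigma> (Suc k) =
     (if d (damped D \<sigma> k) (D (\<sigma> (Suc k))) < (1/2)^k then D (\<sigma> (Suc k)) else damped D \<sigma> k)"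

lemma damped_in: "range D \<subseteq> M \<Longrightarrow> damped D \<sigma> k \<in> M"
  by (induction k) auto

text \<open>The right-hand side is the geometric sum of the jump bounds (1/2)^i over k \<le> i < k +
  j.\<close>

lemma damped_dist:
  assumes "range D \<subseteq> M"
  shows "d (damped D \<sigma> k) (damped D \<sigma> (k + j)) \<le> 2 * (1/2)^k - 2 * (1/2)^(k + j)"
proof (induction j)
  case 0
  then show ?case using damped_in[OF assms] by simp
next
  case (Suc j)
  have "d (damped D \<sigma> (k + j)) (damped D \<sigma> (Suc (k + j))) \<le> (1/2)^(k + j)"
    using damped_in[OF assms] by auto
  moreover have "d (damped D \<sigma> k) (damped D \<sigma> (k + Suc j)) \<le>
    d (damped D \<sigma> k) (damped D \<sigma> (k + j)) + d (damped D \<sigma> (k + j)) (damped D \<sigma> (Suc (k + j)))"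
    using triangle damped_in[OF assms] by (simp del: damped.simps)
  ultimately show ?case using Suc by (simp del: damped.simps)
qed

lemma damped_limit:
  assumes D: "range D \<subseteq> M" and "mcomplete"
  obtains l where "l \<in> M" "\<And>k. d (damped D \<sigma> k) l \<le> 2 * (1/2)^k"
proof -
  have bd: "d (damped D \<sigma> k) (damped D \<sigma> l) \<le> 2 * (1/2)^k" if "k \<le> l" for k l
  proof -
    have "0 \<le> (1/2::real)^l" by simp
    with damped_dist[OF D, of \<sigma> k "l - k"] that show ?thesis by (simp del: zero_le_power)
  qed
  have "MCauchy (damped D \<sigma>)"
    unfolding MCauchy_def
  proof (intro conjI allI impI)
    show "range (damped D \<sigma>) \<subseteq> M" using damped_in[OF D] by auto
    fix \<epsilon> :: real assume "\<epsilon> > 0"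
    then obtain N where N: "(1/2::real)^N < \<epsilon> / 4"
      using real_arch_pow_inv[of "\<epsilon>/4" "1/2"] by auto
    show "\<exists>N. \<forall>n n'. N \<le> n \<longrightarrow> N \<le> n' \<longrightarrow> d (damped D \<sigma> n) (damped D \<sigma> n') < \<epsilon>"
    proof (intro exI[of _ N] allI impI)
      fix n n' assume "N \<le> n" "N \<le> n'"
      have "d (damped D \<sigma> n) (damped D \<sigma> n') \<le>
        d (damped D \<sigma> N) (damped D \<sigma> n) + d (damped D \<sigma> N) (damped D \<sigma> n')"
        using damped_in[OF D] triangle'' by blast
      with bd[OF \<open>N \<le> n\<close>] bd[OF \<open>N \<le> n'\<close>] N show "d (damped D \<sigma> n) (damped D \<sigma> n') < \<epsilon>"
        by linarith
    qed
  qed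
  then obtain l where l: "limitin mtopology (damped D \<sigma>) l sequentially"
    using \<open>mcomplete\<close> unfolding mcomplete_def by blast
  then have lM: "l \<in> M" by (simp add: limitin_metric)
  have "d (damped D \<sigma> k) l \<le> 2 * (1/2)^k" for k
  proof (rule field_le_epsilon)
    fix \<epsilon> :: real assume "\<epsilon> > 0"
    then obtain N where N: "\<forall>n\<ge>N. d (damped D \<sigma> n) l < \<epsilon>"
      using l unfolding limitin_metric eventually_sequentially by meson
    have "d (damped D \<sigma> k) l \<le> d (damped D \<sigma> k) (damped D \<sigma> (max k N)) + d (damped D \<sigma> (max k N)) l"
      using damped_in[OF D] lM triangle by blast
    with bd[of k "max k N"] N[rule_format, of "max k N"] show "d (damped D \<sigma> k) l \<le> 2 * (1/2)^k + \<epsilon>"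
      by linarith
  qed
  with lM show thesis by (rule that)
qed

end

lemma half_power_small: "\<epsilon> > 0 \<Longrightarrow> \<exists>k. c * (1/2::real)^k < \<epsilon>"
proof -
  assume "\<epsilon> > 0"
  have "(\<lambda>k. c * (1/2::real)^k) \<longlonglongrightarrow> c * 0" by (intro tendsto_intros) auto
  then have "\<forall>\<^sub>F k in sequentially. c * (1/2)^k < \<epsilon>"
    using \<open>\<epsilon> > 0\<close> by (intro order_tendstoD(2)[of _ "c*0"]) auto
  then show ?thesis by (auto simp: eventually_sequentially)
qed

lemma second_countable_euclidean:
  "second_countable (euclidean :: 'a::second_countable_topology topology)"
proof -
  obtain B :: "'a set set" where "countable B" "\<And>C. C \<in> B \<Longrightarrow> open C"
    "\<And>S. open S \<Longrightarrow> \<exists>U. U \<subseteq> B \<and> S = \<Union>U"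
    using univ_second_countable by blast
  then show ?thesis
    unfolding second_countable_def by (intro exI[of _ B]) (fastforce simp: subset_iff)
qed

text \<open>\<open>u\<close> sends a sequence to the limit of its damped sequence; it is continuous
  because the first k + 1 entries fix the limit up to 2 * (1/2)^k. \<open>e\<close> lists indices of
  dense points that approach x. The open sublevel sets make \<open>e\<close> Borel, so the space is
  a Borel retract of Baire space.\<close>

lemma completely_metrizable_baire_retract:
  assumes "completely_metrizable_space T" "second_countable T" "topspace T \<noteq> {}"
  obtains u :: "(nat \<Rightarrow> nat) \<Rightarrow> 'a" and e :: "'a \<Rightarrow> nat \<Rightarrow> nat" where
    "continuous_map euclidean T u" "\<And>x. x \<in> topspace T \<Longrightarrow> u (e x) = x"
    "\<And>k n. openin T {x \<in> topspace T. e x k \<le> n}"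
proof -
  obtain M d where M: "Metric_space M d" "Metric_space.mcomplete M d" "T = Metric_space.mtopology M d"
    using assms(1) unfolding completely_metrizable_space_def by auto
  interpret Metric_space M d by (rule M)
  have topM: "topspace T = M" by (simp add: M)
  obtain C where C: "countable C" "C \<subseteq> M" "T closure_of C = M"
    using second_countable_imp_separable_space[OF assms(2)] by (auto simp: separable_space_def topM)
  have "C \<noteq> {}" using C assms(3) topM by auto
  define D where "D = from_nat_into C"
  have rD: "range D = C" unfolding D_def using C \<open>C \<noteq> {}\<close> by (simp add: range_from_nat_into)
  then have D: "range D \<subseteq> M" using C by simp
  have dense: "\<exists>n. d (D n) x < r" if x: "x \<in> M" and r: "r > 0" for x r
  proof -
    have "x \<in> mtopology closure_of C" unfolding M(3)[symmetric] C(3) by (rule x)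
    then obtain y where y: "y \<in> C" "y \<in> mball x r"
      using r unfolding metric_closure_of by blast
    then obtain n where "y = D n" using rD by blast
    then show ?thesis using y commute by auto
  qed
  define u where "u \<sigma> = (SOME l. l \<in> M \<and> (\<forall>k. d (damped D \<sigma> k) l \<le> 2 * (1/2)^k))" for \<sigma>
  have u: "u \<sigma> \<in> M \<and> (\<forall>k. d (damped D \<sigma> k) (u \<sigma>) \<le> 2 * (1/2)^k)" for \<sigma>
    unfolding u_def by (rule someI_ex) (meson damped_limit[OF D M(2)])
  \<comment> \<open>The radius (1/2)^(k+2) keeps consecutive chosen points closer than (1/2)^k, so
    the damping never rejects an index listed by \<open>e x\<close>.\<close>
  define e where "e x k = (LEAST n. d (D n) x < (1/2)^(k+2))" for x k
  have e: "d (D (e x k)) x < (1/2)^(k+2)" if "x \<in> M" for x k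
    unfolding e_def by (rule LeastI_ex) (rule dense[OF that], simp)
  have "continuous_map euclidean mtopology u"
    unfolding continuous_map_to_metric
  proof (intro ballI allI impI)
    fix \<sigma> and \<epsilon> :: real assume "\<epsilon> > 0"
    then obtain k where k: "4 * (1/2::real)^k < \<epsilon>" using half_power_small by blast
    have "u \<tau> \<in> mball (u \<sigma>) \<epsilon>" if "\<forall>i\<le>k. \<tau> i = \<sigma> i" for \<tau>
    proof -
      have "damped D \<tau> j = damped D \<sigma> j" if "j \<le> k" for j
        using that \<open>\<forall>i\<le>k. \<tau> i = \<sigma> i\<close> by (induction j) auto
      then have "damped D \<tau> k = damped D \<sigma> k" by simp
      moreover have "d (u \<sigma>) (u \<tau>) \<le> d (damped D \<sigma> k) (u \<sigma>) + d (damped D \<sigma> k) (u \<tau>)"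
        using u damped_in[OF D] triangle'' by blast
      ultimately show ?thesis using u[of \<sigma>] u[of \<tau>] k
        by (smt (verit, best) in_mball)
    qed
    then show "\<exists>U. openin euclidean U \<and> \<sigma> \<in> U \<and> (\<forall>\<tau>\<in>U. u \<tau> \<in> mball (u \<sigma>) \<epsilon>)"
      by (intro exI[of _ "{\<tau>. \<forall>i\<le>k. \<tau> i = \<sigma> i}"]) (auto simp: open_cylinder_nat)
  qed
  moreover have "u (e x) = x" if "x \<in> topspace T" for x
  proof -
    have x: "x \<in> M" using that topM by simp
    have eq: "damped D (e x) k = D (e x k)" for k
    proof (induction k)
      case (Suc k)
      have "d (D (e x k)) (D (e x (Suc k))) \<le> d (D (e x k)) x + d (D (e x (Suc k))) x"
        using x D triangle' by blast
      also have "\<dots> < (1/2)^(k+2) + (1/2)^(Suc k+2)" using e[OF x] by (intro add_strict_mono)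
      also have "\<dots> \<le> (1/2)^k" by simp
      finally show ?case using Suc by simp
    qed simp
    have "d x (u (e x)) \<le> 0"
    proof (rule field_le_epsilon)
      fix \<epsilon> :: real assume "\<epsilon> > 0"
      then obtain k where k: "4 * (1/2::real)^k < \<epsilon>" using half_power_small by blast
      have "d x (u (e x)) \<le> d (D (e x k)) x + d (D (e x k)) (u (e x))"
        using x D u triangle'' by blast
      moreover have "d (D (e x k)) (u (e x)) \<le> 2 * (1/2)^k" using u[of "e x"] eq by metis
      moreover have "d (D (e x k)) x \<le> 2 * (1/2)^k" 
      proof -
        have "(1/2::real)^(k+2) \<le> 2 * (1/2)^k" by (simp add: power_add)
        with e[OF x, of k] show ?thesis by linarith
      qed
      ultimately show "d x (u (e x)) \<le> 0 + \<epsilon>" using k by linarith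
    qed
    then show ?thesis using x u by (smt (verit) nonneg zero)
  qed
  moreover have "openin T {x \<in> topspace T. e x k \<le> n}" for k n
  proof -
    have "{x \<in> topspace T. e x k \<le> n} = (\<Union>m\<in>{..n}. mball (D m) ((1/2)^(k+2)))"
    proof (intro set_eqI iffI)
      fix x assume x: "x \<in> {x \<in> topspace T. e x k \<le> n}"
      then have "d (D (e x k)) x < (1/2)^(k+2)" using e topM by simp
      moreover have "D (e x k) \<in> M" using D by auto
      ultimately show "x \<in> (\<Union>m\<in>{..n}. mball (D m) ((1/2)^(k+2)))"
        using x topM by (auto simp: in_mball)
    next
      fix x assume "x \<in> (\<Union>m\<in>{..n}. mball (D m) ((1/2)^(k+2)))"
      then obtain m where m: "m \<le> n" "x \<in> M" "d (D m) x < (1/2)^(k+2)" by auto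
      then have "e x k \<le> m" unfolding e_def by (intro Least_le)
      with m topM show "x \<in> {x \<in> topspace T. e x k \<le> n}" by auto
    qed
    then show ?thesis by (auto simp: M(3))
  qed
  ultimately show thesis using that M(3) by blast
qed

section \<open>Standard Borel spaces as measurable retracts of the real line\<close>

text \<open>A working form of being standard Borel. The left inverse \<open>d\<close> is measurable
  on the whole line, so points, measures and kernels can be moved to the reals and back without
  first showing that the image of \<open>e\<close> is Borel.\<close>

definition real_retract :: "'a measure \<Rightarrow> bool" where
  "real_retract M \<longleftrightarrow> (\<exists>e\<in>M \<rightarrow>\<^sub>M (borel :: real measure). \<exists>d\<in>borel \<rightarrow>\<^sub>M M. \<forall>x\<in>space M. d (e x) = x)"

text \<open>Digits 0 and 1 in base 4 leave a tail of at most 1/3 after every position, so no carry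
  occurs and the floor cuts the expansion exactly. Base 2 would not do, since its expansions are
  ambiguous.\<close>

lemma quaternary_digit:
  fixes b :: "nat \<Rightarrow> int"
  assumes b: "\<And>k. b k \<in> {0, 1}"
  shows "\<lfloor>4^(Suc k) * (\<Sum>j. of_int (b j) / 4^(Suc j) :: real)\<rfloor> mod 4 = b k"
proof -
  have b0: "0 \<le> (of_int (b j) :: real)" and b1: "(of_int (b j) :: real) \<le> 1" for j
    using b[of j] by auto
  have sum4: "summable (\<lambda>j. of_int (b (j + i)) / (4::real)^(Suc j))" for i
  proof (rule summable_comparison_test'[of "\<lambda>j. (1/4)^j" 0])
    show "norm (of_int (b (n + i)) / (4::real)^(Suc n)) \<le> (1/4)^n" for n
      using b[of "n+i"] by (auto simp: field_simps)
  qed (simp add: summable_geometric)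
  define r where "r = (\<Sum>j. of_int (b (j + Suc k)) / (4::real)^(Suc j))"
  have "r \<le> (\<Sum>j. (1/4) * (1/4)^j)"
    unfolding r_def
    by (intro suminf_le sum4 summable_mult summable_geometric) (use b1 in \<open>auto simp: field_simps\<close>)
  also have "\<dots> = 1/3" by (subst suminf_mult) (auto simp: suminf_geometric)
  finally have r1: "r < 1" by simp
  have r0: "0 \<le> r" unfolding r_def
    by (intro suminf_nonneg sum4 divide_nonneg_nonneg b0) auto
  have "(\<Sum>j. of_int (b j) / 4^(Suc j) :: real) =
    (\<Sum>j. of_int (b (j + Suc k)) / 4^(Suc (j + Suc k))) + (\<Sum>j<Suc k. of_int (b j) / 4^(Suc j))"
    using suminf_split_initial_segment[OF sum4[of 0, simplified], of "Suc k"] by simp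
  also have "(\<Sum>j. of_int (b (j + Suc k)) / (4::real)^(Suc (j + Suc k))) = (1/4)^(Suc k) * r"
    unfolding r_def by (subst suminf_mult[symmetric, OF sum4]) (simp add: field_simps power_add)
  finally have "4^(Suc k) * (\<Sum>j. of_int (b j) / 4^(Suc j) :: real)
     = r + 4^(Suc k) * (\<Sum>j<Suc k. of_int (b j) / 4^(Suc j))"
    by (simp add: field_simps)
  also have "4^(Suc k) * (\<Sum>j<Suc k. of_int (b j) / (4::real)^(Suc j)) =
     of_int (\<Sum>j<Suc k. b j * 4^(k - j))"
    unfolding sum_distrib_left of_int_sum
  proof (rule sum.cong)
    fix j assume "j \<in> {..<Suc k}"
    then have "(4::real)^(Suc k) = 4^(Suc j) * 4^(k - j)" by (subst power_add[symmetric]) auto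
    then show "4^(Suc k) * (of_int (b j) / (4::real)^(Suc j)) = of_int (b j * 4^(k - j))" by simp
  qed simp
  finally have "\<lfloor>4^(Suc k) * (\<Sum>j. of_int (b j) / 4^(Suc j) :: real)\<rfloor> = (\<Sum>j<Suc k. b j * 4^(k - j))"
    using r0 r1 by linarith
  also have "\<dots> = b k + (\<Sum>j<k. b j * 4^(k - j))" by simp
  also have "(\<Sum>j<k. b j * 4^(k - j)) = 4 * (\<Sum>j<k. b j * 4^(k - Suc j))"
    unfolding sum_distrib_left
    by (intro sum.cong refl) (auto simp: Suc_diff_Suc simp flip: power_Suc)
  finally show ?thesis using b[of k] by auto
qed

lemma measurable_countable_borel:
  "M \<rightarrow>\<^sub>M (borel :: 'a::{countable, t2_space} measure) = M \<rightarrow>\<^sub>M count_space UNIV"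
  by (rule measurable_cong_sets[OF refl sets_borel_eq_count_space])

text \<open>A sequence is coded by its graph: digit number \<open>prod_encode (n, m)\<close> is 1
  exactly if \<sigma> n = m. Decoding at n takes the least m whose digit is 1, which defines a
  measurable function of every real number.\<close>

lemma real_retract_baire: "real_retract (borel :: (nat \<Rightarrow> nat) measure)"
proof -
  define b where "b \<sigma> k = (case prod_decode k of (n, m) \<Rightarrow> (of_bool (\<sigma> n = m) :: int))" for \<sigma> :: "nat \<Rightarrow> nat" and k
  define e where "e \<sigma> = (\<Sum>j. of_int (b \<sigma> j) / 4^(Suc j) :: real)" for \<sigma>
  define d where "d t n = (LEAST m. \<lfloor>4^(Suc (prod_encode (n, m))) * t\<rfloor> mod 4 = 1)" for t :: real and n
  have [measurable]: "(\<lambda>\<sigma>::nat\<Rightarrow>nat. \<sigma> n) \<in> borel \<rightarrow>\<^sub>M count_space UNIV" for n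
    unfolding measurable_countable_borel[symmetric] by (rule measurable_product_coordinates)
  have "e \<in> borel_measurable borel" unfolding e_def b_def split_beta by measurable
  moreover have "d \<in> borel \<rightarrow>\<^sub>M borel"
    unfolding d_def
    by (rule measurable_coordinatewise_then_product, unfold measurable_countable_borel) measurable
  moreover have "d (e \<sigma>) = \<sigma>" for \<sigma>
  proof
    fix n
    have "\<lfloor>4^(Suc k) * e \<sigma>\<rfloor> mod 4 = b \<sigma> k" for k
      unfolding e_def by (rule quaternary_digit) (auto simp: b_def split: prod.split)
    then have "d (e \<sigma>) n = (LEAST m. \<sigma> n = m)" by (simp add: d_def b_def)
    then show "d (e \<sigma>) n = \<sigma> n" by (simp add: Least_equality)
  qed
  ultimately show ?thesis unfolding real_retract_def by auto
qed

lemma real_retract_polish: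
  fixes S :: "'a::polish_space set"
  assumes S: "S \<in> sets borel" "S \<noteq> {}"
  shows "real_retract (borel_on S)"
proof -
  interpret Metric_space "UNIV :: 'a set" dist by (rule Met_TC.Metric_space_axioms)
  have "completely_metrizable_space (euclidean :: 'a topology)"
    using completely_metrizable_space_euclidean .
  moreover have "second_countable (euclidean :: 'a topology)"
    by (rule second_countable_euclidean)
  ultimately obtain u :: "(nat \<Rightarrow> nat) \<Rightarrow> 'a" and e where
    u: "continuous_map euclidean euclidean u" and ue: "\<And>x. u (e x) = x"
    and e: "\<And>k n. open {x. e x k \<le> n}"
    using completely_metrizable_baire_retract[of "euclidean :: 'a topology"] by auto
  have [measurable]: "u \<in> borel \<rightarrow>\<^sub>M borel"
    using u by (intro borel_measurable_continuous_onI) simp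
  have [measurable]: "e \<in> borel \<rightarrow>\<^sub>M borel"
  proof (rule measurable_coordinatewise_then_product)
    show "(\<lambda>x. e x k) \<in> borel \<rightarrow>\<^sub>M borel" for k
      by (rule borel_measurableI_le) (use e[of k] in \<open>simp add: borel_open\<close>)
  qed
  obtain e' :: "_ \<Rightarrow> real" and d' where [measurable]: "e' \<in> borel \<rightarrow>\<^sub>M borel" "d' \<in> borel \<rightarrow>\<^sub>M borel"
    and d'e': "\<And>\<sigma> :: nat \<Rightarrow> nat. d' (e' \<sigma>) = \<sigma>"
    using real_retract_baire unfolding real_retract_def by auto
  obtain s where s: "s \<in> S" using S by auto
  \<comment> \<open>Reals that do not code a point of S go to the fixed point s, which is why S has
    to be nonempty.\<close>
  define d where "d t = (if u (d' t) \<in> S then u (d' t) else s)" for t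
  have [measurable]: "S \<in> sets borel" by (rule S)
  have "d \<in> borel \<rightarrow>\<^sub>M borel"
    unfolding d_def by measurable
  then have "d \<in> borel \<rightarrow>\<^sub>M borel_on S"
    by (intro measurable_restrict_space2) (use s in \<open>auto simp: d_def\<close>)
  moreover have "(\<lambda>x. e' (e x)) \<in> borel_on S \<rightarrow>\<^sub>M borel"
    by (intro measurable_restrict_space1) simp
  moreover have "d (e' (e x)) = x" if "x \<in> S" for x
    using that by (simp add: d_def d'e' ue)
  ultimately show ?thesis unfolding real_retract_def
    by (intro bexI[of _ "\<lambda>x. e' (e x)"] bexI[of _ d]) (auto simp: space_restrict_space)
qed

section \<open>Generating chains and equality of kernels\<close>

text \<open>The abstract form of the half-lines with rational endpoints: countable, totally ordered
  and hence closed under intersection, so that finite measures can be compared on it.\<close>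

definition borel_chain :: "'a measure \<Rightarrow> (rat \<Rightarrow> 'a set) \<Rightarrow> bool" where
  "borel_chain M G \<longleftrightarrow> sets M = sigma_sets (space M) (range G) \<and> mono G \<and> (\<Union>r. G r) = space M"

lemma borel_chain_sets: "borel_chain M G \<Longrightarrow> G r \<in> sets M"
  by (auto simp: borel_chain_def)

lemma borel_chain_mono: "borel_chain M G \<Longrightarrow> r \<le> s \<Longrightarrow> G r \<subseteq> G s"
  by (simp add: borel_chain_def monoD)

lemma borel_chain_Int_stable:
  assumes "borel_chain M G"
  shows "Int_stable (range G)"
proof (rule Int_stableI_image)
  fix r s
  have "G r \<inter> G s = G (min r s)"
    using borel_chain_mono[OF assms, of r s] borel_chain_mono[OF assms, of s r]
    by (cases "r \<le> s") (auto simp: min_def)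
  then show "\<exists>t\<in>UNIV. G r \<inter> G s = G t" by auto
qed

lemma borel_chain_of_nat:
  assumes "borel_chain M G"
  shows "(\<Union>n. G (of_nat n)) = space M"
proof -
  have "G r \<subseteq> (\<Union>n. G (of_nat n))" for r
  proof -
    obtain n where "(of_rat r :: real) \<le> real n" using real_arch_simple by blast
    then have "r \<le> of_nat n" by (metis of_rat_less_eq of_rat_of_nat_eq)
    then have "G r \<subseteq> G (of_nat n)" by (rule borel_chain_mono[OF assms])
    also have "\<dots> \<subseteq> (\<Union>n. G (of_nat n))" by (rule UN_upper[OF UNIV_I])
    finally show ?thesis .
  qed
  then have "(\<Union>n. G (of_nat n)) = (\<Union>r. G r)" by auto
  then show ?thesis using assms by (simp add: borel_chain_def)
qed

lemma borel_chain_eqI: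
  assumes G: "borel_chain M G" and "sets \<mu> = sets M" "sets \<nu> = sets M" "finite_measure \<mu>"
    and eq: "\<And>r. emeasure \<mu> (G r) = emeasure \<nu> (G r)"
  shows "\<mu> = \<nu>"
proof (rule measure_eqI_generator_eq[where E="range G" and \<Omega>="space M" and A="\<lambda>n. G (of_nat n)"])
  interpret finite_measure \<mu> by fact
  show "emeasure \<mu> (G (of_nat i)) \<noteq> \<infinity>" for i by simp
  show "range G \<subseteq> Pow (space M)"
    using borel_chain_sets[OF G] sets.sets_into_space by blast
qed (use assms borel_chain_Int_stable[OF G] borel_chain_of_nat[OF G] in \<open>auto simp: borel_chain_def\<close>)

text \<open>The preimages of the rational half-lines already make \<open>e\<close> measurable. Since
  \<open>d \<circ> e\<close> is the identity, each measurable set is its own preimage under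
  \<open>d \<circ> e\<close> and therefore lies in the generated \<sigma>-algebra.\<close>

lemma real_retract_chain:
  assumes "e \<in> M \<rightarrow>\<^sub>M (borel :: real measure)" "d \<in> borel \<rightarrow>\<^sub>M M" "\<And>x. x \<in> space M \<Longrightarrow> d (e x) = x"
  shows "borel_chain M (\<lambda>r. {x\<in>space M. e x \<le> of_rat r})" (is "borel_chain M ?G")
proof -
  have [measurable]: "e \<in> M \<rightarrow>\<^sub>M borel" by fact
  define N where "N = sigma (space M) (range ?G)"
  have N: "space N = space M" "sets N = sigma_sets (space M) (range ?G)"
    unfolding N_def by (auto intro!: space_measure_of sets_measure_of)
  have "e \<in> borel_measurable N"
  proof (rule borel_measurableI_le)
    fix y :: real
    have [measurable]: "Measurable.pred N (\<lambda>x. e x \<le> of_rat r)" for r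
      unfolding pred_def N by (intro sigma_sets.Basic) auto
    have "e x \<le> y \<longleftrightarrow> (\<forall>r. y < of_rat r \<longrightarrow> e x \<le> of_rat r)" for x
      by (meson dual_order.strict_trans1 leD le_less_linear of_rat_dense order_less_imp_le)
    then have "{x\<in>space N. e x \<le> y} = {x\<in>space N. \<forall>r. y < of_rat r \<longrightarrow> e x \<le> of_rat r}" by auto
    also have "\<dots> \<in> sets N" by measurable
    finally show "{x\<in>space N. e x \<le> y} \<in> sets N" .
  qed
  then have "d \<circ> e \<in> N \<rightarrow>\<^sub>M M" using assms(2) by (rule measurable_comp)
  then have "A \<in> sets N" if "A \<in> sets M" for A
    using measurable_sets[OF _ that, of "d \<circ> e" N] assms(3) sets.sets_into_space[OF that]
    by (subst (asm) vimage_inter_cong[where g="\<lambda>x. x"]) (auto simp: N Int_absorb2)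
  moreover have "sigma_sets (space M) (range ?G) \<subseteq> sets M"
    by (intro sets.sigma_sets_subset) auto
  ultimately have "sets M = sigma_sets (space M) (range ?G)" using N by auto
  moreover have "mono ?G"
    by (auto simp: mono_def of_rat_less_eq intro: order_trans)
  moreover have "(\<Union>r. ?G r) = space M"
  proof -
    have "\<exists>r. e x \<le> of_rat r" for x
      using of_rat_dense[OF less_add_one[of "e x"]] by (meson less_imp_le)
    then show ?thesis by auto
  qed
  ultimately show ?thesis unfolding borel_chain_def by blast
qed

lemma real_retract_obtain_chain:
  assumes "real_retract M" obtains G where "borel_chain M G"
  using assms real_retract_chain unfolding real_retract_def by blast

abbreviation rat_atMost :: "rat \<Rightarrow> real set" where "rat_atMost r \<equiv> {..of_rat r}"

lemma borel_chain_real: "borel_chain borel rat_atMost"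
  using real_retract_chain[of "\<lambda>x. x" borel "\<lambda>x. x"] by (simp add: atMost_def)

text \<open>A generating chain reduces equality of two probability measures to countably many
  equalities of numbers, each measurable in x. Every Borel condition of the form "p is generated by
  ..." rests on this.\<close>

lemma sets_eq_prob_kernels:
  assumes "real_retract M" and f: "f \<in> N \<rightarrow>\<^sub>M prob_algebra M" and g: "g \<in> N \<rightarrow>\<^sub>M prob_algebra M"
  shows "{x\<in>space N. f x = g x} \<in> sets N"
proof -
  obtain G where G: "borel_chain M G" using real_retract_obtain_chain[OF assms(1)] .
  have "f x = g x \<longleftrightarrow> (\<forall>r. measure (f x) (G r) = measure (g x) (G r))" if "x \<in> space N" for x
  proof
    assume *: "\<forall>r. measure (f x) (G r) = measure (g x) (G r)"
    have fg: "f x \<in> space (prob_algebra M)" "g x \<in> space (prob_algebra M)"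
      using that f g by (auto dest: measurable_space)
    then interpret f: prob_space "f x" + g: prob_space "g x" by (auto simp: space_prob_algebra)
    show "f x = g x"
      using * fg by (intro borel_chain_eqI[OF G])
        (auto simp: space_prob_algebra f.emeasure_eq_measure g.emeasure_eq_measure, unfold_locales)
  qed simp
  then have "{x\<in>space N. f x = g x} =
      {x\<in>space N. \<forall>r. measure (f x) (G r) = measure (g x) (G r)}" by auto
  also have "\<dots> \<in> sets N"
  proof -
    have [measurable]: "(\<lambda>x. measure (h x) (G r)) \<in> borel_measurable N" if "h \<in> N \<rightarrow>\<^sub>M prob_algebra M" for h r
      using measurable_compose[OF that measurable_measure_prob_algebra[OF borel_chain_sets[OF G]]] .
    note f[measurable] g[measurable]
    show ?thesis by measurable
  qed
  finally show ?thesis .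
qed

section \<open>Distribution functions and quantiles\<close>

text \<open>The generalized inverse of a distribution function that is known at rational points
  only. The extended reals allow an infinite infimum; \<open>real_of_ereal\<close> makes the value
  real for arbitrary F.\<close>

definition quantile :: "(rat \<Rightarrow> real) \<Rightarrow> real \<Rightarrow> real" where
  "quantile F u = real_of_ereal (INF r. if u \<le> F r then ereal (of_rat r) else \<infinity>)"

abbreviation uniform01 :: "real measure" where
  "uniform01 \<equiv> restrict_space lborel {0<..<1}"

lemma prob_space_uniform01: "prob_space uniform01"
  by (rule prob_spaceI) (simp add: emeasure_restrict_space space_restrict_space)

text \<open>A probability measure for every F whatsoever. This makes the Polish space of all
  functions from the rationals to the reals a measurable parameter space for the probability
  measures on the line; the map is onto by \<open>cdf_kernel_measure\<close>.\<close>

definition cdf_kernel :: "(rat \<Rightarrow> real) \<Rightarrow> real measure" where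
  "cdf_kernel F = distr uniform01 borel (quantile F)"

lemma measurable_quantile:
  "(\<lambda>(F, u). quantile F u) \<in> borel \<Otimes>\<^sub>M uniform01 \<rightarrow>\<^sub>M borel"
proof -
  have [measurable]: "(\<lambda>F. F r) \<in> borel_measurable (borel :: (rat \<Rightarrow> real) measure)" for r
    by (rule measurable_product_coordinates)
  have [measurable]: "(\<lambda>u. u) \<in> uniform01 \<rightarrow>\<^sub>M borel"
    by (intro measurable_restrict_space1) simp
  show ?thesis unfolding quantile_def split_beta by measurable
qed

lemma measurable_cdf_kernel: "cdf_kernel \<in> borel \<rightarrow>\<^sub>M prob_algebra borel"
  unfolding cdf_kernel_def
  by (rule measurable_distr_prob_space2[where M=uniform01])
     (use measurable_quantile prob_space_uniform01 in \<open>auto simp: space_prob_algebra\<close>)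

text \<open>For a monotone F, right continuity and the two limits amount to the existence of a
  single good rational for each \<epsilon>, the form that can be verified almost surely.\<close>

definition rat_cdf :: "(rat \<Rightarrow> real) \<Rightarrow> bool" where
  "rat_cdf F \<longleftrightarrow> mono F \<and> (\<forall>r. 0 \<le> F r \<and> F r \<le> 1) \<and> (\<forall>r. \<forall>\<epsilon>>0. \<exists>s>r. F s < F r + \<epsilon>) \<and>
     (\<forall>\<epsilon>>0. \<exists>r. F r < \<epsilon>) \<and> (\<forall>\<epsilon>>0. \<exists>r. 1 - \<epsilon> < F r)"

text \<open>The Galois connection between F and its generalized inverse. Right continuity gives the
  direction from left to right.\<close>

lemma quantile_le_iff:
  assumes F: "rat_cdf F" and u: "0 < u" "u < 1"
  shows "quantile F u \<le> of_rat r \<longleftrightarrow> u \<le> F r"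
proof -
  let ?h = "\<lambda>r. if u \<le> F r then ereal (of_rat r) else \<infinity>"
  define I where "I = (INF r. ?h r)"
  have mono: "r \<le> s \<Longrightarrow> F r \<le> F s" for r s using F by (auto simp: rat_cdf_def mono_def)
  \<comment> \<open>The rationals a and b, with F a < u \<le> F b, enclose the infimum, so it is
    finite and \<open>real_of_ereal\<close> loses nothing.\<close>
  obtain a where a: "F a < u" using F u by (auto simp: rat_cdf_def)
  obtain b where b: "u \<le> F b"
  proof -
    obtain b where "1 - (1 - u) < F b" using F u unfolding rat_cdf_def by (meson diff_gt_0_iff_gt)
    then have "u \<le> F b" by simp
    then show thesis by (rule that)
  qed
  have "ereal (of_rat a) \<le> I"
    unfolding I_def
  proof (rule INF_greatest)
    fix s show "ereal (of_rat a) \<le> ?h s"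
      using mono[of s a] a by (cases "s \<le> a") (auto simp: of_rat_less_eq)
  qed
  moreover have "I \<le> ereal (of_rat b)"
    unfolding I_def using b by (intro INF_lower2[of b]) auto
  ultimately have I: "ereal (quantile F u) = I"
    unfolding quantile_def I_def[symmetric] by (cases I) auto
  show ?thesis
  proof
    assume "u \<le> F r"
    then have "I \<le> ereal (of_rat r)" unfolding I_def by (intro INF_lower2[of r]) auto
    then show "quantile F u \<le> of_rat r" unfolding I[symmetric] by simp
  next
    assume le: "quantile F u \<le> of_rat r"
    show "u \<le> F r"
    proof (rule ccontr)
      assume "\<not> u \<le> F r"
      then have "0 < u - F r" by simp
      then obtain s where s: "s > r" "F s < F r + (u - F r)" using F unfolding rat_cdf_def by blast
      have "I < ereal (of_rat s)"
        using le s(1) unfolding I[symmetric] by (simp add: of_rat_less order_le_less_trans)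
      then obtain t where "?h t < ereal (of_rat s)" unfolding I_def INF_less_iff by auto
      then have "t < s" "u \<le> F t" by (auto simp: of_rat_less split: if_splits)
      with mono[of t s] s show False by simp
    qed
  qed
qed

lemma emeasure_cdf_kernel:
  assumes F: "rat_cdf F"
  shows "emeasure (cdf_kernel F) (rat_atMost r) = ennreal (F r)"
proof -
  have "quantile F \<in> uniform01 \<rightarrow>\<^sub>M borel"
    using measurable_Pair2[OF measurable_quantile, of F] by simp
  then have "emeasure (cdf_kernel F) (rat_atMost r) = emeasure uniform01 (quantile F -` rat_atMost r \<inter> {0<..<1})"
    unfolding cdf_kernel_def by (subst emeasure_distr) (auto simp: space_restrict_space)
  \<comment> \<open>The base measure lives on the open interval; if F r = 1, the endpoint 1 has to
    be taken out, and it is a null set.\<close>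
  also have "quantile F -` rat_atMost r \<inter> {0<..<1} = {0<..F r} - {1}"
  proof -
    have "F r \<le> 1" using F by (simp add: rat_cdf_def)
    then show ?thesis using quantile_le_iff[OF F] by (auto simp: less_le)
  qed
  also have "emeasure uniform01 \<dots> = emeasure lborel ({0<..F r} - {1})"
  proof -
    have "F r \<le> 1" using F by (simp add: rat_cdf_def)
    then show ?thesis by (subst emeasure_restrict_space) (auto simp: less_le)
  qed
  also have "\<dots> = emeasure lborel {0<..F r}"
    by (rule emeasure_Diff_null_set) auto
  also have "\<dots> = ennreal (F r)" using F by (simp add: rat_cdf_def)
  finally show ?thesis .
qed

lemma rat_cdf_measure:
  assumes "m \<in> space (prob_algebra borel)"
  shows "rat_cdf (\<lambda>r. measure m (rat_atMost r))"
proof -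
  interpret real_distribution m
    using assms by (auto simp: real_distribution_def real_distribution_axioms_def space_prob_algebra)
  have "\<exists>s>r. cdf m (of_rat s) < cdf m (of_rat r) + \<epsilon>" if "\<epsilon> > 0" for r \<epsilon>
  proof -
    have "(cdf m \<longlongrightarrow> cdf m (of_rat r)) (at_right (of_rat r))"
      using cdf_is_right_cont[of "of_rat r"] by (simp add: continuous_within)
    then have "\<forall>\<^sub>F x in at_right (of_rat r). cdf m x < cdf m (of_rat r) + \<epsilon>"
      using that by (intro order_tendstoD) auto
    then obtain b where b: "of_rat r < b" "\<And>y. of_rat r < y \<Longrightarrow> y < b \<Longrightarrow> cdf m y < cdf m (of_rat r) + \<epsilon>"
      unfolding eventually_at_right_field by blast
    obtain s where "of_rat r < (of_rat s :: real)" "of_rat s < b" using of_rat_dense[OF b(1)] by blast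
    with b(2) show ?thesis by (auto simp: of_rat_less)
  qed
  moreover have "\<exists>r. cdf m (of_rat r) < \<epsilon>" if "\<epsilon> > 0" for \<epsilon>
  proof -
    have "\<forall>\<^sub>F x in at_bot. cdf m x < \<epsilon>" using cdf_lim_at_bot that by (rule order_tendstoD)
    then obtain x where x: "\<And>y. y \<le> x \<Longrightarrow> cdf m y < \<epsilon>" unfolding eventually_at_bot_linorder by blast
    obtain r where "x - 1 < of_rat r" "of_rat r < x" using of_rat_dense[of "x - 1" x] by auto
    with x show ?thesis by (meson less_imp_le)
  qed
  moreover have "\<exists>r. 1 - \<epsilon> < cdf m (of_rat r)" if "\<epsilon> > 0" for \<epsilon>
  proof -
    have "\<forall>\<^sub>F x in at_top. 1 - \<epsilon> < cdf m x"
      using that by (intro order_tendstoD(1)[OF cdf_lim_at_top_prob]) simp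
    then obtain x where x: "\<And>y. x \<le> y \<Longrightarrow> 1 - \<epsilon> < cdf m y" unfolding eventually_at_top_linorder by blast
    obtain r where "x < of_rat r" "of_rat r < x + 1" using of_rat_dense[of x "x + 1"] by auto
    with x show ?thesis by (meson less_imp_le)
  qed
  ultimately show ?thesis
    unfolding rat_cdf_def cdf_def by (auto simp: mono_def of_rat_less_eq intro!: finite_measure_mono)
qed

lemma cdf_kernel_measure:
  assumes "m \<in> space (prob_algebra borel)"
  shows "cdf_kernel (\<lambda>r. measure m (rat_atMost r)) = m"
proof -
  interpret prob_space m using assms by (simp add: space_prob_algebra)
  let ?F = "\<lambda>r. measure m (rat_atMost r)"
  have "cdf_kernel ?F \<in> space (prob_algebra borel)"
    by (rule measurable_space[OF measurable_cdf_kernel]) simp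
  then show ?thesis using assms
    by (intro borel_chain_eqI[OF borel_chain_real])
       (auto simp: emeasure_cdf_kernel[OF rat_cdf_measure[OF assms]] emeasure_eq_measure
         space_prob_algebra prob_space.finite_measure)
qed

section \<open>Regression and measurable disintegration\<close>

text \<open>Rational coefficients and thresholds make these lists a countable type, so
  \<open>from_nat\<close> enumerates all the regression functions. \<open>None\<close> stands for
  the constant function, from which complements are formed.\<close>

definition step_fun :: "(rat \<times> rat option) list \<Rightarrow> real \<Rightarrow> real" where
  "step_fun l x =
     (\<Sum>(c, t)\<leftarrow>l. of_rat c * indicator (case t of None \<Rightarrow> UNIV | Some r \<Rightarrow> rat_atMost r) x)"

lemma step_fun_Nil [simp]: "step_fun [] x = 0"
  and step_fun_append: "step_fun (l @ l') x = step_fun l x + step_fun l' x"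
  and step_fun_scale: "step_fun (map (\<lambda>(c, t). (q * c, t)) l) x = of_rat q * step_fun l x"
  by (induction l) (auto simp: step_fun_def of_rat_mult algebra_simps)

lemma measurable_step_fun [measurable]: "step_fun l \<in> borel_measurable borel"
proof (induction l)
  case (Cons ct l)
  obtain c t where "ct = (c, t)" by fastforce
  then have "step_fun (ct # l) = (\<lambda>x. of_rat c * indicator (case t of None \<Rightarrow> UNIV | Some r \<Rightarrow> rat_atMost r) x + step_fun l x)"
    by (simp add: step_fun_def fun_eq_iff)
  moreover have [measurable]: "(case t of None \<Rightarrow> UNIV | Some r \<Rightarrow> rat_atMost r) \<in> sets borel"
    by (cases t) auto
  ultimately show ?case using Cons by simp
qed (simp add: step_fun_def)

lemma step_fun_bounded: "\<exists>B. \<forall>x. \<bar>step_fun l x\<bar> \<le> B"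
proof (induction l)
  case (Cons ct l)
  then obtain B where B: "\<bar>step_fun l x\<bar> \<le> B" for x by blast
  obtain c t where ct: "ct = (c, t)" by fastforce
  have "\<bar>step_fun (ct # l) x\<bar> \<le> \<bar>of_rat c\<bar> + B" for x
  proof -
    have "\<bar>of_rat c * indicator (case t of None \<Rightarrow> UNIV | Some r \<Rightarrow> rat_atMost r) x\<bar> \<le> \<bar>of_rat c :: real\<bar>"
      by (simp add: indicator_def)
    then show ?thesis using B[of x] by (simp add: step_fun_def ct)
  qed
  then show ?case by blast
qed (simp add: step_fun_def exI[of _ 0])

section \<open>Mean square approximation by step functions\<close>

lemma nn_integral_square_add:
  fixes a b :: "'a \<Rightarrow> real"
  assumes [measurable]: "a \<in> borel_measurable M" "b \<in> borel_measurable M"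
  shows "(\<integral>\<^sup>+z. ennreal ((a z + b z)\<^sup>2) \<partial>M) \<le>
    2 * (\<integral>\<^sup>+z. ennreal ((a z)\<^sup>2) \<partial>M) + 2 * (\<integral>\<^sup>+z. ennreal ((b z)\<^sup>2) \<partial>M)"
proof -
  have "(x + y)\<^sup>2 \<le> 2 * x\<^sup>2 + 2 * y\<^sup>2" for x y :: real
    using sum_squares_bound[of x y] by (simp add: power2_sum)
  then have "ennreal ((x + y)\<^sup>2) \<le> ennreal (2 * x\<^sup>2 + 2 * y\<^sup>2)" for x y :: real
    by (intro ennreal_leI)
  moreover have "ennreal (2 * x\<^sup>2 + 2 * y\<^sup>2) = 2 * ennreal (x\<^sup>2) + 2 * ennreal (y\<^sup>2)" for x y :: real
    by (simp add: ennreal_mult')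
  ultimately have "ennreal ((x + y)\<^sup>2) \<le> 2 * ennreal (x\<^sup>2) + 2 * ennreal (y\<^sup>2)" for x y :: real
    by simp
  then have "(\<integral>\<^sup>+z. ennreal ((a z + b z)\<^sup>2) \<partial>M) \<le> (\<integral>\<^sup>+z. 2 * ennreal ((a z)\<^sup>2) + 2 * ennreal ((b z)\<^sup>2) \<partial>M)"
    by (intro nn_integral_mono)
  also have "\<dots> = 2 * (\<integral>\<^sup>+z. ennreal ((a z)\<^sup>2) \<partial>M) + 2 * (\<integral>\<^sup>+z. ennreal ((b z)\<^sup>2) \<partial>M)"
    by (simp add: nn_integral_add nn_integral_cmult)
  finally show ?thesis .
qed

lemma ennreal_quarters: "\<epsilon> > 0 \<Longrightarrow> 2 * ennreal (\<epsilon>/4) + 2 * ennreal (\<epsilon>/4) = ennreal \<epsilon>"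
proof -
  assume "\<epsilon> > 0"
  then show ?thesis by (simp add: mult_2 flip: ennreal_plus)
qed

text \<open>Membership of H in the mean square closure of the step functions of \<phi>.\<close>

definition l2_approx :: "'a measure \<Rightarrow> ('a \<Rightarrow> real) \<Rightarrow> ('a \<Rightarrow> real) \<Rightarrow> bool" where
  "l2_approx M \<phi> H \<longleftrightarrow> H \<in> borel_measurable M \<and>
     (\<forall>\<epsilon>>0. \<exists>l. (\<integral>\<^sup>+z. ennreal ((step_fun l (\<phi> z) - H z)\<^sup>2) \<partial>M) \<le> ennreal \<epsilon>)"

context
  fixes M :: "'a measure" and \<phi> :: "'a \<Rightarrow> real"
  assumes M: "prob_space M" and \<phi> [measurable]: "\<phi> \<in> borel_measurable M"
begin

interpretation prob_space M by (rule M)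

lemma l2_approx_step: "l2_approx M \<phi> (\<lambda>z. step_fun l (\<phi> z))"
  unfolding l2_approx_def by (auto intro!: exI[of _ l])

lemma l2_approx_add:
  assumes "l2_approx M \<phi> H" "l2_approx M \<phi> H'"
  shows "l2_approx M \<phi> (\<lambda>z. H z + H' z)"
proof -
  have [measurable]: "H \<in> borel_measurable M" "H' \<in> borel_measurable M"
    using assms by (auto simp: l2_approx_def)
  have "\<exists>l. (\<integral>\<^sup>+z. ennreal ((step_fun l (\<phi> z) - (H z + H' z))\<^sup>2) \<partial>M) \<le> ennreal \<epsilon>" if "\<epsilon> > 0" for \<epsilon>
  proof -
    from that have "\<epsilon>/4 > 0" by simp
    then obtain l l' where
      l: "(\<integral>\<^sup>+z. ennreal ((step_fun l (\<phi> z) - H z)\<^sup>2) \<partial>M) \<le> ennreal (\<epsilon>/4)" and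
      l': "(\<integral>\<^sup>+z. ennreal ((step_fun l' (\<phi> z) - H' z)\<^sup>2) \<partial>M) \<le> ennreal (\<epsilon>/4)"
      using assms unfolding l2_approx_def by meson
    have "(\<integral>\<^sup>+z. ennreal ((step_fun (l @ l') (\<phi> z) - (H z + H' z))\<^sup>2) \<partial>M) =
        (\<integral>\<^sup>+z. ennreal (((step_fun l (\<phi> z) - H z) + (step_fun l' (\<phi> z) - H' z))\<^sup>2) \<partial>M)"
      by (simp add: step_fun_append algebra_simps)
    also have "\<dots> \<le> 2 * (\<integral>\<^sup>+z. ennreal ((step_fun l (\<phi> z) - H z)\<^sup>2) \<partial>M) +
        2 * (\<integral>\<^sup>+z. ennreal ((step_fun l' (\<phi> z) - H' z)\<^sup>2) \<partial>M)"
      by (rule nn_integral_square_add) auto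
    also have "\<dots> \<le> 2 * ennreal (\<epsilon>/4) + 2 * ennreal (\<epsilon>/4)"
      by (intro add_mono mult_left_mono l l') auto
    finally show ?thesis unfolding ennreal_quarters[OF that] by blast
  qed
  then show ?thesis unfolding l2_approx_def by auto
qed

lemma l2_approx_limit:
  assumes [measurable]: "H \<in> borel_measurable M"
    and lim: "\<And>\<epsilon>. \<epsilon> > 0 \<Longrightarrow> \<exists>H'. l2_approx M \<phi> H' \<and> (\<integral>\<^sup>+z. ennreal ((H' z - H z)\<^sup>2) \<partial>M) \<le> ennreal \<epsilon>"
  shows "l2_approx M \<phi> H"
proof -
  have "\<exists>l. (\<integral>\<^sup>+z. ennreal ((step_fun l (\<phi> z) - H z)\<^sup>2) \<partial>M) \<le> ennreal \<epsilon>" if "\<epsilon> > 0" for \<epsilon>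
  proof -
    from that have \<epsilon>: "\<epsilon>/4 > 0" by simp
    obtain H' where H': "l2_approx M \<phi> H'" "(\<integral>\<^sup>+z. ennreal ((H' z - H z)\<^sup>2) \<partial>M) \<le> ennreal (\<epsilon>/4)"
      using lim[OF \<epsilon>] by blast
    then obtain l where l: "(\<integral>\<^sup>+z. ennreal ((step_fun l (\<phi> z) - H' z)\<^sup>2) \<partial>M) \<le> ennreal (\<epsilon>/4)"
      using \<epsilon> unfolding l2_approx_def by blast
    have [measurable]: "H' \<in> borel_measurable M" using H' by (auto simp: l2_approx_def)
    have "(\<integral>\<^sup>+z. ennreal ((step_fun l (\<phi> z) - H z)\<^sup>2) \<partial>M) =
        (\<integral>\<^sup>+z. ennreal (((step_fun l (\<phi> z) - H' z) + (H' z - H z))\<^sup>2) \<partial>M)"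
      by simp
    also have "\<dots> \<le> 2 * (\<integral>\<^sup>+z. ennreal ((step_fun l (\<phi> z) - H' z)\<^sup>2) \<partial>M) +
        2 * (\<integral>\<^sup>+z. ennreal ((H' z - H z)\<^sup>2) \<partial>M)"
      by (rule nn_integral_square_add) auto
    also have "\<dots> \<le> 2 * ennreal (\<epsilon>/4) + 2 * ennreal (\<epsilon>/4)"
      by (intro add_mono mult_left_mono l H') auto
    finally show ?thesis unfolding ennreal_quarters[OF that] by blast
  qed
  then show ?thesis unfolding l2_approx_def by auto
qed

lemma l2_approx_scale:
  assumes "l2_approx M \<phi> H"
  shows "l2_approx M \<phi> (\<lambda>z. of_rat q * H z)"
proof -
  have [measurable]: "H \<in> borel_measurable M"
    using assms by (auto simp: l2_approx_def)
  have "\<exists>l. (\<integral>\<^sup>+z. ennreal ((step_fun l (\<phi> z) - of_rat q * H z)\<^sup>2) \<partial>M) \<le> ennreal \<epsilon>" if "\<epsilon> > 0" for \<epsilon>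
  proof -
    define Q where "Q = (of_rat q :: real)\<^sup>2"
    have Q: "0 \<le> Q" by (simp add: Q_def)
    with that have "\<epsilon> / (Q + 1) > 0" by simp
    then obtain l where l: "(\<integral>\<^sup>+z. ennreal ((step_fun l (\<phi> z) - H z)\<^sup>2) \<partial>M) \<le> ennreal (\<epsilon> / (Q + 1))"
      using assms unfolding l2_approx_def by meson
    define l' where "l' = map (\<lambda>(c, t). (q * c, t)) l"
    have "(step_fun l' (\<phi> z) - of_rat q * H z)\<^sup>2 = Q * (step_fun l (\<phi> z) - H z)\<^sup>2" for z
      unfolding l'_def step_fun_scale Q_def power_mult_distrib[symmetric] by (simp add: algebra_simps)
    then have "(\<integral>\<^sup>+z. ennreal ((step_fun l' (\<phi> z) - of_rat q * H z)\<^sup>2) \<partial>M)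
       = ennreal Q * (\<integral>\<^sup>+z. ennreal ((step_fun l (\<phi> z) - H z)\<^sup>2) \<partial>M)"
      using Q by (simp add: ennreal_mult' nn_integral_cmult)
    also have "\<dots> \<le> ennreal Q * ennreal (\<epsilon> / (Q + 1))"
      by (intro mult_left_mono l) auto
    also have "\<dots> = ennreal (Q * (\<epsilon> / (Q + 1)))"
      by (rule ennreal_mult'[symmetric, OF Q])
    also have "\<dots> \<le> ennreal \<epsilon>"
      using Q that by (intro ennreal_leI) (simp add: field_simps)
    finally show ?thesis by blast
  qed
  then show ?thesis unfolding l2_approx_def by auto
qed

lemma l2_approx_sum:
  assumes "finite I" "\<And>i. i \<in> I \<Longrightarrow> l2_approx M \<phi> (H i)"
  shows "l2_approx M \<phi> (\<lambda>z. \<Sum>i\<in>I. H i z)"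
  using assms
proof (induction I rule: finite_induct)
  case empty
  then show ?case using l2_approx_step[of "[]"] by simp
next
  case (insert i I)
  then show ?case using l2_approx_add[of "H i" "\<lambda>z. \<Sum>i\<in>I. H i z"] by simp
qed

text \<open>A Dynkin system argument from the rational half-lines. For a disjoint union, finite
  partial unions suffice up to \<epsilon>, by continuity from below of the image measure of
  \<phi>.\<close>

lemma l2_approx_indicator:
  assumes "B \<in> sets borel"
  shows "l2_approx M \<phi> (\<lambda>z. indicator B (\<phi> z))"
proof -
  have B: "B \<in> sigma_sets UNIV (range rat_atMost)"
    using assms borel_chain_real unfolding borel_chain_def by simp
  have sets: "A \<in> sets borel" if "A \<in> sigma_sets UNIV (range rat_atMost)" for A
    using that borel_chain_real unfolding borel_chain_def by simp
  have "range rat_atMost \<subseteq> Pow UNIV" by simp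
  from borel_chain_Int_stable[OF borel_chain_real] this B show ?thesis
  proof (induction rule: sigma_sets_induct_disjoint)
    case (basic A)
    then obtain r where "A = rat_atMost r" by auto
    then show ?case using l2_approx_step[of "[(1, Some r)]"] by (simp add: step_fun_def)
  next
    case empty
    then show ?case using l2_approx_step[of "[]"] by simp
  next
    case (compl A)
    have "l2_approx M \<phi> (\<lambda>z. step_fun [(1, None)] (\<phi> z) + of_rat (-1) * indicator A (\<phi> z))"
      by (intro l2_approx_add l2_approx_step l2_approx_scale compl)
    then show ?case by (simp add: step_fun_def indicator_diff)
  next
    case (union A)
    have [measurable]: "A i \<in> sets borel" for i using union(2) sets by blast
    define \<mu> where "\<mu> = distr M borel \<phi>"
    interpret \<mu>: prob_space \<mu> unfolding \<mu>_def by (rule prob_space_distr) simp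
    have sets_\<mu>: "sets \<mu> = sets borel" by (simp add: \<mu>_def)
    define U where "U n = (\<Union>i<n. A i)" for n
    have U [measurable]: "U n \<in> sets borel" for n unfolding U_def by measurable
    have UU: "(\<Union>n. U n) = (\<Union>i. A i)" unfolding U_def by auto
    have inc: "incseq U" unfolding incseq_def U_def by (intro allI impI UN_mono) auto
    have lim: "(\<lambda>n. measure \<mu> (U n)) \<longlonglongrightarrow> measure \<mu> (\<Union>i. A i)"
      unfolding UU[symmetric]
      by (intro \<mu>.finite_Lim_measure_incseq) (use inc in \<open>auto simp: sets_\<mu>\<close>)
    show ?case
    proof (rule l2_approx_limit)
      fix \<epsilon> :: real assume "\<epsilon> > 0"
      then obtain n where "measure \<mu> (\<Union>i. A i) - \<epsilon> < measure \<mu> (U n)"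
        using order_tendstoD(1)[OF lim, of "measure \<mu> (\<Union>i. A i) - \<epsilon>"] by (auto simp: eventually_sequentially)
      then have le: "measure \<mu> ((\<Union>i. A i) - U n) \<le> \<epsilon>"
        by (subst \<mu>.finite_measure_Diff) (auto simp: sets_\<mu> U_def)
      have ind: "(\<Sum>i<n. indicator (A i) x) = (indicator (U n) x :: real)" for x
        unfolding U_def using union(1)
        by (intro indicator_UN_disjoint[symmetric]) (auto intro: disjoint_family_on_mono)
      have "l2_approx M \<phi> (\<lambda>z. indicator (U n) (\<phi> z))"
        unfolding ind[symmetric] by (intro l2_approx_sum union) auto
      moreover have "(\<integral>\<^sup>+z. ennreal ((indicator (U n) (\<phi> z) - indicator (\<Union>i. A i) (\<phi> z))\<^sup>2) \<partial>M) =
        (\<integral>\<^sup>+z. indicator ((\<Union>i. A i) - U n) (\<phi> z) \<partial>M)"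
        by (intro nn_integral_cong) (auto simp: indicator_def U_def)
      moreover have "\<dots> = emeasure \<mu> ((\<Union>i. A i) - U n)"
        unfolding \<mu>_def by (subst nn_integral_indicator[symmetric], simp, subst nn_integral_distr) simp_all
      moreover have "\<dots> \<le> ennreal \<epsilon>" using le by (simp add: \<mu>.emeasure_eq_measure ennreal_leI)
      ultimately show "\<exists>H'. l2_approx M \<phi> H' \<and>
         (\<integral>\<^sup>+z. ennreal ((H' z - indicator (\<Union>i. A i) (\<phi> z))\<^sup>2) \<partial>M) \<le> ennreal \<epsilon>"
        by (intro exI[of _ "\<lambda>z. indicator (U n) (\<phi> z)"]) simp
    next
      have "(\<Union>i. A i) \<in> sets borel" by measurable
      then show "(\<lambda>z. indicat_real (\<Union>i. A i) (\<phi> z)) \<in> borel_measurable M"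
        by (intro measurable_compose[OF \<phi> borel_measurable_indicator])
    qed
  qed
qed

text \<open>Each level set of H is the preimage under \<phi> of a Borel set. Averaging the
  indicators of the levels k/N, for k from 1 to N, yields floor (N * H) / N, which is within 1/N of
  H.\<close>

lemma l2_approx_unit_interval:
  assumes H: "H \<in> borel_measurable (vimage_algebra (space M) \<phi> borel)"
    and H01: "\<And>z. 0 \<le> H z" "\<And>z. H z \<le> (1::real)"
  shows "l2_approx M \<phi> H"
proof (rule l2_approx_limit)
  have sub: "sets (vimage_algebra (space M) \<phi> borel) \<subseteq> sets M"
    by (rule sets_image_in_sets) auto
  show "H \<in> borel_measurable M"
    using H by (rule measurable_mono[OF order_refl _ sub, THEN subsetD, rotated -1]) auto
  fix \<epsilon> :: real assume "\<epsilon> > 0"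
  then obtain n where n: "inverse (real (Suc n)) < \<epsilon>" using reals_Archimedean by blast
  define N where "N = Suc n"
  have "\<exists>B. B \<in> sets borel \<and> {z\<in>space M. real k / N \<le> H z} = \<phi> -` B \<inter> space M" for k :: nat
  proof -
    have "{z\<in>space (vimage_algebra (space M) \<phi> borel). real k / N \<le> H z} \<in> sets (vimage_algebra (space M) \<phi> borel)"
      using H by measurable
    then show ?thesis by (auto simp: sets_vimage_algebra2)
  qed
  then obtain B where B: "\<And>k::nat. B k \<in> sets borel"
    "\<And>k. {z\<in>space M. real k / N \<le> H z} = \<phi> -` B k \<inter> space M" by metis
  define H' where "H' z = of_rat (1 / of_nat N) * (\<Sum>k\<in>{1..N}. indicat_real (B k) (\<phi> z))" for z
  have "l2_approx M \<phi> H'"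
    unfolding H'_def by (intro l2_approx_scale l2_approx_sum l2_approx_indicator B) auto
  moreover have "(\<integral>\<^sup>+z. ennreal ((H' z - H z)\<^sup>2) \<partial>M) \<le> (\<integral>\<^sup>+z. ennreal \<epsilon> \<partial>M)"
  proof (intro nn_integral_mono ennreal_leI)
    fix z assume z: "z \<in> space M"
    define y where "y = real N * H z"
    have y: "0 \<le> y" "y \<le> N" using H01[of z] by (auto simp: y_def mult_left_le)
    have "indicator (B k) (\<phi> z) = (of_bool (real k \<le> y) :: real)" for k
      using B(2)[of k] z by (auto simp: y_def N_def field_simps indicator_def set_eq_iff)
    then have "(\<Sum>k\<in>{1..N}. indicator (B k) (\<phi> z)) = real (card {k\<in>{1..N}. real k \<le> y})"
      by (simp add: sum.If_cases Int_def of_bool_def)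
    also have "{k\<in>{1..N}. real k \<le> y} = {1..nat \<lfloor>y\<rfloor>}"
      using y by (auto simp: le_nat_floor le_nat_iff le_floor_iff nat_le_iff)
    finally have H': "H' z = real_of_int \<lfloor>y\<rfloor> / N"
      using y by (simp add: H'_def of_rat_divide)
    have "H z = y / N" by (simp add: y_def N_def)
    then have "\<bar>H' z - H z\<bar> = \<bar>of_int \<lfloor>y\<rfloor> - y\<bar> / N"
      unfolding H' by (simp add: diff_divide_distrib[symmetric] abs_divide)
    also have "\<dots> \<le> 1 / N" by (intro divide_right_mono) linarith+
    finally have le: "\<bar>H' z - H z\<bar> \<le> 1 / N" .
    then have "(H' z - H z)\<^sup>2 \<le> (1 / N)\<^sup>2" by (metis abs_ge_zero power2_abs power_mono)
    also have "(1 / real N)\<^sup>2 = 1 / N * (1 / N)" by (rule power2_eq_square)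
    also have "\<dots> \<le> 1 * (1 / N)" by (rule mult_right_mono) (auto simp: N_def)
    finally have "(H' z - H z)\<^sup>2 \<le> 1 / N" by simp
    also have "\<dots> \<le> \<epsilon>" using n by (simp add: N_def inverse_eq_divide)
    finally show "(H' z - H z)\<^sup>2 \<le> \<epsilon>" .
  qed
  ultimately show "\<exists>H'. l2_approx M \<phi> H' \<and> (\<integral>\<^sup>+z. ennreal ((H' z - H z)\<^sup>2) \<partial>M) \<le> ennreal \<epsilon>"
    by (intro exI[of _ H']) (simp add: emeasure_space_1)
qed

end

section \<open>Least squares and conditional expectations\<close>

text \<open>The squared errors have a finite total integral, so their sum is finite almost
  everywhere and its terms tend to 0. The geometric rate is what spares the passage to a
  subsequence, which would have to be chosen measurably in the measure.\<close>

lemma AE_tendsto_of_l2_geometric: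
  fixes f :: "nat \<Rightarrow> 'a \<Rightarrow> real"
  assumes [measurable]: "\<And>j. f j \<in> borel_measurable M" "H \<in> borel_measurable M"
    and le: "\<And>j. (\<integral>\<^sup>+z. ennreal ((f j z - H z)\<^sup>2) \<partial>M) \<le> ennreal ((1/4)^j)"
  shows "AE z in M. (\<lambda>j. f j z) \<longlonglongrightarrow> H z"
proof -
  have "(\<integral>\<^sup>+z. (\<Sum>j. ennreal ((f j z - H z)\<^sup>2)) \<partial>M) = (\<Sum>j. \<integral>\<^sup>+z. ennreal ((f j z - H z)\<^sup>2) \<partial>M)"
    by (rule nn_integral_suminf) simp
  also have "\<dots> \<le> (\<Sum>j. ennreal ((1/4)^j))"
    by (intro suminf_le le) auto
  also have "\<dots> = ennreal (\<Sum>j. (1/4)^j)"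
    by (rule suminf_ennreal2) (simp_all add: summable_geometric)
  also have "\<dots> < \<infinity>" by simp
  finally have "(\<integral>\<^sup>+z. (\<Sum>j. ennreal ((f j z - H z)\<^sup>2)) \<partial>M) \<noteq> \<infinity>"
    by simp
  then have "AE z in M. (\<Sum>j. ennreal ((f j z - H z)\<^sup>2)) \<noteq> \<infinity>"
    by (intro nn_integral_PInf_AE) auto
  then show ?thesis
  proof eventually_elim
    case (elim z)
    then have "summable (\<lambda>j. (f j z - H z)\<^sup>2)"
      by (intro summable_suminf_not_top) auto
    then have "(\<lambda>j. (f j z - H z)\<^sup>2) \<longlonglongrightarrow> 0" by (rule summable_LIMSEQ_zero)
    then have "(\<lambda>j. sqrt ((f j z - H z)\<^sup>2)) \<longlonglongrightarrow> sqrt 0" by (rule tendsto_real_sqrt)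
    then have "(\<lambda>j. f j z - H z) \<longlonglongrightarrow> 0" by (simp add: tendsto_rabs_zero_iff)
    then show ?case by (rule LIM_zero_cancel)
  qed
qed

text \<open>Clipping gives another version of the conditional expectation when Y has values in the
  unit interval, and its bounds hold at every point instead of almost everywhere.\<close>

definition cond_exp01 :: "'a measure \<Rightarrow> ('a \<Rightarrow> real) \<Rightarrow> ('a \<Rightarrow> real) \<Rightarrow> 'a \<Rightarrow> real" where
  "cond_exp01 M \<phi> Y z = max 0 (min 1 (real_cond_exp M (vimage_algebra (space M) \<phi> borel) Y z))"

lemma cond_exp01_bounds: "0 \<le> cond_exp01 M \<phi> Y z" "cond_exp01 M \<phi> Y z \<le> 1"
  by (auto simp: cond_exp01_def)

context
  fixes M :: "'a measure" and \<phi> :: "'a \<Rightarrow> real"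
  assumes M: "prob_space M" and \<phi> [measurable]: "\<phi> \<in> borel_measurable M"
begin

interpretation prob_space M by (rule M)

lemma subalgebra_vimage: "subalgebra M (vimage_algebra (space M) \<phi> borel)"
  unfolding subalgebra_def using sets_image_in_sets[OF _ \<phi>] by simp

interpretation finite_measure_subalgebra M "vimage_algebra (space M) \<phi> borel"
  by unfold_locales (rule subalgebra_vimage)

lemma measurable_cond_exp01_vimage:
  "cond_exp01 M \<phi> Y \<in> borel_measurable (vimage_algebra (space M) \<phi> borel)"
  unfolding cond_exp01_def by measurable

lemma measurable_cond_exp01 [measurable]: "cond_exp01 M \<phi> Y \<in> borel_measurable M"
  by (rule measurable_from_subalg[OF subalgebra_vimage measurable_cond_exp01_vimage])

lemma AE_cond_exp01:
  assumes [measurable]: "Y \<in> borel_measurable M" and Y01: "\<And>z. 0 \<le> Y z" "\<And>z. Y z \<le> 1"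
  shows "AE z in M. cond_exp01 M \<phi> Y z = real_cond_exp M (vimage_algebra (space M) \<phi> borel) Y z"
proof -
  have int: "integrable M Y"
    by (rule integrable_const_bound[of _ 1]) (use Y01 in auto)
  have "AE z in M. real_cond_exp M (vimage_algebra (space M) \<phi> borel) Y z \<ge> 0"
    by (rule real_cond_exp_ge_c[OF int]) (use Y01 in auto)
  moreover have "AE z in M. real_cond_exp M (vimage_algebra (space M) \<phi> borel) Y z \<le> 1"
    by (rule real_cond_exp_le_c[OF int]) (use Y01 in auto)
  ultimately show ?thesis by eventually_elim (simp add: cond_exp01_def)
qed

lemma integrable_cond_exp01:
  assumes [measurable]: "g \<in> borel_measurable M" and B: "\<And>z. \<bar>g z\<bar> \<le> B"
  shows "integrable M (\<lambda>z. g z * cond_exp01 M \<phi> Y z)"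
proof (rule integrable_const_bound[of _ B])
  have "\<bar>g z\<bar> * \<bar>cond_exp01 M \<phi> Y z\<bar> \<le> B * 1" for z
    using B[of z] cond_exp01_bounds[of M \<phi> Y z] by (intro mult_mono) auto
  then show "AE z in M. norm (g z * cond_exp01 M \<phi> Y z) \<le> B"
    by (simp add: abs_mult)
qed simp

lemma integral_cond_exp01:
  assumes [measurable]: "Y \<in> borel_measurable M" and Y01: "\<And>z. 0 \<le> Y z" "\<And>z. Y z \<le> 1"
    and g: "g \<in> borel_measurable (vimage_algebra (space M) \<phi> borel)" and B: "\<And>z. \<bar>g z\<bar> \<le> B"
  shows "(\<integral>z. g z * cond_exp01 M \<phi> Y z \<partial>M) = (\<integral>z. g z * Y z \<partial>M)"
proof -
  have [measurable]: "g \<in> borel_measurable M"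
    by (rule measurable_from_subalg[OF subalgebra_vimage g])
  have "integrable M (\<lambda>z. g z * Y z)"
  proof (rule integrable_const_bound[of _ B])
    have "\<bar>g z\<bar> * \<bar>Y z\<bar> \<le> B * 1" for z
      using B[of z] Y01[of z] by (intro mult_mono) auto
    then show "AE z in M. norm (g z * Y z) \<le> B"
      by (simp add: abs_mult)
  qed simp
  then have "(\<integral>z. g z * real_cond_exp M (vimage_algebra (space M) \<phi> borel) Y z \<partial>M) = (\<integral>z. g z * Y z \<partial>M)"
    by (rule real_cond_exp_intg(2)) (use g in auto)
  moreover have "(\<integral>z. g z * cond_exp01 M \<phi> Y z \<partial>M) =
      (\<integral>z. g z * real_cond_exp M (vimage_algebra (space M) \<phi> borel) Y z \<partial>M)"
  proof (rule integral_cong_AE)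
    show "AE z in M. g z * cond_exp01 M \<phi> Y z =
        g z * real_cond_exp M (vimage_algebra (space M) \<phi> borel) Y z"
      using AE_cond_exp01[OF assms(1) Y01] by eventually_elim simp
  qed (auto intro!: borel_measurable_times measurable_from_subalg[OF subalgebra_vimage])
  ultimately show ?thesis by simp
qed

lemma measurable_vimage_compose:
  "h \<in> borel_measurable borel \<Longrightarrow> (\<lambda>z. h (\<phi> z)) \<in> borel_measurable (vimage_algebra (space M) \<phi> borel)"
  by (rule measurable_compose[OF measurable_vimage_algebra1]) auto

text \<open>Least-squares regression: the squared distance to \<open>Y\<close> and the squared distance to its
  conditional expectation differ by a constant, so near-minimizers of the former converge.\<close>

lemma square_loss_cond_exp01:
  assumes [measurable]: "Y \<in> borel_measurable M" and Y01: "\<And>z. 0 \<le> Y z" "\<And>z. Y z \<le> 1"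
  defines "H \<equiv> cond_exp01 M \<phi> Y"
  shows "(\<integral>z. (step_fun l (\<phi> z) - Y z)\<^sup>2 \<partial>M) =
    (\<integral>z. (step_fun l (\<phi> z) - H z)\<^sup>2 \<partial>M) + ((\<integral>z. (Y z)\<^sup>2 \<partial>M) - (\<integral>z. (H z)\<^sup>2 \<partial>M))"
proof -
  let ?s = "\<lambda>z. step_fun l (\<phi> z)"
  obtain B where B: "\<bar>step_fun l x\<bar> \<le> B" for x using step_fun_bounded by blast
  have H01: "0 \<le> H z" "H z \<le> 1" for z unfolding H_def by (rule cond_exp01_bounds)+
  have [measurable]: "H \<in> borel_measurable M" unfolding H_def by measurable
  have int: "integrable M (\<lambda>z. (?s z)\<^sup>2)"
    "integrable M (\<lambda>z. ?s z * G z)" "integrable M (\<lambda>z. (G z)\<^sup>2)"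
    if [measurable]: "G \<in> borel_measurable M" and G: "\<And>z. 0 \<le> G z" "\<And>z. G z \<le> 1" for G
  proof -
    show "integrable M (\<lambda>z. (?s z)\<^sup>2)"
    proof (rule integrable_const_bound[of _ "B\<^sup>2"])
      have "(?s z)\<^sup>2 \<le> B\<^sup>2" for z
        using power_mono[OF B[of "\<phi> z"] abs_ge_zero, of 2] by simp
      then show "AE z in M. norm ((?s z)\<^sup>2) \<le> B\<^sup>2" by simp
    qed simp
    have "\<bar>?s z\<bar> * \<bar>G z\<bar> \<le> B * 1" for z
      using B[of "\<phi> z"] G[of z] by (intro mult_mono) auto
    then show "integrable M (\<lambda>z. ?s z * G z)"
      by (intro integrable_const_bound[of _ B]) (auto simp: abs_mult)
    show "integrable M (\<lambda>z. (G z)\<^sup>2)"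
    proof (rule integrable_const_bound[of _ 1])
      show "AE z in M. norm ((G z)\<^sup>2) \<le> 1" using G by (simp add: power_le_one)
    qed simp
  qed
  have expand: "(\<integral>z. (?s z - G z)\<^sup>2 \<partial>M) = (\<integral>z. (?s z)\<^sup>2 \<partial>M) - 2 * (\<integral>z. ?s z * G z \<partial>M) + (\<integral>z. (G z)\<^sup>2 \<partial>M)"
    if "G \<in> borel_measurable M" and "\<And>z. 0 \<le> G z" "\<And>z. G z \<le> 1" for G
  proof -
    note int = int[OF that]
    have "(\<integral>z. (?s z - G z)\<^sup>2 \<partial>M) = (\<integral>z. (?s z)\<^sup>2 - 2 * (?s z * G z) + (G z)\<^sup>2 \<partial>M)"
      by (simp add: power2_diff algebra_simps)
    also have "\<dots> = (\<integral>z. (?s z)\<^sup>2 - 2 * (?s z * G z) \<partial>M) + (\<integral>z. (G z)\<^sup>2 \<partial>M)"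
      by (intro Bochner_Integration.integral_add Bochner_Integration.integrable_diff integrable_mult_right int)
    also have "(\<integral>z. (?s z)\<^sup>2 - 2 * (?s z * G z) \<partial>M) = (\<integral>z. (?s z)\<^sup>2 \<partial>M) - (\<integral>z. 2 * (?s z * G z) \<partial>M)"
      by (intro Bochner_Integration.integral_diff integrable_mult_right int)
    finally show ?thesis by simp
  qed
  have "(\<integral>z. ?s z * H z \<partial>M) = (\<integral>z. ?s z * Y z \<partial>M)"
    unfolding H_def using B
    by (intro integral_cond_exp01 Y01 measurable_vimage_compose) auto
  then show ?thesis
    using expand[of Y] expand[of H] Y01 H01 by simp
qed

text \<open>The excess loss of \<open>L j\<close> over a step function equals the difference of
  their squared distances to the conditional expectation. The latter distance can be made
  arbitrarily small, so that of \<open>L j\<close> is at most (1/4)^j.\<close>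

lemma l2_near_minimizers_converge:
  assumes [measurable]: "Y \<in> borel_measurable M" and Y01: "\<And>z. 0 \<le> Y z" "\<And>z. Y z \<le> 1"
    and min: "\<And>j l. (\<integral>z. (step_fun (L j) (\<phi> z) - Y z)\<^sup>2 \<partial>M) \<le> (\<integral>z. (step_fun l (\<phi> z) - Y z)\<^sup>2 \<partial>M) + (1/4)^j"
  shows "AE z in M. (\<lambda>j. step_fun (L j) (\<phi> z)) \<longlonglongrightarrow> cond_exp01 M \<phi> Y z"
proof (rule AE_tendsto_of_l2_geometric)
  fix j
  define H where "H = cond_exp01 M \<phi> Y"
  define a where "a l = (\<integral>z. (step_fun l (\<phi> z) - H z)\<^sup>2 \<partial>M)" for l
  have [measurable]: "H \<in> borel_measurable M" unfolding H_def by measurable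
  have H01: "0 \<le> H z" "H z \<le> 1" for z unfolding H_def by (rule cond_exp01_bounds)+
  have nn: "(\<integral>\<^sup>+z. ennreal ((step_fun l (\<phi> z) - H z)\<^sup>2) \<partial>M) = ennreal (a l)" for l
    unfolding a_def
  proof (rule nn_integral_eq_integral)
    obtain B where B: "\<bar>step_fun l x\<bar> \<le> B" for x using step_fun_bounded by blast
    have "\<bar>step_fun l (\<phi> z) - H z\<bar> \<le> B + 1" for z
      using B[of "\<phi> z"] H01[of z] by linarith
    then have "\<bar>step_fun l (\<phi> z) - H z\<bar>\<^sup>2 \<le> (B + 1)\<^sup>2" for z
      by (intro power_mono) auto
    then show "integrable M (\<lambda>z. (step_fun l (\<phi> z) - H z)\<^sup>2)"
      by (intro integrable_const_bound[of _ "(B + 1)\<^sup>2"]) auto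
  qed simp
  have "a (L j) \<le> (1/4)^j"
  proof (rule field_le_epsilon)
    fix \<epsilon> :: real assume "\<epsilon> > 0"
    have "l2_approx M \<phi> H"
      by (rule l2_approx_unit_interval[OF M \<phi>])
         (use H01 measurable_cond_exp01_vimage in \<open>auto simp: H_def\<close>)
    with \<open>\<epsilon> > 0\<close> obtain l where "ennreal (a l) \<le> ennreal \<epsilon>"
      unfolding l2_approx_def nn by blast
    then have "a l \<le> \<epsilon>" using \<open>\<epsilon> > 0\<close> by (simp add: ennreal_le_iff)
    moreover have "a (L j) \<le> a l + (1/4)^j"
      using min[of j l] square_loss_cond_exp01[OF assms(1) Y01] unfolding a_def H_def by simp
    ultimately show "a (L j) \<le> (1/4)^j + \<epsilon>" by simp
  qed
  then show "(\<integral>\<^sup>+z. ennreal ((step_fun (L j) (\<phi> z) - cond_exp01 M \<phi> Y z)\<^sup>2) \<partial>M) \<le> ennreal ((1/4)^j)"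
    using nn[of "L j"] unfolding H_def by (simp add: ennreal_leI)
qed auto

text \<open>If all h n stayed above H by a fixed amount on a set of positive measure, their
  integrals would stay away from that of H. This is how limits of a marginal distribution function
  become almost sure limits of the conditional ones.\<close>

lemma AE_exists_close:
  fixes H :: "'a \<Rightarrow> real" and h :: "nat \<Rightarrow> 'a \<Rightarrow> real"
  assumes [measurable]: "H \<in> borel_measurable M" "\<And>n. h n \<in> borel_measurable M"
    and bd: "\<And>z. 0 \<le> H z" "\<And>z. H z \<le> 1" "\<And>n z. 0 \<le> h n z" "\<And>n z. h n z \<le> 1"
    and ge: "\<And>n. AE z in M. H z \<le> h n z"
    and lim: "(\<lambda>n. \<integral>z. h n z \<partial>M) \<longlonglongrightarrow> (\<integral>z. H z \<partial>M)"
  shows "AE z in M. \<forall>\<epsilon>>0. \<exists>n. h n z < H z + \<epsilon>"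
proof -
  have int: "integrable M H" "integrable M (h n)" for n
    by (rule integrable_const_bound[of _ 1]; use bd in auto)+
  have "AE z in M. \<exists>n. h n z < H z + inverse (real (Suc k))" for k
  proof -
    define S where "S = {z\<in>space M. \<forall>n. H z + inverse (real (Suc k)) \<le> h n z}"
    have [measurable]: "S \<in> sets M" unfolding S_def by measurable
    have le: "inverse (real (Suc k)) * prob S \<le> (\<integral>z. h n z \<partial>M) - (\<integral>z. H z \<partial>M)" for n
    proof -
      have "inverse (real (Suc k)) * prob S = (\<integral>z. inverse (real (Suc k)) * indicator S z \<partial>M)" by simp
      also have "\<dots> \<le> (\<integral>z. h n z - H z \<partial>M)"
      proof (rule integral_mono_AE)
        show "AE z in M. inverse (real (Suc k)) * indicator S z \<le> h n z - H z"
          using ge[of n] by eventually_elim (auto simp: S_def indicator_def algebra_simps)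
      qed (auto intro!: int integrable_real_indicator simp: emeasure_eq_measure)
      also have "\<dots> = (\<integral>z. h n z \<partial>M) - (\<integral>z. H z \<partial>M)" by (intro Bochner_Integration.integral_diff int)
      finally show ?thesis .
    qed
    have "(\<lambda>n. (\<integral>z. h n z \<partial>M) - (\<integral>z. H z \<partial>M)) \<longlonglongrightarrow> (\<integral>z. H z \<partial>M) - (\<integral>z. H z \<partial>M)"
      by (intro tendsto_intros lim)
    then have "inverse (real (Suc k)) * prob S \<le> 0"
      using le by (intro LIMSEQ_le_const[of _ "0"]) auto
    then have "prob S = 0" by (simp add: mult_le_0_iff measure_le_0_iff)
    then have "AE z in M. z \<notin> S" by (simp add: prob_eq_0)
    then show ?thesis using AE_space by eventually_elim (auto simp: S_def not_le)
  qed
  then have "AE z in M. \<forall>k. \<exists>n. h n z < H z + inverse (real (Suc k))" by (simp add: AE_all_countable)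
  then show ?thesis
  proof eventually_elim
    case (elim z)
    show ?case
    proof (intro allI impI)
      fix \<epsilon> :: real assume "\<epsilon> > 0"
      then obtain k where "inverse (real (Suc k)) < \<epsilon>" using reals_Archimedean by blast
      moreover obtain n where "h n z < H z + inverse (real (Suc k))" using elim by blast
      ultimately have "h n z < H z + \<epsilon>" by linarith
      then show "\<exists>n. h n z < H z + \<epsilon>" ..
    qed
  qed
qed

end

section \<open>Measures composed with kernels\<close>

text \<open>The joint law m(dx) k(dy | x). Written as a bind, it inherits the monad laws and the
  integration and almost-everywhere rules of bind.\<close>

definition kernel_prod :: "'a measure \<Rightarrow> 'b measure \<Rightarrow> 'a measure \<Rightarrow> ('a \<Rightarrow> 'b measure) \<Rightarrow> ('a \<times> 'b) measure" where
  "kernel_prod M N m k = m \<bind> (\<lambda>x. distr (k x) (M \<Otimes>\<^sub>M N) (Pair x))"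

lemma measurable_kernel_prod_slice [measurable]:
  "k \<in> M \<rightarrow>\<^sub>M prob_algebra N \<Longrightarrow> (\<lambda>x. distr (k x) (M \<Otimes>\<^sub>M N) (Pair x)) \<in> M \<rightarrow>\<^sub>M prob_algebra (M \<Otimes>\<^sub>M N)"
  by (rule measurable_distr_prob_space2) auto

lemma sets_prob_algebra_cong: "m \<in> space (prob_algebra M) \<Longrightarrow> sets m = sets M"
  by (simp add: space_prob_algebra)

lemma space_prob_algebra_cong: "m \<in> space (prob_algebra M) \<Longrightarrow> space m = space M"
  by (auto simp: space_prob_algebra intro!: sets_eq_imp_space_eq)

lemma prob_algebra_prob_space: "m \<in> space (prob_algebra M) \<Longrightarrow> prob_space m"
  by (simp add: space_prob_algebra)

lemma bind_in_prob_algebra: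
  "m \<in> space (prob_algebra M) \<Longrightarrow> k \<in> M \<rightarrow>\<^sub>M prob_algebra N \<Longrightarrow> m \<bind> k \<in> space (prob_algebra N)"
  using prob_space_bind'[of m M k N] sets_bind'[of m M k N] by (simp add: space_prob_algebra[of N])

lemma distr_in_prob_algebra:
  "m \<in> space (prob_algebra M) \<Longrightarrow> f \<in> M \<rightarrow>\<^sub>M N \<Longrightarrow> distr m N f \<in> space (prob_algebra N)"
  by (rule measurable_space[OF measurable_distr_prob_space])

text \<open>Here and in the next rules \<open>m\<close> has the measurable sets of \<open>M\<close>
  without being \<open>M\<close>. The conversion of measurability between the two is done here once
  for all the calculations with laws.\<close>

lemma nn_integral_bind_prob_algebra:
  assumes m: "m \<in> space (prob_algebra M)" and k: "k \<in> M \<rightarrow>\<^sub>M prob_algebra N" and f: "f \<in> borel_measurable N"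
  shows "(\<integral>\<^sup>+y. f y \<partial>(m \<bind> k)) = (\<integral>\<^sup>+x. \<integral>\<^sup>+y. f y \<partial>k x \<partial>m)"
proof (rule nn_integral_bind[OF f])
  show "k \<in> m \<rightarrow>\<^sub>M subprob_algebra N"
    using measurable_prob_algebraD[OF k] measurable_cong_sets[OF sets_prob_algebra_cong[OF m] refl] by blast
qed

lemma AE_bind_prob_algebra:
  assumes m: "m \<in> space (prob_algebra M)" and k: "k \<in> M \<rightarrow>\<^sub>M prob_algebra N" and P: "Measurable.pred N P"
  shows "(AE y in m \<bind> k. P y) \<longleftrightarrow> (AE x in m. AE y in k x. P y)"
proof (rule AE_bind[OF _ P])
  show "k \<in> m \<rightarrow>\<^sub>M subprob_algebra N"
    using measurable_prob_algebraD[OF k] measurable_cong_sets[OF sets_prob_algebra_cong[OF m] refl] by blast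
qed

lemma distr_bind_prob_algebra:
  assumes m: "m \<in> space (prob_algebra M)" and k: "k \<in> M \<rightarrow>\<^sub>M prob_algebra N" and f: "f \<in> N \<rightarrow>\<^sub>M R"
  shows "distr (m \<bind> k) R f = m \<bind> (\<lambda>x. distr (k x) R f)"
proof (rule distr_bind[OF _ _ f])
  show "k \<in> m \<rightarrow>\<^sub>M subprob_algebra N"
    using measurable_prob_algebraD[OF k] measurable_cong_sets[OF sets_prob_algebra_cong[OF m] refl] by blast
  show "space m \<noteq> {}" using prob_algebra_prob_space[OF m] by (rule prob_space.not_empty)
qed

lemma bind_distr_prob_algebra:
  assumes m: "m \<in> space (prob_algebra M)" and f: "f \<in> M \<rightarrow>\<^sub>M N" and k: "k \<in> N \<rightarrow>\<^sub>M prob_algebra R"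
  shows "distr m N f \<bind> k = m \<bind> (\<lambda>x. k (f x))"
proof (rule bind_distr[OF _ measurable_prob_algebraD[OF k]])
  show "f \<in> m \<rightarrow>\<^sub>M N" using f measurable_cong_sets[OF sets_prob_algebra_cong[OF m] refl] by blast
  show "space m \<noteq> {}" using prob_algebra_prob_space[OF m] by (rule prob_space.not_empty)
qed

lemma bind_assoc_prob_algebra:
  assumes m: "m \<in> space (prob_algebra M)" and f: "f \<in> M \<rightarrow>\<^sub>M prob_algebra N" and k: "k \<in> N \<rightarrow>\<^sub>M prob_algebra R"
  shows "(m \<bind> f) \<bind> k = m \<bind> (\<lambda>x. f x \<bind> k)"
proof (rule bind_assoc[OF _ measurable_prob_algebraD[OF k]])
  show "f \<in> m \<rightarrow>\<^sub>M subprob_algebra N"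
    using measurable_prob_algebraD[OF f] measurable_cong_sets[OF sets_prob_algebra_cong[OF m] refl] by blast
qed

lemma distr_distr_prob_algebra:
  assumes m: "m \<in> space (prob_algebra M)" and f: "f \<in> M \<rightarrow>\<^sub>M N" and g: "g \<in> N \<rightarrow>\<^sub>M R"
  shows "distr (distr m N f) R g = distr m R (\<lambda>x. g (f x))"
  using assms measurable_cong_sets[OF sets_prob_algebra_cong[OF m] refl]
  by (subst distr_distr) (auto simp: comp_def)

lemma distr_cong_prob_algebra:
  assumes m: "m \<in> space (prob_algebra M)" and "\<And>x. x \<in> space M \<Longrightarrow> f x = g x"
  shows "distr m N f = distr m N g"
  using assms by (intro distr_cong refl) (simp add: space_prob_algebra_cong[OF m])

lemma distr_id_prob_algebra:
  assumes m: "m \<in> space (prob_algebra M)" and "\<And>x. x \<in> space M \<Longrightarrow> f x = x"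
  shows "distr m M f = m"
proof -
  have "distr m M f = distr m m (\<lambda>x. x)"
    using assms by (intro distr_cong) (auto simp: space_prob_algebra_cong[OF m] sets_prob_algebra_cong[OF m])
  then show ?thesis by simp
qed

lemma bind_cong_prob_algebra:
  "m \<in> space (prob_algebra M) \<Longrightarrow> (\<And>x. x \<in> space M \<Longrightarrow> f x = g x) \<Longrightarrow> m \<bind> f = m \<bind> g"
  by (intro bind_cong refl) (simp add: space_prob_algebra_cong)

lemma kernel_prod_in_prob_algebra:
  "m \<in> space (prob_algebra M) \<Longrightarrow> k \<in> M \<rightarrow>\<^sub>M prob_algebra N \<Longrightarrow>
    kernel_prod M N m k \<in> space (prob_algebra (M \<Otimes>\<^sub>M N))"
  unfolding kernel_prod_def by (rule bind_in_prob_algebra[OF _ measurable_kernel_prod_slice])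

lemma measurable_Pair_slice:
  "k \<in> M \<rightarrow>\<^sub>M prob_algebra N \<Longrightarrow> x \<in> space M \<Longrightarrow> Pair x \<in> k x \<rightarrow>\<^sub>M M \<Otimes>\<^sub>M N"
  using measurable_cong_sets[OF sets_prob_algebra_cong[OF measurable_space[of k M "prob_algebra N" x]] refl]
  by (auto intro: measurable_Pair1')

lemma nn_integral_kernel_prod:
  assumes m: "m \<in> space (prob_algebra M)" and k: "k \<in> M \<rightarrow>\<^sub>M prob_algebra N"
    and f: "f \<in> borel_measurable (M \<Otimes>\<^sub>M N)"
  shows "(\<integral>\<^sup>+z. f z \<partial>kernel_prod M N m k) = (\<integral>\<^sup>+x. \<integral>\<^sup>+y. f (x, y) \<partial>k x \<partial>m)"
  unfolding kernel_prod_def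
  by (subst nn_integral_bind_prob_algebra[OF m measurable_kernel_prod_slice[OF k] f])
     (auto intro!: nn_integral_cong simp: space_prob_algebra_cong[OF m] nn_integral_distr f measurable_Pair_slice[OF k])

lemma AE_kernel_prod:
  assumes m: "m \<in> space (prob_algebra M)" and k: "k \<in> M \<rightarrow>\<^sub>M prob_algebra N"
    and P: "Measurable.pred (M \<Otimes>\<^sub>M N) P"
  shows "(AE z in kernel_prod M N m k. P z) \<longleftrightarrow> (AE x in m. AE y in k x. P (x, y))"
proof -
  have "(AE z in kernel_prod M N m k. P z) \<longleftrightarrow> (AE x in m. AE z in distr (k x) (M \<Otimes>\<^sub>M N) (Pair x). P z)"
    unfolding kernel_prod_def by (rule AE_bind_prob_algebra[OF m measurable_kernel_prod_slice[OF k] P])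
  also have "\<dots> \<longleftrightarrow> (AE x in m. AE y in k x. P (x, y))"
    by (rule AE_cong) (use P in \<open>auto simp: space_prob_algebra_cong[OF m] pred_def intro!: AE_distr_iff measurable_Pair_slice[OF k]\<close>)
  finally show ?thesis .
qed

lemma emeasure_kernel_prod_Times:
  assumes m: "m \<in> space (prob_algebra M)" and k: "k \<in> M \<rightarrow>\<^sub>M prob_algebra N"
    and [measurable]: "B \<in> sets M" "C \<in> sets N"
  shows "emeasure (kernel_prod M N m k) (B \<times> C) = (\<integral>\<^sup>+x. indicator B x * emeasure (k x) C \<partial>m)"
proof -
  have "emeasure (kernel_prod M N m k) (B \<times> C) = (\<integral>\<^sup>+z. indicator (B \<times> C) z \<partial>kernel_prod M N m k)"
    using kernel_prod_in_prob_algebra[OF m k] by (simp add: space_prob_algebra)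
  also have "\<dots> = (\<integral>\<^sup>+x. \<integral>\<^sup>+y. indicator (B \<times> C) (x, y) \<partial>k x \<partial>m)"
    by (rule nn_integral_kernel_prod[OF m k]) simp
  also have "\<dots> = (\<integral>\<^sup>+x. indicator B x * emeasure (k x) C \<partial>m)"
  proof (rule nn_integral_cong)
    fix x assume "x \<in> space m"
    then have "C \<in> sets (k x)"
      using measurable_space[OF k, of x] by (simp add: space_prob_algebra_cong[OF m] space_prob_algebra)
    then show "(\<integral>\<^sup>+y. indicator (B \<times> C) (x, y) \<partial>k x) = indicator B x * emeasure (k x) C"
      unfolding indicator_times fst_conv snd_conv by (rule nn_integral_cmult_indicator)
  qed
  finally show ?thesis .
qed

lemma distr_fst_kernel_prod:
  assumes m: "m \<in> space (prob_algebra M)" and k: "k \<in> M \<rightarrow>\<^sub>M prob_algebra N"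
  shows "distr (kernel_prod M N m k) M fst = m"
proof -
  have "distr (kernel_prod M N m k) M fst = m \<bind> (\<lambda>x. distr (distr (k x) (M \<Otimes>\<^sub>M N) (Pair x)) M fst)"
    unfolding kernel_prod_def by (rule distr_bind_prob_algebra[OF m measurable_kernel_prod_slice[OF k]]) simp
  also have "\<dots> = m \<bind> return M"
  proof (rule bind_cong_prob_algebra[OF m])
    fix x assume x: "x \<in> space M"
    then have kx: "k x \<in> space (prob_algebra N)" using k by (rule measurable_space[rotated])
    then interpret prob_space "k x" by (rule prob_algebra_prob_space)
    have "distr (distr (k x) (M \<Otimes>\<^sub>M N) (Pair x)) M fst = distr (k x) M (\<lambda>_. x)"
      using x by (subst distr_distr_prob_algebra[OF kx]) auto
    also have "\<dots> = return M x" using x by (rule distr_const)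
    finally show "distr (distr (k x) (M \<Otimes>\<^sub>M N) (Pair x)) M fst = return M x" .
  qed
  also have "\<dots> = m"
    using bind_return'[of m] return_sets_cong[OF sets_prob_algebra_cong[OF m]] by simp
  finally show ?thesis .
qed

lemma prob_eqI_rectangles:
  assumes G: "borel_chain N G" and \<mu>: "\<mu> \<in> space (prob_algebra (M \<Otimes>\<^sub>M N))" and \<nu>: "\<nu> \<in> space (prob_algebra (M \<Otimes>\<^sub>M N))"
    and eq: "\<And>B r. B \<in> sets M \<Longrightarrow> emeasure \<mu> (B \<times> G r) = emeasure \<nu> (B \<times> G r)"
  shows "\<mu> = \<nu>"
proof -
  interpret prob_space \<mu> using \<mu> by (rule prob_algebra_prob_space)
  let ?E = "{B \<times> C |B C. B \<in> sets M \<and> C \<in> range G}"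
  have GN: "range G \<subseteq> sets N" using borel_chain_sets[OF G] by auto
  have sub: "?E \<subseteq> Pow (space M \<times> space N)"
    using sets.sets_into_space[of _ M] sets.sets_into_space[of _ N] GN by blast
  have "sets (M \<Otimes>\<^sub>M N) = sets (sigma (space M \<times> space N) ?E)"
    by (rule sets_pair_eq[where Ca="{space M}" and Cb="range G"])
       (use G GN sets.space_closed[of M] sets.space_closed[of N] sets.sigma_sets_eq[of M]
        in \<open>auto simp: borel_chain_def\<close>)
  then have sets: "sets (M \<Otimes>\<^sub>M N) = sigma_sets (space M \<times> space N) ?E"
    using sub by simp
  show ?thesis
  proof (rule measure_eqI_generator_eq[where A="\<lambda>n. space M \<times> G (of_nat n)" and E="?E" and \<Omega>="space M \<times> space N"])
    show "Int_stable ?E"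
    proof (rule Int_stableI)
      fix a b assume "a \<in> ?E" "b \<in> ?E"
      then obtain B C B' C' where ab: "a = B \<times> C" "b = B' \<times> C'" "B \<in> sets M" "B' \<in> sets M"
        "C \<in> range G" "C' \<in> range G" by blast
      then have "C \<inter> C' \<in> range G" using borel_chain_Int_stable[OF G] by (auto simp: Int_stable_def)
      then show "a \<inter> b \<in> ?E" using ab by (auto simp: Times_Int_Times)
    qed
    show "(\<Union>i. space M \<times> G (of_nat i)) = space M \<times> space N"
      using borel_chain_of_nat[OF G] by blast
    show "emeasure \<mu> (space M \<times> G (of_nat i)) \<noteq> \<infinity>" for i by simp
  qed (use sub eq sets \<mu> \<nu> in \<open>auto simp: space_prob_algebra\<close>)
qed

text \<open>For each set C of a generating chain, k x C and k' x C are densities with respect to m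
  of the same measure, namely of B \<times> C under the product, so they agree almost everywhere;
  the chain is countable.\<close>

lemma kernel_prod_unique:
  assumes "real_retract N" and m: "m \<in> space (prob_algebra M)"
    and k: "k \<in> M \<rightarrow>\<^sub>M prob_algebra N" and k': "k' \<in> M \<rightarrow>\<^sub>M prob_algebra N"
    and eq: "kernel_prod M N m k = kernel_prod M N m k'"
  shows "AE x in m. k x = k' x"
proof -
  obtain G where G: "borel_chain N G" using real_retract_obtain_chain[OF assms(1)] .
  interpret prob_space m using m by (rule prob_algebra_prob_space)
  have meas [measurable]: "(\<lambda>x. emeasure (l x) (G r)) \<in> borel_measurable m"
    if l: "l \<in> M \<rightarrow>\<^sub>M prob_algebra N" for l r
    using measurable_compose[OF measurable_prob_algebraD[OF l] measurable_emeasure_subprob_algebra[OF borel_chain_sets[OF G]]]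
      measurable_cong_sets[OF sets_prob_algebra_cong[OF m] refl] by blast
  have "AE x in m. emeasure (k x) (G r) = emeasure (k' x) (G r)" for r
  proof -
    have "density m (\<lambda>x. emeasure (k x) (G r)) = density m (\<lambda>x. emeasure (k' x) (G r))"
    proof (rule measure_eqI)
      fix B assume "B \<in> sets (density m (\<lambda>x. emeasure (k x) (G r)))"
      then have B: "B \<in> sets m" "B \<in> sets M" using m by (auto simp: space_prob_algebra)
      then show "emeasure (density m (\<lambda>x. emeasure (k x) (G r))) B = emeasure (density m (\<lambda>x. emeasure (k' x) (G r))) B"
        using emeasure_kernel_prod_Times[OF m k B(2) borel_chain_sets[OF G, of r]]
          emeasure_kernel_prod_Times[OF m k' B(2) borel_chain_sets[OF G, of r]] eq meas[OF k] meas[OF k']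
        by (simp add: emeasure_density mult.commute)
    qed simp
    then show ?thesis
      using meas[OF k] meas[OF k'] by (subst (asm) density_unique_iff) auto
  qed
  then have "AE x in m. \<forall>r. emeasure (k x) (G r) = emeasure (k' x) (G r)" by (simp add: AE_all_countable)
  then show ?thesis using AE_space
  proof eventually_elim
    case (elim x)
    then have "k x \<in> space (prob_algebra N)" "k' x \<in> space (prob_algebra N)"
      using k k' by (auto simp: space_prob_algebra_cong[OF m] dest: measurable_space)
    then show ?case using elim
      by (intro borel_chain_eqI[OF G]) (auto simp: space_prob_algebra prob_space.finite_measure)
  qed
qed

section \<open>Disintegration by regression\<close>

definition reg_loss :: "(real \<times> real) measure \<Rightarrow> rat \<Rightarrow> nat \<Rightarrow> real" where
  "reg_loss \<nu> r i = (\<integral>z. (step_fun (from_nat i) (fst z) - indicator (rat_atMost r) (snd z))\<^sup>2 \<partial>\<nu>)"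

text \<open>The first index within (1/4)^j of the infimum of the losses. The least such index is
  measurable in \<nu>, and the rate is the one required by
  \<open>l2_near_minimizers_converge\<close>.\<close>

definition reg_index :: "(real \<times> real) measure \<Rightarrow> rat \<Rightarrow> nat \<Rightarrow> nat" where
  "reg_index \<nu> r j = (LEAST i. \<forall>k. reg_loss \<nu> r i \<le> reg_loss \<nu> r k + (1/4)^j)"

definition cond_cdf :: "(real \<times> real) measure \<Rightarrow> real \<Rightarrow> rat \<Rightarrow> real" where
  "cond_cdf \<nu> x r = lim (\<lambda>j. step_fun (from_nat (reg_index \<nu> r j)) x)"

text \<open>For almost all x the limit exists and is a distribution function. At the other points
  \<open>lim\<close> and \<open>cdf_kernel\<close> still return some probability measure, so this is
  a kernel everywhere.\<close>

definition cond_kernel :: "(real \<times> real) measure \<Rightarrow> real \<Rightarrow> real measure" where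
  "cond_kernel \<nu> x = cdf_kernel (cond_cdf \<nu> x)"

text \<open>Here the explicit construction pays off: a loss is an integral and so measurable in
  \<nu>, an index is a least number with a measurable property, and a limit of jointly measurable
  functions is jointly measurable.\<close>

lemma measurable_cond_kernel:
  "(\<lambda>(\<nu>, x). cond_kernel \<nu> x) \<in> prob_algebra (borel \<Otimes>\<^sub>M borel) \<Otimes>\<^sub>M borel \<rightarrow>\<^sub>M prob_algebra borel"
proof -
  let ?P = "prob_algebra (borel \<Otimes>\<^sub>M borel) :: (real \<times> real) measure measure"
  have [measurable]: "(\<lambda>\<nu>. reg_loss \<nu> r i) \<in> borel_measurable ?P" for r i
    unfolding reg_loss_def prob_algebra_def
    by (rule measurable_restrict_space1, rule integral_measurable_subprob_algebra) measurable
  have [measurable]: "(\<lambda>\<nu>. reg_index \<nu> r j) \<in> ?P \<rightarrow>\<^sub>M count_space UNIV" for r j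
    unfolding reg_index_def by measurable
  have "(\<lambda>w. step_fun (from_nat (reg_index (fst w) r j)) (snd w)) \<in> borel_measurable (?P \<Otimes>\<^sub>M borel)" for r j
    by (rule measurable_compose_countable) measurable
  then have "(\<lambda>w. cond_cdf (fst w) (snd w) r) \<in> borel_measurable (?P \<Otimes>\<^sub>M borel)" for r
    unfolding cond_cdf_def by (rule borel_measurable_lim_metric)
  then have "(\<lambda>w. cond_cdf (fst w) (snd w)) \<in> ?P \<Otimes>\<^sub>M borel \<rightarrow>\<^sub>M borel"
    by (rule measurable_coordinatewise_then_product)
  then show ?thesis
    unfolding cond_kernel_def split_beta by (rule measurable_compose[OF _ measurable_cdf_kernel])
qed

lemma reg_loss_nonneg: "0 \<le> reg_loss \<nu> r i"
  unfolding reg_loss_def by (rule Bochner_Integration.integral_nonneg) simp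

lemma reg_index: "reg_loss \<nu> r (reg_index \<nu> r j) \<le> reg_loss \<nu> r k + (1/4)^j"
proof -
  let ?I = "INF i. reg_loss \<nu> r i"
  have bdd: "bdd_below (range (reg_loss \<nu> r))" by (rule bdd_belowI2[of _ 0]) (rule reg_loss_nonneg)
  have "?I < ?I + (1/4)^j" by simp
  then obtain i where i: "reg_loss \<nu> r i < ?I + (1/4)^j"
    using cINF_less_iff[OF UNIV_not_empty bdd] by blast
  have "\<exists>i. \<forall>k. reg_loss \<nu> r i \<le> reg_loss \<nu> r k + (1/4)^j"
  proof (intro exI[of _ i] allI)
    fix k have "?I \<le> reg_loss \<nu> r k" using bdd by (rule cINF_lower) simp
    with i show "reg_loss \<nu> r i \<le> reg_loss \<nu> r k + (1/4)^j" by linarith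
  qed
  then show ?thesis unfolding reg_index_def by (rule LeastI2_ex) blast
qed

context
  fixes \<nu> :: "(real \<times> real) measure"
  assumes \<nu>: "\<nu> \<in> space (prob_algebra (borel \<Otimes>\<^sub>M borel))"
begin

abbreviation "cond_le r \<equiv> cond_exp01 \<nu> fst (\<lambda>z. indicator (rat_atMost r) (snd z))"

lemma disintegration_prob_space: "prob_space \<nu>" and disintegration_sets: "sets \<nu> = sets (borel \<Otimes>\<^sub>M borel)"
  using \<nu> by (auto simp: space_prob_algebra)

interpretation prob_space \<nu> by (rule disintegration_prob_space)

lemma disintegration_measurable [measurable]:
  "fst \<in> \<nu> \<rightarrow>\<^sub>M borel" "snd \<in> \<nu> \<rightarrow>\<^sub>M borel"
  unfolding measurable_cong_sets[OF disintegration_sets refl] by measurable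

lemma AE_cond_cdf: "AE z in \<nu>. \<forall>r. cond_cdf \<nu> (fst z) r = cond_le r z"
proof -
  have conv: "AE z in \<nu>. (\<lambda>j. step_fun (from_nat (reg_index \<nu> r j)) (fst z)) \<longlonglongrightarrow> cond_le r z" for r
  proof (rule l2_near_minimizers_converge)
    fix j and l :: "(rat \<times> rat option) list"
    have "reg_loss \<nu> r (reg_index \<nu> r j) \<le> reg_loss \<nu> r (to_nat l) + (1/4)^j" by (rule reg_index)
    then show "(\<integral>z. (step_fun (from_nat (reg_index \<nu> r j)) (fst z) - indicator (rat_atMost r) (snd z))\<^sup>2 \<partial>\<nu>)
      \<le> (\<integral>z. (step_fun l (fst z) - indicator (rat_atMost r) (snd z))\<^sup>2 \<partial>\<nu>) + (1/4)^j"
      by (simp add: reg_loss_def)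
  qed (auto simp: disintegration_prob_space)
  have "AE z in \<nu>. cond_cdf \<nu> (fst z) r = cond_le r z" for r
    using conv[of r] by eventually_elim (simp add: cond_cdf_def limI)
  then show ?thesis by (simp add: AE_all_countable)
qed

lemma measurable_cond_le [measurable]: "cond_le r \<in> borel_measurable \<nu>"
  by (rule measurable_cond_exp01) (auto simp: disintegration_prob_space)

lemma integral_cond_le:
  "B \<in> sets borel \<Longrightarrow> (\<integral>z. indicator B (fst z) * cond_le r z \<partial>\<nu>) = measure \<nu> (B \<times> rat_atMost r)"
proof -
  assume [measurable]: "B \<in> sets borel"
  have "(\<integral>z. indicator B (fst z) * cond_le r z \<partial>\<nu>) =
      (\<integral>z. indicator B (fst z) * indicator (rat_atMost r) (snd z) \<partial>\<nu>)"
    by (rule integral_cond_exp01[where B=1])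
       (auto simp: disintegration_prob_space indicator_def intro!: measurable_vimage_compose)
  also have "\<dots> = (\<integral>z. indicator (B \<times> rat_atMost r) z \<partial>\<nu>)"
    by (simp add: indicator_times)
  also have "\<dots> = measure \<nu> (B \<times> rat_atMost r)"
  proof -
    have "B \<times> rat_atMost r \<in> sets \<nu>" unfolding disintegration_sets by simp
    then show ?thesis by simp
  qed
  finally show ?thesis .
qed

lemma integral_cond_le_UNIV: "(\<integral>z. cond_le r z \<partial>\<nu>) = measure (distr \<nu> borel snd) (rat_atMost r)"
proof -
  have "(\<integral>z. cond_le r z \<partial>\<nu>) = measure \<nu> (UNIV \<times> rat_atMost r)"
    using integral_cond_le[of UNIV r] by simp
  also have "UNIV \<times> rat_atMost r = snd -` rat_atMost r \<inter> space \<nu>"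
    using sets_eq_imp_space_eq[OF disintegration_sets] by (auto simp: space_pair_measure)
  finally show ?thesis by (simp add: measure_distr)
qed

text \<open>Monotonicity is inherited from the indicators. The integral of \<open>cond_le r\<close>
  is the second marginal distribution function at r, so \<open>AE_exists_close\<close> turns its
  right continuity and its limits into those of almost every conditional distribution function; the
  limit at the top is treated through 1 - \<open>cond_le\<close>.\<close>

lemma AE_rat_cdf_cond_le: "AE z in \<nu>. rat_cdf (\<lambda>r. cond_le r z)"
proof -
  define F where "F r = measure (distr \<nu> borel snd) (rat_atMost r)" for r
  have cdf: "rat_cdf F"
    unfolding F_def by (rule rat_cdf_measure) (rule distr_in_prob_algebra[OF \<nu>], simp)
  have mono: "F r \<le> F s" if "r \<le> s" for r s using cdf that by (auto simp: rat_cdf_def mono_def)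
  have close: "(\<lambda>n. F (s n)) \<longlonglongrightarrow> c" if small: "\<And>\<epsilon>. \<epsilon> > 0 \<Longrightarrow> \<exists>n. F (s n) < c + \<epsilon>" and ge: "\<And>n. c \<le> F (s n)" and anti: "antimono s"
    for s :: "nat \<Rightarrow> rat" and c
  proof (rule decreasing_tendsto)
    fix x assume "c < x"
    then obtain n where "F (s n) < c + (x - c)" using small[of "x - c"] by auto
    then have "F (s m) < x" if "m \<ge> n" for m
      using mono[OF antimonoD[OF anti that]] by simp
    then show "\<forall>\<^sub>F m in sequentially. F (s m) < x" by (auto simp: eventually_sequentially)
  qed (use ge in auto)
  have ae_mono: "AE z in \<nu>. \<forall>r s. r \<le> s \<longrightarrow> cond_le r z \<le> cond_le s z"
  proof -
    have "AE z in \<nu>. cond_le r z \<le> cond_le s z" if "r \<le> s" for r s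
    proof -
      interpret S: finite_measure_subalgebra \<nu> "vimage_algebra (space \<nu>) fst borel"
        by unfold_locales (rule subalgebra_vimage[OF disintegration_prob_space], simp)
      have int: "integrable \<nu> (\<lambda>z. indicat_real (rat_atMost t) (snd z))" for t
        by (rule integrable_const_bound[of _ 1]) auto
      have "AE z in \<nu>. real_cond_exp \<nu> (vimage_algebra (space \<nu>) fst borel) (\<lambda>z. indicat_real (rat_atMost r) (snd z)) z
        \<le> real_cond_exp \<nu> (vimage_algebra (space \<nu>) fst borel) (\<lambda>z. indicat_real (rat_atMost s) (snd z)) z"
      proof (rule S.real_cond_exp_mono[OF AE_I2 int int])
        have "(of_rat r :: real) \<le> of_rat s" using that by (simp add: of_rat_less_eq)
        then show "indicat_real (rat_atMost r) (snd z) \<le> indicat_real (rat_atMost s) (snd z)" for z :: "real \<times> real"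
          by (auto simp: indicator_def)
      qed
      then show ?thesis by eventually_elim (auto simp: cond_exp01_def)
    qed
    then show ?thesis by (simp add: AE_all_countable)
  qed
  have ae_right: "AE z in \<nu>. \<forall>r. \<forall>\<epsilon>>0. \<exists>s>r. cond_le s z < cond_le r z + \<epsilon>"
  proof -
    have "AE z in \<nu>. \<forall>\<epsilon>>0. \<exists>n. cond_le (r + 1 / of_nat (Suc n)) z < cond_le r z + \<epsilon>" for r
    proof (rule AE_exists_close[OF disintegration_prob_space disintegration_measurable(1)])
      have anti: "antimono (\<lambda>n. r + 1 / of_nat (Suc n))"
        by (auto simp: antimono_def intro!: divide_left_mono)
      show "(\<lambda>n. \<integral>z. cond_le (r + 1 / of_nat (Suc n)) z \<partial>\<nu>) \<longlonglongrightarrow> (\<integral>z. cond_le r z \<partial>\<nu>)"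
        unfolding integral_cond_le_UNIV F_def[symmetric]
      proof (rule close[OF _ _ anti])
        fix \<epsilon> :: real assume "\<epsilon> > 0"
        then obtain s where s: "s > r" "F s < F r + \<epsilon>" using cdf unfolding rat_cdf_def by blast
        obtain n where "inverse (of_nat (Suc n)) < s - r" using reals_Archimedean[of "s - r"] s by auto
        then have "r + 1 / of_nat (Suc n) \<le> s" by (simp add: inverse_eq_divide)
        from mono[OF this] s show "\<exists>n. F (r + 1 / of_nat (Suc n)) < F r + \<epsilon>" by (intro exI[of _ n]) simp
      qed (rule mono, simp)
      show "AE z in \<nu>. cond_le r z \<le> cond_le (r + 1 / of_nat (Suc n)) z" for n
        using ae_mono by eventually_elim (auto simp: add_increasing2)
    qed (auto intro: cond_exp01_bounds)
    then have "AE z in \<nu>. \<forall>r. \<forall>\<epsilon>>0. \<exists>n. cond_le (r + 1 / of_nat (Suc n)) z < cond_le r z + \<epsilon>"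
      by (simp add: AE_all_countable)
    then show ?thesis
    proof eventually_elim
      case (elim z)
      show ?case
      proof (intro allI impI)
        fix r and \<epsilon> :: real assume "\<epsilon> > 0"
        then obtain n where "cond_le (r + 1 / of_nat (Suc n)) z < cond_le r z + \<epsilon>" using elim by blast
        then show "\<exists>s>r. cond_le s z < cond_le r z + \<epsilon>"
          by (intro exI[of _ "r + 1 / of_nat (Suc n)"]) simp
      qed
    qed
  qed
  have ae_bot: "AE z in \<nu>. \<forall>\<epsilon>>0. \<exists>n. cond_le (- of_nat n) z < 0 + \<epsilon>"
  proof (rule AE_exists_close[OF disintegration_prob_space disintegration_measurable(1)])
    have anti: "antimono (\<lambda>n. - of_nat n :: rat)" by (auto simp: antimono_def)
    have "(\<lambda>n. F (- of_nat n)) \<longlonglongrightarrow> 0"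
    proof (rule close[OF _ _ anti])
      fix \<epsilon> :: real assume "\<epsilon> > 0"
      then obtain s where s: "F s < \<epsilon>" using cdf unfolding rat_cdf_def by blast
      obtain n where "- s \<le> of_nat n" using real_arch_simple by blast
      then have "- of_nat n \<le> s" by simp
      from mono[OF this] s show "\<exists>n. F (- of_nat n) < 0 + \<epsilon>" by (intro exI[of _ n]) simp
    qed (use cdf in \<open>auto simp: rat_cdf_def\<close>)
    then show "(\<lambda>n. \<integral>z. cond_le (- of_nat n) z \<partial>\<nu>) \<longlonglongrightarrow> (\<integral>z. 0 \<partial>\<nu>)"
      unfolding integral_cond_le_UNIV F_def[symmetric] by simp
  qed (auto intro: cond_exp01_bounds)
  have ae_top: "AE z in \<nu>. \<forall>\<epsilon>>0. \<exists>n. 1 - cond_le (of_nat n) z < 0 + \<epsilon>"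
  proof (rule AE_exists_close[OF disintegration_prob_space disintegration_measurable(1)])
    have int: "integrable \<nu> (cond_le r)" for r
      by (rule integrable_const_bound[of _ 1]) (auto intro!: AE_I2 simp: cond_exp01_bounds)
    have "(\<integral>z. 1 - cond_le r z \<partial>\<nu>) = 1 - F r" for r
      using int by (simp add: integral_cond_le_UNIV F_def prob_space)
    moreover have "(\<lambda>n. 1 - F (of_nat n)) \<longlonglongrightarrow> 0"
    proof (rule decreasing_tendsto)
      fix x :: real assume "0 < x"
      then obtain s where s: "1 - x < F s" using cdf unfolding rat_cdf_def by blast
      obtain n where n: "s \<le> of_nat n" using real_arch_simple by blast
      have "1 - F (of_nat m) < x" if "m \<ge> n" for m
      proof -
        have "s \<le> of_nat m" using n that by (meson of_nat_mono order_trans)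
        from mono[OF this] s show ?thesis by simp
      qed
      then show "\<forall>\<^sub>F m in sequentially. 1 - F (of_nat m) < x" by (auto simp: eventually_sequentially)
    qed (use cdf in \<open>auto simp: rat_cdf_def\<close>)
    ultimately show "(\<lambda>n. \<integral>z. 1 - cond_le (of_nat n) z \<partial>\<nu>) \<longlonglongrightarrow> (\<integral>z. 0 \<partial>\<nu>)"
      by (simp del: of_rat_of_nat_eq)
  qed (auto intro: cond_exp01_bounds simp del: of_rat_of_nat_eq)
  show ?thesis
    using ae_mono ae_right ae_bot ae_top
  proof eventually_elim
    case (elim z)
    have "\<exists>r. 1 - \<epsilon> < cond_le r z" if \<epsilon>: "\<epsilon> > 0" for \<epsilon>
    proof -
      obtain n where "1 - cond_le (of_nat n) z < 0 + \<epsilon>" using elim(4) \<epsilon> by blast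
      then show ?thesis by (intro exI[of _ "of_nat n"]) (simp del: of_rat_of_nat_eq)
    qed
    moreover have "\<exists>r. cond_le r z < \<epsilon>" if \<epsilon>: "\<epsilon> > 0" for \<epsilon>
    proof -
      obtain n where "cond_le (- of_nat n) z < 0 + \<epsilon>" using elim(3) \<epsilon> by blast
      then show ?thesis by (intro exI[of _ "- of_nat n"]) simp
    qed
    moreover have "mono (\<lambda>r. cond_le r z)" using elim(1) by (simp add: mono_def)
    ultimately show ?case
      unfolding rat_cdf_def using elim(2) cond_exp01_bounds[of \<nu> fst _ z] by blast
  qed
qed

text \<open>Off a null set the kernel has distribution function \<open>cond_le\<close>, and on
  rectangles the claim becomes the defining property of a conditional expectation.\<close>

lemma kernel_prod_cond_kernel: "kernel_prod borel borel (distr \<nu> borel fst) (cond_kernel \<nu>) = \<nu>"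
proof (rule prob_eqI_rectangles[OF borel_chain_real])
  have m: "distr \<nu> borel fst \<in> space (prob_algebra borel)"
    by (rule distr_in_prob_algebra[OF \<nu>]) simp
  have k: "cond_kernel \<nu> \<in> borel \<rightarrow>\<^sub>M prob_algebra borel"
    using measurable_Pair2[OF measurable_cond_kernel \<nu>] by simp
  show "kernel_prod borel borel (distr \<nu> borel fst) (cond_kernel \<nu>) \<in> space (prob_algebra (borel \<Otimes>\<^sub>M borel))"
    by (rule kernel_prod_in_prob_algebra[OF m k])
  fix B :: "real set" and r assume B [measurable]: "B \<in> sets borel"
  have [measurable]: "(\<lambda>x. emeasure (cond_kernel \<nu> x) (rat_atMost r)) \<in> borel_measurable borel"
    using measurable_compose[OF measurable_prob_algebraD[OF k] measurable_emeasure_subprob_algebra] by simp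
  have "emeasure (kernel_prod borel borel (distr \<nu> borel fst) (cond_kernel \<nu>)) (B \<times> rat_atMost r)
      = (\<integral>\<^sup>+x. indicator B x * emeasure (cond_kernel \<nu> x) (rat_atMost r) \<partial>distr \<nu> borel fst)"
    by (rule emeasure_kernel_prod_Times[OF m k]) auto
  also have "\<dots> = (\<integral>\<^sup>+z. indicator B (fst z) * emeasure (cond_kernel \<nu> (fst z)) (rat_atMost r) \<partial>\<nu>)"
    by (rule nn_integral_distr) auto
  also have "\<dots> = (\<integral>\<^sup>+z. ennreal (indicator B (fst z) * cond_le r z) \<partial>\<nu>)"
  proof (rule nn_integral_cong_AE)
    show "AE z in \<nu>. indicator B (fst z) * emeasure (cond_kernel \<nu> (fst z)) (rat_atMost r) =
        ennreal (indicator B (fst z) * cond_le r z)"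
      using AE_cond_cdf AE_rat_cdf_cond_le
    proof eventually_elim
      case (elim z)
      have "cond_cdf \<nu> (fst z) = (\<lambda>r. cond_le r z)" using elim(1) by auto
      then have "emeasure (cond_kernel \<nu> (fst z)) (rat_atMost r) = ennreal (cond_le r z)"
        unfolding cond_kernel_def using emeasure_cdf_kernel[OF elim(2)] by simp
      then show ?case by (simp add: indicator_def)
    qed
  qed
  also have "\<dots> = ennreal (\<integral>z. indicator B (fst z) * cond_le r z \<partial>\<nu>)"
  proof (rule nn_integral_eq_integral)
    show "integrable \<nu> (\<lambda>z. indicator B (fst z) * cond_le r z)"
      by (rule integrable_cond_exp01[where B=1]) (auto simp: disintegration_prob_space indicator_def)
  qed (intro AE_I2 mult_nonneg_nonneg cond_exp01_bounds indicator_pos_le)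
  also have "\<dots> = emeasure \<nu> (B \<times> rat_atMost r)"
    unfolding integral_cond_le[OF B] by (rule emeasure_eq_measure[symmetric])
  finally show "emeasure (kernel_prod borel borel (distr \<nu> borel fst) (cond_kernel \<nu>)) (B \<times> rat_atMost r)
    = emeasure \<nu> (B \<times> rat_atMost r)" .
qed (rule \<nu>)

end

text \<open>The measure is pushed to the plane by the two embeddings, disintegrated there, and the
  kernel is pulled back. As D after E is the identity, \<nu> is recovered from its image.\<close>

theorem measurable_disintegration:
  assumes "real_retract M" "real_retract N"
  obtains K where "(\<lambda>(\<nu>, x). K \<nu> x) \<in> prob_algebra (M \<Otimes>\<^sub>M N) \<Otimes>\<^sub>M M \<rightarrow>\<^sub>M prob_algebra N"
    "\<And>\<nu>. \<nu> \<in> space (prob_algebra (M \<Otimes>\<^sub>M N)) \<Longrightarrow> kernel_prod M N (distr \<nu> M fst) (K \<nu>) = \<nu>"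
proof -
  obtain e d where e [measurable]: "e \<in> M \<rightarrow>\<^sub>M (borel :: real measure)" and d [measurable]: "d \<in> borel \<rightarrow>\<^sub>M M"
    and de: "\<And>x. x \<in> space M \<Longrightarrow> d (e x) = x" using assms(1) unfolding real_retract_def by blast
  obtain e' d' where e' [measurable]: "e' \<in> N \<rightarrow>\<^sub>M (borel :: real measure)" and d' [measurable]: "d' \<in> borel \<rightarrow>\<^sub>M N"
    and de': "\<And>x. x \<in> space N \<Longrightarrow> d' (e' x) = x" using assms(2) unfolding real_retract_def by blast
  define E where "E z = (e (fst z), e' (snd z))" for z
  define D where "D z = (d (fst z), d' (snd z))" for z
  have E [measurable]: "E \<in> M \<Otimes>\<^sub>M N \<rightarrow>\<^sub>M borel \<Otimes>\<^sub>M borel" unfolding E_def by measurable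
  have D [measurable]: "D \<in> borel \<Otimes>\<^sub>M borel \<rightarrow>\<^sub>M M \<Otimes>\<^sub>M N" unfolding D_def by measurable
  have DE: "z \<in> space (M \<Otimes>\<^sub>M N) \<Longrightarrow> D (E z) = z" for z
    by (auto simp: D_def E_def space_pair_measure de de')
  define K where "K \<nu> x = distr (cond_kernel (distr \<nu> (borel \<Otimes>\<^sub>M borel) E) (e x)) N d'" for \<nu> x
  have "(\<lambda>w. (distr (fst w) (borel \<Otimes>\<^sub>M borel) E, e (snd w))) \<in>
      prob_algebra (M \<Otimes>\<^sub>M N) \<Otimes>\<^sub>M M \<rightarrow>\<^sub>M prob_algebra (borel \<Otimes>\<^sub>M borel) \<Otimes>\<^sub>M borel"
    by (intro measurable_Pair measurable_compose[OF measurable_fst measurable_distr_prob_space[OF E]])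
       (rule measurable_compose[OF measurable_snd e])
  from measurable_compose[OF measurable_compose[OF this measurable_cond_kernel] measurable_distr_prob_space[OF d']]
  have 1: "(\<lambda>(\<nu>, x). K \<nu> x) \<in> prob_algebra (M \<Otimes>\<^sub>M N) \<Otimes>\<^sub>M M \<rightarrow>\<^sub>M prob_algebra N"
    by (simp add: K_def split_beta)
  have 2: "kernel_prod M N (distr \<nu> M fst) (K \<nu>) = \<nu>" if \<nu>: "\<nu> \<in> space (prob_algebra (M \<Otimes>\<^sub>M N))" for \<nu>
  proof -
    define \<nu>' where "\<nu>' = distr \<nu> (borel \<Otimes>\<^sub>M borel) E"
    have \<nu>': "\<nu>' \<in> space (prob_algebra (borel \<Otimes>\<^sub>M borel))"
      unfolding \<nu>'_def by (rule distr_in_prob_algebra[OF \<nu> E])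
    define m where "m = distr \<nu> M fst"
    have m: "m \<in> space (prob_algebra M)" unfolding m_def by (rule distr_in_prob_algebra[OF \<nu>]) simp
    have m': "distr \<nu>' borel fst = distr m borel e"
      unfolding \<nu>'_def m_def by (simp add: distr_distr_prob_algebra[OF \<nu>] E_def)
    have k: "cond_kernel \<nu>' \<in> borel \<rightarrow>\<^sub>M prob_algebra borel"
      using measurable_Pair2[OF measurable_cond_kernel \<nu>'] by simp
    have k_in: "cond_kernel \<nu>' t \<in> space (prob_algebra borel)" for t
      using measurable_space[OF k, of t] by simp
    have "\<nu> = distr \<nu>' (M \<Otimes>\<^sub>M N) D"
      unfolding \<nu>'_def by (simp add: distr_distr_prob_algebra[OF \<nu> E D] distr_id_prob_algebra[OF \<nu> DE])
    also have "\<nu>' = kernel_prod borel borel (distr m borel e) (cond_kernel \<nu>')"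
      using kernel_prod_cond_kernel[OF \<nu>'] m' by simp
    also have "distr \<dots> (M \<Otimes>\<^sub>M N) D =
        distr m borel e \<bind> (\<lambda>t. distr (distr (cond_kernel \<nu>' t) (borel \<Otimes>\<^sub>M borel) (Pair t)) (M \<Otimes>\<^sub>M N) D)"
      unfolding kernel_prod_def
      by (rule distr_bind_prob_algebra[OF _ measurable_kernel_prod_slice[OF k] D])
         (rule distr_in_prob_algebra[OF m e])
    also have "\<dots> = m \<bind> (\<lambda>x. distr (distr (cond_kernel \<nu>' (e x)) (borel \<Otimes>\<^sub>M borel) (Pair (e x))) (M \<Otimes>\<^sub>M N) D)"
      by (rule bind_distr_prob_algebra[OF m e])
         (rule measurable_compose[OF measurable_kernel_prod_slice[OF k] measurable_distr_prob_space[OF D]])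
    also have "\<dots> = kernel_prod M N m (K \<nu>)"
      unfolding kernel_prod_def
    proof (rule bind_cong_prob_algebra[OF m])
      fix x assume x: "x \<in> space M"
      show "distr (distr (cond_kernel \<nu>' (e x)) (borel \<Otimes>\<^sub>M borel) (Pair (e x))) (M \<Otimes>\<^sub>M N) D =
          distr (K \<nu> x) (M \<Otimes>\<^sub>M N) (Pair x)"
        unfolding K_def \<nu>'_def[symmetric] using x
        by (simp add: distr_distr_prob_algebra[OF k_in] D_def de)
    qed
    finally show ?thesis by (simp add: m_def)
  qed
  from 1 2 show thesis by (rule that)
qed

section \<open>Analytic sets\<close>

text \<open>The working notion. \<open>analytic_inI\<close> and
  \<open>analytic_in_subset_imp_analytic\<close> connect it with \<open>analytic_in\<close>, whose
  parameter spaces are Polish topologies on sets of reals.\<close>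

definition analytic :: "'a::topological_space set \<Rightarrow> bool" where
  "analytic S \<longleftrightarrow> S = {} \<or> (\<exists>g :: (nat \<Rightarrow> nat) \<Rightarrow> 'a. continuous_on UNIV g \<and> range g = S)"

lemma analytic_continuous_image:
  assumes "analytic S" "continuous_on S h"
  shows "analytic (h ` S)"
proof (cases "S = {}")
  case False
  then obtain g :: "(nat \<Rightarrow> nat) \<Rightarrow> 'a" where g: "continuous_on UNIV g" "range g = S"
    using assms(1) by (auto simp: analytic_def)
  then have "continuous_on UNIV (h \<circ> g)" using assms(2) by (intro continuous_on_compose) auto
  moreover have "range (h \<circ> g) = h ` S" using g by auto
  ultimately show ?thesis unfolding analytic_def by blast
qed (simp add: analytic_def)

lemma analytic_closed:
  fixes S :: "'a::polish_space set"
  assumes "closed S"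
  shows "analytic S"
proof (cases "S = {}")
  case False
  have "completely_metrizable_space (top_of_set S)"
    using assms completely_metrizable_space_euclidean
    by (intro completely_metrizable_space_closedin) auto
  moreover have "second_countable (top_of_set S)"
    by (intro second_countable_subtopology second_countable_euclidean)
  ultimately obtain u :: "(nat \<Rightarrow> nat) \<Rightarrow> 'a" and e where
    u: "continuous_map euclidean (top_of_set S) u" and ue: "\<And>x. x \<in> S \<Longrightarrow> u (e x) = x"
    using False by (elim completely_metrizable_baire_retract) auto
  have "continuous_on UNIV u" "range u \<subseteq> S"
    using u by (auto simp: continuous_map_in_subtopology)
  moreover have "S \<subseteq> range u" using ue by (metis rangeI subsetI)
  ultimately show ?thesis unfolding analytic_def by blast
qed (simp add: analytic_def)

text \<open>The first entry of a sequence selects the set and the remaining entries select a point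
  in it.\<close>

lemma analytic_UN:
  fixes S :: "nat \<Rightarrow> 'a::topological_space set"
  assumes "\<And>n. analytic (S n)"
  shows "analytic (\<Union>n. S n)"
proof (cases "(\<Union>n. S n) = {}")
  case False
  then obtain n0 where n0: "S n0 \<noteq> {}" by auto
  \<comment> \<open>Empty members have no parametrization; replacing them by a nonempty one keeps
    the union.\<close>
  define S' where "S' n = (if S n = {} then S n0 else S n)" for n
  have UN: "(\<Union>n. S' n) = (\<Union>n. S n)" by (auto simp: S'_def split: if_splits)
  have "\<exists>g :: (nat \<Rightarrow> nat) \<Rightarrow> 'a. continuous_on UNIV g \<and> range g = S' n" for n
    using assms[of n] assms[of n0] n0 by (auto simp: analytic_def S'_def)
  then obtain G :: "nat \<Rightarrow> (nat \<Rightarrow> nat) \<Rightarrow> 'a" where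
    G: "\<And>n. continuous_on UNIV (G n)" "\<And>n. range (G n) = S' n" by metis
  define g where "g \<sigma> = G (\<sigma> 0) (\<lambda>i. \<sigma> (Suc i))" for \<sigma>
  have shift: "continuous_on UNIV (\<lambda>\<sigma> :: nat \<Rightarrow> nat. \<lambda>i. \<sigma> (Suc i))"
    by (intro continuous_on_coordinatewise_then_product continuous_on_product_coordinates)
  have "continuous_on UNIV g"
    unfolding continuous_on_open_vimage[OF open_UNIV]
  proof (intro allI impI)
    fix B :: "'a set" assume "open B"
    have "g -` B \<inter> UNIV =
        (\<Union>n. (\<lambda>\<sigma>. \<sigma> 0) -` {n} \<inter> (\<lambda>\<sigma>. G n (\<lambda>i. \<sigma> (Suc i))) -` B)"
      by (auto simp: g_def)
    also have "open \<dots>"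
    proof (intro open_UN ballI open_Int)
      fix n
      show "open ((\<lambda>\<sigma> :: nat \<Rightarrow> nat. \<sigma> 0) -` {n})"
        by (intro open_vimage Topological_Spaces.open_discrete continuous_on_product_coordinates)
      show "open ((\<lambda>\<sigma>. G n (\<lambda>i. \<sigma> (Suc i))) -` B)"
        by (intro open_vimage \<open>open B\<close> continuous_on_compose2[OF G(1) shift]) auto
    qed
    finally show "open (g -` B \<inter> UNIV)" .
  qed
  moreover have "range g = (\<Union>n. S' n)"
  proof (intro equalityI subsetI)
    fix x assume "x \<in> (\<Union>n. S' n)"
    then obtain n \<sigma> where "x = G n \<sigma>" using G(2) by (metis UN_E rangeE)
    then have "x = g (case_nat n \<sigma>)" by (simp add: g_def)
    then show "x \<in> range g" by blast
  next
    fix x assume "x \<in> range g"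
    then show "x \<in> (\<Union>n. S' n)" using G(2) unfolding g_def by blast
  qed
  ultimately show ?thesis unfolding analytic_def UN[symmetric] by blast
qed (simp add: analytic_def)

text \<open>A point of the intersection amounts to a sequence of parameters with equal images, and
  these form a closed set in a countable power of Baire space.\<close>

lemma analytic_INT:
  fixes S :: "nat \<Rightarrow> 'a::t2_space set"
  assumes "\<And>n. analytic (S n)"
  shows "analytic (\<Inter>n. S n)"
proof (cases "\<exists>n. S n = {}")
  case False
  then have "\<exists>g :: (nat \<Rightarrow> nat) \<Rightarrow> 'a. continuous_on UNIV g \<and> range g = S n" for n
    using assms[of n] by (auto simp: analytic_def)
  then obtain G :: "nat \<Rightarrow> (nat \<Rightarrow> nat) \<Rightarrow> 'a" where
    G: "\<And>n. continuous_on UNIV (G n)" "\<And>n. range (G n) = S n" by metis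
  define C where "C = {\<tau> :: nat \<Rightarrow> nat \<Rightarrow> nat. \<forall>n. G n (\<tau> n) = G 0 (\<tau> 0)}"
  have cont: "continuous_on UNIV (\<lambda>\<tau> :: nat \<Rightarrow> nat \<Rightarrow> nat. G n (\<tau> n))" for n
    by (rule continuous_on_compose2[OF G(1) continuous_on_product_coordinates]) auto
  have "closed C"
    unfolding C_def by (intro closed_Collect_all closed_Collect_eq cont)
  then have "analytic ((\<lambda>\<tau>. G 0 (\<tau> 0)) ` C)"
    by (intro analytic_continuous_image analytic_closed continuous_on_subset[OF cont]) auto
  moreover have "(\<lambda>\<tau>. G 0 (\<tau> 0)) ` C = (\<Inter>n. S n)"
  proof (intro equalityI subsetI)
    fix x assume "x \<in> (\<Inter>n. S n)"
    then have "\<forall>n. \<exists>\<sigma>. x = G n \<sigma>" using G(2) by (metis INT_D UNIV_I rangeE)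
    then obtain \<tau> where "\<And>n. x = G n (\<tau> n)" by metis
    then show "x \<in> (\<lambda>\<tau>. G 0 (\<tau> 0)) ` C" by (auto simp: C_def image_iff intro!: exI[of _ \<tau>])
  next
    fix x assume "x \<in> (\<lambda>\<tau>. G 0 (\<tau> 0)) ` C"
    then obtain \<tau> where \<tau>: "x = G 0 (\<tau> 0)" "\<forall>n. G n (\<tau> n) = G 0 (\<tau> 0)" by (auto simp: C_def)
    have "x \<in> S n" for n using \<tau> G(2)[of n] by (metis rangeI)
    then show "x \<in> (\<Inter>n. S n)" by blast
  qed
  ultimately show ?thesis by simp
next
  case True
  then have "(\<Inter>n. S n) = {}" by blast
  then show ?thesis by (simp add: analytic_def)
qed

lemma analytic_open:
  fixes U :: "'a::polish_space set"
  assumes "open U"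
  shows "analytic U"
\<comment> \<open>\<open>infdist\<close> to the empty set is 0 by convention, so the whole space has
  to be treated apart.\<close>
proof (cases "U = UNIV")
  case False
  define F where "F n = {x. inverse (real (Suc n)) \<le> infdist x (- U)}" for n
  have "U = (\<Union>n. F n)"
  proof (intro equalityI subsetI)
    fix x assume "x \<in> U"
    then have "0 < infdist x (- U)"
      using assms False by (subst infdist_pos_not_in_closed) auto
    then obtain n where "inverse (real (Suc n)) < infdist x (- U)" using reals_Archimedean by blast
    then show "x \<in> (\<Union>n. F n)" by (auto simp: F_def intro!: exI[of _ n])
  next
    fix x assume "x \<in> (\<Union>n. F n)"
    then obtain n where n: "inverse (real (Suc n)) \<le> infdist x (- U)" by (auto simp: F_def)
    have "0 < inverse (real (Suc n))" by simp
    with n have "infdist x (- U) \<noteq> 0" by linarith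
    then show "x \<in> U" by (metis ComplI infdist_zero)
  qed
  moreover have "analytic (F n)" for n
    unfolding F_def
    by (intro analytic_closed closed_Collect_le continuous_intros)
  ultimately show ?thesis using analytic_UN[of F] by simp
qed (simp add: analytic_closed)

text \<open>Analytic sets are not closed under complements, so the induction carries each set
  together with its complement; unions then need \<open>analytic_INT\<close> for the
  complements.\<close>

lemma analytic_borel:
  fixes S :: "'a::polish_space set"
  assumes "S \<in> sets borel"
  shows "analytic S"
proof -
  have "S \<in> sigma_sets UNIV {U. open U}" using assms by (simp add: borel_def)
  then have "analytic S \<and> analytic (- S)"
  proof (induction rule: sigma_sets.induct)
    case (Basic U)
    then show ?case by (simp add: analytic_open analytic_closed closed_Compl)
  next
    case Empty
    then show ?case by (simp add: analytic_closed)
  next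
    case (Compl U)
    then show ?case by (simp add: Compl_eq_Diff_UNIV[symmetric])
  next
    case (Union U)
    then show ?case using analytic_UN[of U] analytic_INT[of "\<lambda>n. - U n"] by (simp add: Compl_UN)
  qed
  then show ?thesis ..
qed

text \<open>The image is the projection of the graph; the graph is Borel and the projection
  continuous.\<close>

lemma analytic_borel_image:
  fixes g :: "'a::polish_space \<Rightarrow> 'b::polish_space"
  assumes D: "D \<in> sets borel" and g: "g \<in> restrict_space borel D \<rightarrow>\<^sub>M borel"
  shows "analytic (g ` D)"
proof -
  have [measurable]: "D \<in> sets borel" by fact
  define g' where "g' x = (if x \<in> D then g x else undefined)" for x
  have [measurable]: "g' \<in> borel_measurable borel"
    unfolding g'_def by (rule measurable_If_restrict_space_iff[THEN iffD2]) (use g in auto)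
  have "{z \<in> space (borel \<Otimes>\<^sub>M borel). fst z \<in> D \<and> dist (snd z) (g' (fst z)) = 0} \<in> sets (borel \<Otimes>\<^sub>M borel)"
    by measurable
  then have "{z. fst z \<in> D \<and> snd z = g (fst z)} \<in> sets borel"
    unfolding borel_prod by (simp add: space_pair_measure g'_def cong: conj_cong)
  then have "analytic (snd ` {z. fst z \<in> D \<and> snd z = g (fst z)})"
    by (intro analytic_continuous_image analytic_borel continuous_on_snd continuous_on_id)
  also have "snd ` {z. fst z \<in> D \<and> snd z = g (fst z)} = g ` D" by (auto simp: image_iff)
  finally show ?thesis .
qed

section \<open>Universal measurability and measurable selection\<close>

lemma tendsto_nat_fun_iff:
  fixes f :: "'b \<Rightarrow> nat \<Rightarrow> nat"
  shows "(f \<longlongrightarrow> l) F \<longleftrightarrow> (\<forall>i. \<forall>\<^sub>F x in F. f x i = l i)"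
proof -
  have "(f \<longlongrightarrow> l) F \<longleftrightarrow> limitin (product_topology (\<lambda>_. euclidean) UNIV) f l F"
    by (simp add: euclidean_product_topology)
  also have "\<dots> \<longleftrightarrow> (\<forall>i. ((\<lambda>x. f x i) \<longlongrightarrow> l i) F)"
    by (simp add: limitin_componentwise)
  also have "\<dots> \<longleftrightarrow> (\<forall>i. \<forall>\<^sub>F x in F. f x i = l i)"
    by (simp add: tendsto_discrete)
  finally show ?thesis .
qed

lemma compact_bounded_sequences: "compact {\<sigma> :: nat \<Rightarrow> nat. \<forall>i. \<sigma> i \<le> N i}"
proof -
  have "compactin (product_topology (\<lambda>_. euclidean) UNIV) (PiE UNIV (\<lambda>i. {..N i}))"
    unfolding compactin_PiE by (auto simp: finite_imp_compact)
  moreover have "PiE UNIV (\<lambda>i. {..N i}) = {\<sigma>. \<forall>i. \<sigma> i \<le> N i}" by (auto simp: PiE_def)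
  ultimately show ?thesis by (simp add: euclidean_product_topology)
qed

lemma completion_sandwich:
  assumes "L \<in> sets M" "E \<in> sets M" "L \<subseteq> R" "R \<subseteq> E" "emeasure M (E - L) = 0"
  shows "R \<in> sets (completion M)"
proof (rule sets_completionI)
  show "R = L \<union> (R - L)" "R - L \<subseteq> E - L" using assms by auto
  show "E - L \<in> null_sets M" using assms by auto
qed (rule assms(1))

text \<open>Any value below the outer measure is still exceeded after truncating every coordinate, and
  the truncated set of sequences is compact.\<close>

lemma analytic_inner_approx:
  fixes g :: "(nat \<Rightarrow> nat) \<Rightarrow> 'a::metric_space"
  assumes g: "continuous_on UNIV g" and p: "finite_measure p" "sets p = sets borel"
    and c: "c < outer_measure_of p (range g)"
  obtains L where "L \<in> sets p" "L \<subseteq> range g" "c \<le> emeasure p L"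
proof -
  interpret finite_measure p by fact
  have sp: "space p = UNIV" using sets_eq_imp_space_eq[OF p(2)] by simp
  define B where "B n x = {\<sigma> :: nat \<Rightarrow> nat. \<forall>i<n. \<sigma> i \<le> x i}" for n and x :: "nat \<Rightarrow> nat"
  have "\<exists>f. \<forall>n. c < outer_measure_of p (g ` B n (f n)) \<and> (\<forall>i<n. f (Suc n) i = f n i)"
  proof (rule dependent_nat_choice)
    show "\<exists>x. c < outer_measure_of p (g ` B 0 x)" using c by (simp add: B_def)
    fix x n assume x: "c < outer_measure_of p (g ` B n x)"
    have B: "B (Suc n) (x(n := m)) = B n x \<inter> {\<sigma>. \<sigma> n \<le> m}" for m
      by (auto simp: B_def less_Suc_eq)
    have inc: "incseq (\<lambda>m. g ` B (Suc n) (x(n := m)))"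
      unfolding incseq_def B by (intro allI impI image_mono) auto
    have "(\<Union>m. B (Suc n) (x(n := m))) = B n x" unfolding B by auto
    then have "(\<Union>m. g ` B (Suc n) (x(n := m))) = g ` B n x" by (simp only: image_UN[symmetric])
    \<comment> \<open>Outer measure is continuous from below along arbitrary increasing sets, and
      the sets here are not yet known to be measurable.\<close>
    then have "(SUP m. outer_measure_of p (g ` B (Suc n) (x(n := m)))) = outer_measure_of p (g ` B n x)"
      using SUP_outer_measure_of_incseq[OF _ inc, of p] sp by simp
    with x have "c < (SUP m. outer_measure_of p (g ` B (Suc n) (x(n := m))))" by (simp only:)
    then obtain m where "c < outer_measure_of p (g ` B (Suc n) (x(n := m)))"
      unfolding less_SUP_iff by blast
    then show "\<exists>y. c < outer_measure_of p (g ` B (Suc n) y) \<and> (\<forall>i<n. y i = x i)"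
      by (intro exI[of _ "x(n := m)"]) simp
  qed
  then obtain f where f: "\<And>n. c < outer_measure_of p (g ` B n (f n))" "\<And>n i. i < n \<Longrightarrow> f (Suc n) i = f n i"
    by blast
  \<comment> \<open>Coordinate i is settled at stage i + 1 and kept afterwards, so this diagonal
    gives the bounds of all stages.\<close>
  define N where "N i = f (Suc i) i" for i
  have fN: "f n i = N i" if "i < n" for n i
    using that
  proof (induction n)
    case (Suc n)
    then show ?case using f(2)[of i n] by (cases "i = n") (auto simp: N_def)
  qed simp
  have BN: "B n (f n) = B n N" for n using fN by (auto simp: B_def)
  define E where "E n = closure (g ` B n N)" for n
  have sub: "(\<Inter>n. E n) \<subseteq> range g"
  proof
    fix y assume y: "y \<in> (\<Inter>n. E n)"
    have "\<exists>\<sigma>. \<sigma> \<in> B n N \<and> dist (g \<sigma>) y < inverse (real (Suc n))" for n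
    proof -
      have "y \<in> closure (g ` B n N)" using y by (auto simp: E_def)
      moreover have "0 < inverse (real (Suc n))" by simp
      ultimately show ?thesis unfolding closure_approachable by blast
    qed
    then obtain \<sigma> where \<sigma>: "\<And>n. \<sigma> n \<in> B n N" "\<And>n. dist (g (\<sigma> n)) y < inverse (real (Suc n))" by metis
    \<comment> \<open>Truncation by N moves the sequences into a compact set and leaves the first n
      entries of \<sigma> n as they are, so a limit of the truncated sequences is a limit of the
      original ones.\<close>
    define \<tau> where "\<tau> n i = min (\<sigma> n i) (N i)" for n i
    have "\<forall>n. \<tau> n \<in> {\<sigma>. \<forall>i. \<sigma> i \<le> N i}" by (simp add: \<tau>_def)
    then obtain l r where r: "strict_mono r" "(\<tau> \<circ> r) \<longlonglongrightarrow> l"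
      using compact_imp_seq_compact[OF compact_bounded_sequences[of N]] unfolding seq_compact_def by blast
    have "\<forall>\<^sub>F n in sequentially. \<sigma> (r n) i = l i" for i
    proof -
      have "\<forall>\<^sub>F n in sequentially. \<tau> (r n) i = l i"
        using r(2) unfolding tendsto_nat_fun_iff by simp
      moreover have "\<forall>\<^sub>F n in sequentially. i < n" by (rule eventually_gt_at_top)
      ultimately show ?thesis
      proof eventually_elim
        case (elim n)
        then have "i < r n" using seq_suble[OF r(1), of n] by simp
        then have "\<sigma> (r n) i \<le> N i" using \<sigma>(1)[of "r n"] by (simp add: B_def)
        with elim show ?case by (simp add: \<tau>_def)
      qed
    qed
    then have "(\<lambda>n. \<sigma> (r n)) \<longlonglongrightarrow> l" by (simp add: tendsto_nat_fun_iff)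
    then have "(\<lambda>n. g (\<sigma> (r n))) \<longlonglongrightarrow> g l"
      using g by (intro continuous_on_tendsto_compose[OF g]) auto
    moreover have "(\<lambda>n. g (\<sigma> n)) \<longlonglongrightarrow> y"
    proof (rule tendsto_dist_iff[THEN iffD2], rule tendsto_sandwich[of "\<lambda>_. 0"])
      show "\<forall>\<^sub>F n in sequentially. dist (g (\<sigma> n)) y \<le> inverse (real (Suc n))"
        using \<sigma>(2) by (intro always_eventually allI less_imp_le)
      show "(\<lambda>n. inverse (real (Suc n))) \<longlonglongrightarrow> 0" by (rule LIMSEQ_inverse_real_of_nat)
    qed auto
    then have "(\<lambda>n. g (\<sigma> (r n))) \<longlonglongrightarrow> y"
      using LIMSEQ_subseq_LIMSEQ[OF _ r(1)] by (fastforce simp: comp_def)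
    ultimately have "y = g l" using LIMSEQ_unique by blast
    then show "y \<in> range g" by simp
  qed
  have [measurable]: "E n \<in> sets p" for n unfolding E_def p(2) by simp
  have "c \<le> emeasure p (E n)" for n
  proof -
    have "c < outer_measure_of p (g ` B n N)" using f(1)[of n] BN by simp
    also have "\<dots> \<le> outer_measure_of p (E n)"
      unfolding E_def by (rule outer_measure_of_mono[OF closure_subset])
    also have "\<dots> = emeasure p (E n)" by simp
    finally show ?thesis by simp
  qed
  moreover have "decseq E"
    unfolding decseq_def E_def by (intro allI impI closure_mono image_mono) (auto simp: B_def)
  ultimately have "c \<le> emeasure p (\<Inter>n. E n)"
    by (subst INF_emeasure_decseq[symmetric]) (auto intro: INF_greatest)
  moreover have "(\<Inter>n. E n) \<in> sets p" by measurable
  ultimately show thesis using sub that by blast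
qed

text \<open>Measurable subsets of S come arbitrarily close to its outer measure. Their union and a
  measurable hull of S enclose S and differ by a null set.\<close>

lemma analytic_universally_measurable:
  fixes S :: "'a::metric_space set"
  assumes S: "analytic S" and p: "finite_measure p" "sets p = sets borel"
  shows "S \<in> sets (completion p)"
proof (cases "S = {}")
  case False
  interpret finite_measure p by fact
  have sp: "space p = UNIV" using sets_eq_imp_space_eq[OF p(2)] by simp
  obtain g :: "(nat \<Rightarrow> nat) \<Rightarrow> 'a" where g: "continuous_on UNIV g" "range g = S"
    using S False unfolding analytic_def by blast
  obtain E where E: "E \<in> sets p" "S \<subseteq> E" "outer_measure_of p S = emeasure p E"
    using outer_measure_of_attain[of S p] sp by auto
  have "\<exists>L. L \<in> sets p \<and> L \<subseteq> S \<and> measure p E - inverse (real (Suc n)) \<le> measure p L" for n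
  proof (cases "measure p E - inverse (real (Suc n)) < 0")
    case False
    then have "ennreal (measure p E - inverse (real (Suc n))) < outer_measure_of p (range g)"
    proof -
      have "0 < inverse (real (Suc n))" by simp
      with False show ?thesis unfolding g E emeasure_eq_measure by (intro ennreal_lessI) linarith+
    qed
    then obtain L where "L \<in> sets p" "L \<subseteq> S" "ennreal (measure p E - inverse (real (Suc n))) \<le> emeasure p L"
      using analytic_inner_approx[OF g(1) p] g(2) by metis
    then show ?thesis unfolding emeasure_eq_measure by (auto simp: ennreal_le_iff)
  qed (use less_imp_le in \<open>auto intro!: exI[of _ "{}"]\<close>)
  then obtain L where L: "\<And>n. L n \<in> sets p" "\<And>n. L n \<subseteq> S"
    "\<And>n. measure p E - inverse (real (Suc n)) \<le> measure p (L n)" by metis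
  show ?thesis
  proof (rule completion_sandwich)
    show UL: "(\<Union>n. L n) \<in> sets p" using L(1) by blast
    show "(\<Union>n. L n) \<subseteq> S" using L(2) by blast
    have "measure p (E - (\<Union>n. L n)) \<le> 0"
    proof (rule field_le_epsilon)
      fix \<epsilon> :: real assume "\<epsilon> > 0"
      then obtain n where n: "inverse (real (Suc n)) < \<epsilon>" using reals_Archimedean by blast
      have "measure p (L n) \<le> measure p (\<Union>n. L n)"
        using UL by (intro finite_measure_mono) auto
      moreover have "measure p (E - (\<Union>n. L n)) = measure p E - measure p (\<Union>n. L n)"
        using UL E L(2) by (intro finite_measure_Diff) auto
      ultimately show "measure p (E - (\<Union>n. L n)) \<le> 0 + \<epsilon>" using L(3)[of n] n by simp
    qed
    then have "measure p (E - (\<Union>n. L n)) = 0" using measure_nonneg[of p "E - (\<Union>n. L n)"] by linarith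
    then show "emeasure p (E - (\<Union>n. L n)) = 0" by (simp add: emeasure_eq_measure)
  qed (use E in auto)
qed simp

section \<open>Lexicographic selection\<close>

definition cylinder :: "nat list \<Rightarrow> (nat \<Rightarrow> nat) set" where
  "cylinder t = {\<sigma>. \<forall>i<length t. \<sigma> i = t ! i}"

text \<open>Which cylinders have y in their image decides the lexicographic choice at y, so
  universal measurability of these images is what makes \<open>lex_select\<close>
  measurable.\<close>

lemma analytic_cylinder_image:
  assumes "continuous_on UNIV g"
  shows "analytic (g ` cylinder t)"
proof -
  define h where "h \<sigma> i = (if i < length t then t ! i else \<sigma> (i - length t))" for \<sigma> :: "nat \<Rightarrow> nat" and i
  have h: "continuous_on UNIV h"
    unfolding h_def
  proof (rule continuous_on_coordinatewise_then_product)
    show "continuous_on UNIV (\<lambda>\<sigma>. if i < length t then t ! i else \<sigma> (i - length t))" for i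
      by (cases "i < length t") (simp_all add: continuous_on_product_coordinates)
  qed
  have "range h = cylinder t"
  proof (intro equalityI subsetI)
    fix \<sigma> assume "\<sigma> \<in> cylinder t"
    then have "\<sigma> = h (\<lambda>i. \<sigma> (i + length t))" by (auto simp: h_def cylinder_def)
    then show "\<sigma> \<in> range h" by blast
  qed (auto simp: h_def cylinder_def)
  then have "analytic (cylinder t)" using h unfolding analytic_def by blast
  then show ?thesis by (rule analytic_continuous_image) (rule continuous_on_subset[OF assms], simp)
qed

text \<open>The lexicographically least point of the closed fibre of \<open>g\<close> over \<open>y\<close>.\<close>

primrec lex_prefix :: "((nat \<Rightarrow> nat) \<Rightarrow> 'a) \<Rightarrow> 'a \<Rightarrow> nat \<Rightarrow> nat list" where
  "lex_prefix g y 0 = []"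
| "lex_prefix g y (Suc n) =
     lex_prefix g y n @ [LEAST m. y \<in> g ` cylinder (lex_prefix g y n @ [m])]"

definition lex_select :: "((nat \<Rightarrow> nat) \<Rightarrow> 'a) \<Rightarrow> 'a \<Rightarrow> nat \<Rightarrow> nat" where
  "lex_select g y n = lex_prefix g y (Suc n) ! n"

lemma length_lex_prefix [simp]: "length (lex_prefix g y n) = n"
  by (induction n) auto

lemma lex_prefix_nth: "i < n \<Longrightarrow> lex_prefix g y n ! i = lex_select g y i"
proof (induction n)
  case (Suc n)
  then show ?case
    by (cases "i = n") (auto simp: lex_select_def nth_append)
qed simp

lemma lex_prefix_in: "y \<in> range g \<Longrightarrow> y \<in> g ` cylinder (lex_prefix g y n)"
proof (induction n)
  case 0
  then show ?case by (simp add: cylinder_def)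
next
  case (Suc n)
  then obtain \<sigma> where \<sigma>: "\<sigma> \<in> cylinder (lex_prefix g y n)" "y = g \<sigma>" by auto
  then have "\<sigma> \<in> cylinder (lex_prefix g y n @ [\<sigma> n])"
    by (auto simp: cylinder_def less_Suc_eq nth_append)
  then have "y \<in> g ` cylinder (lex_prefix g y n @ [\<sigma> n])" using \<sigma>(2) by blast
  then show ?case unfolding lex_prefix.simps by (rule LeastI)
qed

text \<open>The fibre over y meets every cylinder around \<open>lex_select g y\<close>. Points of
  these intersections converge to \<open>lex_select g y\<close>, and g is continuous.\<close>

lemma lex_select_section:
  fixes g :: "(nat \<Rightarrow> nat) \<Rightarrow> 'a::t2_space"
  assumes g: "continuous_on UNIV g" and y: "y \<in> range g"
  shows "g (lex_select g y) = y"
proof -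
  have "\<exists>\<sigma>. \<sigma> \<in> cylinder (lex_prefix g y n) \<and> g \<sigma> = y" for n
    using lex_prefix_in[OF y, of n] by blast
  then obtain \<sigma> where \<sigma>: "\<And>n. \<sigma> n \<in> cylinder (lex_prefix g y n)" "\<And>n. g (\<sigma> n) = y" by metis
  have "\<forall>\<^sub>F n in sequentially. \<sigma> n i = lex_select g y i" for i
    using eventually_gt_at_top[of i]
    by eventually_elim (use \<sigma>(1) in \<open>auto simp: cylinder_def lex_prefix_nth\<close>)
  then have "\<sigma> \<longlonglongrightarrow> lex_select g y" by (simp add: tendsto_nat_fun_iff)
  then have "(\<lambda>n. g (\<sigma> n)) \<longlonglongrightarrow> g (lex_select g y)"
    by (intro continuous_on_tendsto_compose[OF g]) auto
  then show ?thesis unfolding \<sigma>(2) using LIMSEQ_unique tendsto_const by metis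
qed

lemma measurable_lex_select:
  fixes g :: "(nat \<Rightarrow> nat) \<Rightarrow> 'a::metric_space"
  assumes g: "continuous_on UNIV g" and p: "finite_measure p" "sets p = sets borel"
  shows "lex_select g \<in> completion p \<rightarrow>\<^sub>M borel"
proof -
  have [measurable]: "g ` cylinder t \<in> sets (completion p)" for t
    by (rule analytic_universally_measurable[OF analytic_cylinder_image[OF g] p])
  have [measurable]: "(\<lambda>y. lex_prefix g y n) \<in> completion p \<rightarrow>\<^sub>M count_space UNIV" for n
  proof (induction n)
    case (Suc n)
    note Suc [measurable]
    have "(\<lambda>y. t @ [LEAST m. y \<in> g ` cylinder (t @ [m])]) \<in> completion p \<rightarrow>\<^sub>M count_space UNIV" for t
      by (rule measurable_compose[OF _ measurable_count_space]) measurable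
    from measurable_compose_countable[OF this Suc] show ?case by simp
  qed simp
  show ?thesis
    by (rule measurable_coordinatewise_then_product, unfold lex_select_def measurable_countable_borel)
       (rule measurable_compose[where f="\<lambda>y. lex_prefix g y (Suc n)" for n, OF _ measurable_count_space], measurable)
qed

section \<open>Analytic sets in a general topology\<close>

lemma space_borel_of: "space (borel_of T) = topspace T"
  and sets_borel_of: "sets (borel_of T) = sigma_sets (topspace T) {U. openin T U}"
  unfolding borel_of_def using openin_subset[of T]
  by (auto intro!: space_measure_of sets_measure_of)

lemma borel_of_euclidean: "sets (borel_of euclidean) = sets borel"
  by (simp add: sets_borel_of borel_def)

lemma measurable_borel_of:
  assumes "continuous_map T T' f"
  shows "f \<in> borel_of T \<rightarrow>\<^sub>M borel_of T'"
  unfolding borel_of_def[of T']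
proof (rule measurable_measure_of)
  show "f \<in> space (borel_of T) \<rightarrow> topspace T'"
    using assms by (auto simp: space_borel_of continuous_map_def)
  show "f -` U \<inter> space (borel_of T) \<in> sets (borel_of T)" if "U \<in> {U. openin T' U}" for U
  proof -
    have "openin T {x \<in> topspace T. f x \<in> U}"
      using assms that by (auto simp: continuous_map_def)
    also have "{x \<in> topspace T. f x \<in> U} = f -` U \<inter> space (borel_of T)" by (auto simp: space_borel_of)
    finally show ?thesis by (auto simp: sets_borel_of)
  qed
qed (use openin_subset in auto)

text \<open>The Polish domain is copied onto the range of an injection into the reals, with the
  topology pulled back along the inverse, because \<open>analytic_in\<close> asks for a topology on
  real numbers.\<close>

lemma analytic_inI:
  fixes D :: "'z::polish_space set"
  assumes D: "D \<in> sets borel" and f: "f \<in> restrict_space borel D \<rightarrow>\<^sub>M borel_of T"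
    and S: "f ` D = S"
  shows "analytic_in T S"
proof -
  have "real_retract (borel_on (UNIV :: 'z set))" by (rule real_retract_polish) auto
  then obtain e :: "'z \<Rightarrow> real" and d where de: "\<And>x. d (e x) = x"
    unfolding real_retract_def by (auto simp: space_restrict_space)
  define Z where "Z = pullback_topology (range e) d euclidean"
  have topZ: "topspace Z = range e" by (simp add: Z_def topspace_pullback_topology)
  have d: "continuous_map Z euclidean d"
    unfolding Z_def using continuous_map_pullback[OF continuous_map_id, of "range e" d euclidean] by simp
  have e: "continuous_map euclidean Z e"
    unfolding Z_def by (rule continuous_map_pullback') (auto simp: comp_def de)
  have "homeomorphic_maps Z euclidean d e"
    unfolding homeomorphic_maps_def using d e by (auto simp: topZ de)
  then have "Z homeomorphic_space (euclidean :: 'z topology)"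
    unfolding homeomorphic_space_def by blast
  then have Z: "completely_metrizable_space Z" "second_countable Z"
    using homeomorphic_completely_metrizable_space homeomorphic_space_second_countability
      completely_metrizable_space_euclidean second_countable_euclidean by blast+
  have [measurable]: "d \<in> borel_of Z \<rightarrow>\<^sub>M borel"
    using measurable_borel_of[OF d] measurable_cong_sets[OF refl borel_of_euclidean] by blast
  have eD: "e ` D = d -` D \<inter> space (borel_of Z)"
    by (auto simp: space_borel_of topZ de)
  have "e ` D \<in> sets (borel_of Z)" unfolding eD using D by (rule measurable_sets[rotated]) simp
  moreover have "(\<lambda>t. f (d t)) \<in> restrict_space (borel_of Z) (e ` D) \<rightarrow>\<^sub>M borel_of T"
    by (rule measurable_compose[OF _ f], rule measurable_restrict_space3) (auto simp: de)
  moreover have "(\<lambda>t. f (d t)) ` e ` D = S" using S by (simp add: image_image de)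
  moreover have "S \<subseteq> topspace T"
    using measurable_space[OF f] S by (auto simp: space_restrict_space space_borel_of)
  ultimately show ?thesis unfolding analytic_in_def using Z by blast
qed

text \<open>The parameter space is replaced by Baire space along a continuous surjection; the
  remaining map is Borel on a Borel set, so its image is analytic.\<close>

lemma analytic_in_subset_imp_analytic:
  fixes R S :: "'a::polish_space set"
  assumes "analytic_in (top_of_set S) R"
  shows "analytic R"
proof (cases "R = {}")
  case False
  with assms obtain Z :: "real topology" and D f where
    Z: "completely_metrizable_space Z" "second_countable Z" and D: "D \<in> sets (borel_of Z)" and
    f: "f \<in> restrict_space (borel_of Z) D \<rightarrow>\<^sub>M borel_of (top_of_set S)" and R: "f ` D = R"
    unfolding analytic_in_def by blast
  have DZ: "D \<subseteq> topspace Z" using sets.sets_into_space[OF D] by (simp add: space_borel_of)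
  with R False have "topspace Z \<noteq> {}" by auto
  with Z obtain u :: "(nat \<Rightarrow> nat) \<Rightarrow> real" and e where
    u: "continuous_map euclidean Z u" and ue: "\<And>x. x \<in> topspace Z \<Longrightarrow> u (e x) = x"
    by (elim completely_metrizable_baire_retract) auto
  have [measurable]: "u \<in> borel \<rightarrow>\<^sub>M borel_of Z"
    using measurable_borel_of[OF u] measurable_cong_sets[OF borel_of_euclidean refl] by blast
  have "continuous_map (top_of_set S) euclidean (\<lambda>x. x)" by (simp add: continuous_on_id)
  then have id: "(\<lambda>x. x) \<in> borel_of (top_of_set S) \<rightarrow>\<^sub>M borel"
    using measurable_borel_of measurable_cong_sets[OF refl borel_of_euclidean] by blast
  have "u -` D \<in> sets borel" using measurable_sets[OF _ D, of u borel] by simp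
  moreover have "(\<lambda>\<sigma>. f (u \<sigma>)) \<in> restrict_space borel (u -` D) \<rightarrow>\<^sub>M borel"
    by (rule measurable_compose[OF _ measurable_compose[OF f id]], rule measurable_restrict_space3) auto
  ultimately have "analytic ((\<lambda>\<sigma>. f (u \<sigma>)) ` (u -` D))" by (rule analytic_borel_image)
  also have "(\<lambda>\<sigma>. f (u \<sigma>)) ` (u -` D) = f ` D"
  proof (intro equalityI subsetI)
    fix y assume "y \<in> f ` D"
    then obtain x where x: "x \<in> D" "y = f x" by blast
    then have "u (e x) = x" using ue DZ by blast
    with x have "e x \<in> u -` D" "y = f (u (e x))" by auto
    then show "y \<in> (\<lambda>\<sigma>. f (u \<sigma>)) ` (u -` D)" by blast
  qed auto
  finally show ?thesis using R by simp
qed (simp add: analytic_def)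

section \<open>The Borel sets of the weak topology\<close>

lemma topspace_weak_topology: "topspace (weak_topology S) = prob_measures S"
proof -
  have "prob_measures S = {p \<in> prob_measures S. (\<integral>x. 0 \<partial>p) \<in> (UNIV :: real set)}" by simp
  then have "prob_measures S \<in> {{p \<in> prob_measures S. (\<integral>x. f x \<partial>p) \<in> U} | (f :: 'a \<Rightarrow> real) U.
        continuous_on S f \<and> bounded (f ` S) \<and> open U}"
    by (intro CollectI exI[of _ "\<lambda>_. 0"] exI[of _ UNIV]) (auto simp: bounded_iff)
  then show ?thesis
    unfolding weak_topology_def topology_generated_by_topspace by blast
qed

lemma openin_weak_topology:
  fixes f :: "'a::topological_space \<Rightarrow> real"
  assumes "continuous_on S f" "bounded (f ` S)" "open U"
  shows "openin (weak_topology S) {p \<in> prob_measures S. (\<integral>x. f x \<partial>p) \<in> U}"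
  unfolding weak_topology_def by (rule topology_generated_by_Basis) (use assms in blast)

lemma space_borel_of_weak: "space (borel_of (weak_topology S)) = space (prob_algebra (borel_on S))"
  by (simp add: space_borel_of topspace_weak_topology prob_measures_def)

lemma sets_borel_on: "sets (borel_on S) = sigma_sets S {U \<inter> S | U. open U}"
proof -
  have "sets (borel_on S) = {(\<lambda>x. x) -` A \<inter> S | A. A \<in> sigma_sets UNIV {U. open U}}"
    by (auto simp: sets_restrict_space borel_def)
  also have "\<dots> = sigma_sets S {(\<lambda>x. x) -` A \<inter> S | A. A \<in> {U. open U}}"
    by (rule sigma_sets_vimage_commute) auto
  finally show ?thesis by simp
qed

text \<open>For open U the continuous functions min 1 (k * distance to the complement of U) tend to
  the indicator of U. So the measure of U \<inter> S is a limit of weakly continuous functions of p,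
  and these sets generate.\<close>

lemma measurable_weak_to_prob_algebra:
  fixes S :: "'a::metric_space set"
  shows "(\<lambda>p. p) \<in> borel_of (weak_topology S) \<rightarrow>\<^sub>M prob_algebra (borel_on S)"
proof (rule measurable_prob_algebra_generated[where \<Omega>=S and G="{U \<inter> S | U. open U}"])
  show "sets (borel_on S) = sigma_sets S {U \<inter> S | U. open U}" by (rule sets_borel_on)
  show "Int_stable {U \<inter> S | U. open U}"
  proof (rule Int_stableI)
    fix a b assume "a \<in> {U \<inter> S | U. open U}" "b \<in> {U \<inter> S | U. open U}"
    then obtain U V where "open U" "open V" "a = U \<inter> S" "b = V \<inter> S" by blast
    then show "a \<inter> b \<in> {U \<inter> S | U. open U}" by (intro CollectI exI[of _ "U \<inter> V"]) auto
  qed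
  fix A assume "A \<in> {U \<inter> S | U. open U}"
  then obtain U where U: "open U" "A = U \<inter> S" by blast
  define f where "f k x = (if U = UNIV then 1 else min 1 (real k * infdist x (- U)))" for k :: nat and x
  have f: "continuous_on S (f k)" for k
    unfolding f_def by (cases "U = UNIV") (auto intro!: continuous_intros)
  have f01: "0 \<le> f k x" "f k x \<le> 1" for k x
    using mult_nonneg_nonneg[OF of_nat_0_le_iff infdist_nonneg] by (auto simp: f_def)
  have bdd: "bounded (f k ` S)" for k
    unfolding bounded_iff by (intro exI[of _ 1]) (simp add: abs_of_nonneg f01)
  have meas: "(\<lambda>p. \<integral>x. f k x \<partial>p) \<in> borel_measurable (borel_of (weak_topology S))" for k
  proof (rule borel_measurableI)
    fix V :: "real set" assume "open V"
    have "(\<lambda>p. \<integral>x. f k x \<partial>p) -` V \<inter> space (borel_of (weak_topology S)) =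
        {p \<in> prob_measures S. (\<integral>x. f k x \<partial>p) \<in> V}"
      by (auto simp: space_borel_of topspace_weak_topology)
    then show "(\<lambda>p. \<integral>x. f k x \<partial>p) -` V \<inter> space (borel_of (weak_topology S)) \<in> sets (borel_of (weak_topology S))"
      using openin_weak_topology[OF f bdd \<open>open V\<close>] by (auto simp: sets_borel_of)
  qed
  have lim: "(\<lambda>k. \<integral>x. f k x \<partial>p) \<longlonglongrightarrow> measure p A" if p: "p \<in> space (prob_algebra (borel_on S))" for p
  proof -
    interpret prob_space p using p by (rule prob_algebra_prob_space)
    have fp: "f k \<in> borel_measurable p" for k
      unfolding measurable_cong_sets[OF sets_prob_algebra_cong[OF p] refl]
      by (intro borel_measurable_continuous_on_restrict f)
    have A: "A \<in> sets p"
      unfolding sets_prob_algebra_cong[OF p] U(2) sets_borel_on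
      by (rule sigma_sets.Basic) (use U(1) in blast)
    have pt: "(\<lambda>k. f k x) \<longlonglongrightarrow> indicator A x" if "x \<in> space p" for x
    proof (cases "x \<in> U")
      case True
      have "\<forall>\<^sub>F k in sequentially. f k x = 1"
      proof (cases "U = UNIV")
        case False
        with True have "0 < infdist x (- U)"
          using U(1) by (subst infdist_pos_not_in_closed) auto
        then obtain n where "1 < real n * infdist x (- U)" using reals_Archimedean3 by blast
        moreover have "real n * infdist x (- U) \<le> real k * infdist x (- U)" if "n \<le> k" for k
          using that by (intro mult_right_mono infdist_nonneg) simp
        ultimately have "1 \<le> real k * infdist x (- U)" if "n \<le> k" for k
          using that by (meson less_imp_le less_le_trans)
        then have "f k x = 1" if "n \<le> k" for k
          using that False by (simp add: f_def)
        then show ?thesis by (auto simp: eventually_sequentially)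
      qed (simp add: f_def)
      then show ?thesis
        using that True U by (intro tendsto_eventually) (simp add: space_prob_algebra_cong[OF p] space_restrict_space)
    next
      case False
      then have "f k x = 0" for k by (auto simp: f_def)
      then show ?thesis using False U by simp
    qed
    have "(\<lambda>k. \<integral>x. f k x \<partial>p) \<longlonglongrightarrow> (\<integral>x. indicator A x \<partial>p)"
      by (rule integral_dominated_convergence[where w="\<lambda>_. 1"]) (use pt fp A f01 in auto)
    then show ?thesis using A by simp
  qed
  have "(\<lambda>p. measure p A) \<in> borel_measurable (borel_of (weak_topology S))"
  proof (rule borel_measurable_LIMSEQ_real)
    show "(\<lambda>k. \<integral>x. f k x \<partial>p) \<longlonglongrightarrow> measure p A" if "p \<in> space (borel_of (weak_topology S))" for p
      using that unfolding space_borel_of_weak by (rule lim)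
  qed (rule meas)
  moreover have "emeasure p A = ennreal (measure p A)" if "p \<in> space (borel_of (weak_topology S))" for p
    using that unfolding space_borel_of_weak
    by (intro finite_measure.emeasure_eq_measure prob_space.finite_measure prob_algebra_prob_space)
  ultimately show "(\<lambda>p. emeasure p A) \<in> borel_measurable (borel_of (weak_topology S))"
    by (subst measurable_cong[where g="\<lambda>p. ennreal (measure p A)"]) auto
qed (auto simp: space_borel_of_weak space_prob_algebra)

text \<open>Finite unions of a countable basis; by continuity from below they approximate every open
  set, with one family for all measures.\<close>

lemma countable_open_approx_family:
  obtains \<B> :: "'a::second_countable_topology set set" where
    "countable \<B>" "\<And>B. B \<in> \<B> \<Longrightarrow> open B"
    "\<And>p U S c. open U \<Longrightarrow> p \<in> space (prob_algebra (borel_on S)) \<Longrightarrow> c < measure p (U \<inter> S) \<Longrightarrow>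
      \<exists>B\<in>\<B>. B \<subseteq> U \<and> c < measure p (B \<inter> S)"
proof -
  obtain B0 :: "'a set set" where B0: "countable B0" "topological_basis B0"
    using ex_countable_basis by blast
  define \<B> where "\<B> = Union ` {F. finite F \<and> F \<subseteq> B0}"
  have "countable \<B>" unfolding \<B>_def by (intro countable_image countable_Collect_finite_subset B0)
  moreover have "open B" if "B \<in> \<B>" for B
    using that topological_basis_open[OF B0(2)] by (auto simp: \<B>_def)
  moreover have "\<exists>B\<in>\<B>. B \<subseteq> U \<and> c < measure p (B \<inter> S)"
    if U: "open U" and p: "p \<in> space (prob_algebra (borel_on S))" and c: "c < measure p (U \<inter> S)" for p U S c
  proof -
    interpret prob_space p using p by (rule prob_algebra_prob_space)
    obtain B' where B': "B' \<subseteq> B0" "\<Union>B' = U" using B0(2) U unfolding topological_basis_def by blast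
    show ?thesis
    proof (cases "B' = {}")
      case True
      then show ?thesis using B' c by (intro bexI[of _ "{}"]) (auto simp: \<B>_def intro!: image_eqI[of _ _ "{}"])
    next
      case False
      have cB': "countable B'" using B' B0 countable_subset by blast
      define V where "V n = (\<Union>i<n. from_nat_into B' i)" for n
      have in_B': "from_nat_into B' i \<in> B'" for i using False by (rule from_nat_into)
      have V\<B>: "V n \<in> \<B>" for n
        unfolding \<B>_def V_def
        by (intro image_eqI[of _ _ "from_nat_into B' ` {..<n}"]) (use in_B' B' in auto)
      have op: "open (V n)" for n
        unfolding V_def using in_B' B'(1) topological_basis_open[OF B0(2)] by blast
      have UN: "(\<Union>n. V n \<inter> S) = U \<inter> S"
      proof -
        have "(\<Union>i. from_nat_into B' i) = U" using range_from_nat_into[OF False cB'] B'(2) by simp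
        moreover have "(\<Union>n. V n) = (\<Union>i. from_nat_into B' i)" by (auto simp: V_def)
        ultimately show ?thesis by auto
      qed
      have inc: "incseq (\<lambda>n. V n \<inter> S)" unfolding incseq_def V_def by (intro allI impI Int_mono UN_mono) auto
      have "V n \<inter> S \<in> sets p" for n
        unfolding sets_prob_algebra_cong[OF p] sets_borel_on using op by blast
      then have "(\<lambda>n. measure p (V n \<inter> S)) \<longlonglongrightarrow> measure p (U \<inter> S)"
        unfolding UN[symmetric] using inc by (intro finite_Lim_measure_incseq) auto
      then have "\<forall>\<^sub>F n in sequentially. c < measure p (V n \<inter> S)" using c by (rule order_tendstoD)
      then obtain n where "c < measure p (V n \<inter> S)" by (auto simp: eventually_sequentially)
      moreover have "V n \<subseteq> U" using in_B' B'(2) unfolding V_def by blast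
      ultimately show ?thesis using V\<B> by blast
    qed
  qed
  ultimately show thesis by (rule that)
qed

text \<open>The number of levels k/N strictly below h is the ceiling of N * h minus one, cut off at
  0. Strict inequalities are used because they give open level sets for continuous h.\<close>

lemma level_count_bounds:
  assumes "0 \<le> h" "h \<le> (1::real)" "N > 0"
  defines "m \<equiv> (\<Sum>k\<in>{1..N}. of_bool (real k < N * h)) :: real"
  shows "m \<le> N * h" "N * h \<le> m + 1"
proof -
  define y where "y = N * h"
  have y: "0 \<le> y" "y \<le> N" using assms by (auto simp: y_def mult_left_le)
  have "m = real (card {k\<in>{1..N}. real k < y})"
    unfolding m_def y_def by (simp add: Int_def of_bool_def sum.If_cases)
  also have "{k\<in>{1..N}. real k < y} = {1..<nat \<lceil>y\<rceil>}"
    using y by (auto simp: zless_nat_eq_int_zless less_ceiling_iff) 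
  finally have m: "m = real (nat \<lceil>y\<rceil> - 1)" by simp
  show "m \<le> N * h" "N * h \<le> m + 1"
    unfolding y_def[symmetric] m using y by linarith+
qed

text \<open>N times the integral is, up to 1, the sum of the measures of N open level sets. Each of
  them is shrunk to a member of the countable family and its measure to a rational bound. The
  resulting conditions on p come from a countable supply, although h and c are arbitrary.\<close>

lemma weak_lower_semicontinuity:
  fixes h :: "'a::second_countable_topology \<Rightarrow> real"
  assumes h: "continuous_on S h" and h01: "\<And>x. x \<in> S \<Longrightarrow> 0 \<le> h x \<and> h x \<le> 1"
    and \<B>: "\<And>p U c. open U \<Longrightarrow> p \<in> space (prob_algebra (borel_on S)) \<Longrightarrow> c < measure p (U \<inter> S) \<Longrightarrow>
      \<exists>B\<in>\<B>. B \<subseteq> U \<and> c < measure p (B \<inter> S)" "\<And>B. B \<in> \<B> \<Longrightarrow> open B"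
    and p0: "p0 \<in> space (prob_algebra (borel_on S))" and c: "c < (\<integral>x. h x \<partial>p0)"
  shows "\<exists>N B (r :: nat \<Rightarrow> rat). (\<forall>k. B k \<in> \<B>) \<and> (\<forall>k. of_rat (r k) < measure p0 (B k \<inter> S)) \<and>
    (\<forall>p. p \<in> space (prob_algebra (borel_on S)) \<longrightarrow>
      (\<forall>k\<in>{1..N}. of_rat (r k) < measure p (B k \<inter> S)) \<longrightarrow> c < (\<integral>x. h x \<partial>p))"
proof -
  \<comment> \<open>N is so large that the rounding error 1/N is smaller than the gap between the
    integral and c.\<close>
  obtain N where N: "N > 0" "inverse (real N) < (\<integral>x. h x \<partial>p0) - c"
    using reals_Archimedean[of "(\<integral>x. h x \<partial>p0) - c"] c by (metis diff_gt_0_iff_gt zero_less_Suc)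
  have "\<exists>U. open U \<and> U \<inter> S = {x\<in>S. real k < N * h x}" for k
  proof -
    have "openin (top_of_set S) (S \<inter> (\<lambda>x. N * h x) -` {real k<..})"
      by (rule continuous_openin_preimage_gen) (auto intro!: continuous_intros h)
    then obtain U where "open U" "S \<inter> (\<lambda>x. N * h x) -` {real k<..} = S \<inter> U"
      by (auto simp: openin_open)
    then show ?thesis by (intro exI[of _ U]) auto
  qed
  then obtain U where U: "\<And>k. open (U k)" "\<And>k::nat. U k \<inter> S = {x\<in>S. real k < N * h x}" by metis
  have US: "U k \<inter> S \<in> sets (borel_on S)" for k unfolding sets_borel_on using U(1) by blast
  have bounds: "(\<Sum>k\<in>{1..N}. measure p (U k \<inter> S)) \<le> N * (\<integral>x. h x \<partial>p)"
    "N * (\<integral>x. h x \<partial>p) \<le> (\<Sum>k\<in>{1..N}. measure p (U k \<inter> S)) + 1"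
    if p: "p \<in> space (prob_algebra (borel_on S))" for p
  proof -
    interpret prob_space p using p by (rule prob_algebra_prob_space)
    have sp: "space p = S" using space_prob_algebra_cong[OF p] by (simp add: space_restrict_space)
    have Up: "U k \<inter> S \<in> sets p" for k using US sets_prob_algebra_cong[OF p] by simp
    have "h \<in> borel_measurable p"
      unfolding measurable_cong_sets[OF sets_prob_algebra_cong[OF p] refl]
      by (intro borel_measurable_continuous_on_restrict h)
    then have int: "integrable p h"
      by (rule integrable_const_bound[of _ 1, rotated]) (use h01 sp in auto)
    have intU: "integrable p (indicat_real (U k \<inter> S))" for k
      by (rule integrable_const_bound[of _ 1]) (use Up in auto)
    have eq: "(\<Sum>k\<in>{1..N}. indicat_real (U k \<inter> S) x) = (\<Sum>k\<in>{1..N}. of_bool (real k < N * h x))"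
      if "x \<in> S" for x
      using that U(2) by (intro sum.cong) (auto simp: indicator_def)
    have sum: "(\<Sum>k\<in>{1..N}. measure p (U k \<inter> S)) = (\<integral>x. (\<Sum>k\<in>{1..N}. indicat_real (U k \<inter> S) x) \<partial>p)"
      using intU Up by (subst Bochner_Integration.integral_sum) auto
    show "(\<Sum>k\<in>{1..N}. measure p (U k \<inter> S)) \<le> N * (\<integral>x. h x \<partial>p)"
      unfolding sum integral_mult_right_zero[symmetric]
      by (rule integral_mono) (use int intU level_count_bounds[OF _ _ N(1)] h01 eq sp in auto)
    have "N * (\<integral>x. h x \<partial>p) \<le> (\<integral>x. (\<Sum>k\<in>{1..N}. indicat_real (U k \<inter> S) x) + 1 \<partial>p)"
      unfolding integral_mult_right_zero[symmetric]
      by (rule integral_mono) (use int intU level_count_bounds[OF _ _ N(1)] h01 eq sp in auto)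
    also have "\<dots> = (\<integral>x. (\<Sum>k\<in>{1..N}. indicat_real (U k \<inter> S) x) \<partial>p) + 1"
      using intU by (subst Bochner_Integration.integral_add) (auto simp: prob_space)
    finally show "N * (\<integral>x. h x \<partial>p) \<le> (\<Sum>k\<in>{1..N}. measure p (U k \<inter> S)) + 1" unfolding sum .
  qed
  \<comment> \<open>The surplus of the level sum over N * c is divided evenly among the N
    levels.\<close>
  define \<delta> where "\<delta> = ((\<Sum>k\<in>{1..N}. measure p0 (U k \<inter> S)) - N * c) / N"
  have "N * inverse (real N) < N * ((\<integral>x. h x \<partial>p0) - c)" using N by (intro mult_strict_left_mono) auto
  then have "\<delta> > 0" using bounds(2)[OF p0] N unfolding \<delta>_def by (simp add: algebra_simps)
  have "\<exists>B\<in>\<B>. B \<subseteq> U k \<and> measure p0 (U k \<inter> S) - \<delta> < measure p0 (B \<inter> S)" for k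
    using \<B>(1)[OF U(1) p0] \<open>\<delta> > 0\<close> by simp
  then obtain B where B: "\<And>k. B k \<in> \<B>" "\<And>k. B k \<subseteq> U k"
    "\<And>k. measure p0 (U k \<inter> S) - \<delta> < measure p0 (B k \<inter> S)" by metis
  have "\<exists>r. measure p0 (U k \<inter> S) - \<delta> < of_rat r \<and> of_rat r < measure p0 (B k \<inter> S)" for k
    using of_rat_dense[OF B(3)] by blast
  then obtain r where r: "\<And>k. measure p0 (U k \<inter> S) - \<delta> < of_rat (r k)"
    "\<And>k. of_rat (r k) < measure p0 (B k \<inter> S)" by metis
  have "c < (\<integral>x. h x \<partial>p)" if p: "p \<in> space (prob_algebra (borel_on S))"
    and less: "\<forall>k\<in>{1..N}. of_rat (r k) < measure p (B k \<inter> S)" for p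
  proof -
    interpret prob_space p using p by (rule prob_algebra_prob_space)
    have "N * c = (\<Sum>k\<in>{1..N}. measure p0 (U k \<inter> S) - \<delta>)"
      using N by (simp add: sum_subtractf \<delta>_def)
    also have "\<dots> < (\<Sum>k\<in>{1..N}. measure p (B k \<inter> S))"
      using N less less_trans[OF r(1)] by (intro sum_strict_mono) auto
    also have "\<dots> \<le> (\<Sum>k\<in>{1..N}. measure p (U k \<inter> S))"
      using B(2) US sets_prob_algebra_cong[OF p] by (intro sum_mono finite_measure_mono) auto
    also have "\<dots> \<le> N * (\<integral>x. h x \<partial>p)" by (rule bounds(1)[OF p])
    finally show ?thesis using N by simp
  qed
  with B(1) r(2) show ?thesis by blast
qed

text \<open>An open set may be an uncountable union of basic sets. This is overcome by a topology T
  with a countable subbase of evaluation sets: it refines the weak topology, and its open sets are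
  countable unions of finite intersections of evaluation sets.\<close>

lemma openin_weak_in_prob_algebra:
  fixes S :: "'a::second_countable_topology set"
  assumes "openin (weak_topology S) W"
  shows "W \<in> sets (prob_algebra (borel_on S))"
proof -
  let ?P = "prob_algebra (borel_on S)"
  obtain \<B> :: "'a set set" where \<B>: "countable \<B>" "\<And>B. B \<in> \<B> \<Longrightarrow> open B"
    "\<And>p U S c. open U \<Longrightarrow> p \<in> space (prob_algebra (borel_on S)) \<Longrightarrow> c < measure p (U \<inter> S) \<Longrightarrow>
      \<exists>B\<in>\<B>. B \<subseteq> U \<and> c < measure p (B \<inter> S)"
    using countable_open_approx_family by blast
  define v where "v B r = {p\<in>space ?P. of_rat r < measure p (B \<inter> S)}" for B and r :: rat
  define \<V> where "\<V> = insert (space ?P) ((\<lambda>(B, r). v B r) ` (\<B> \<times> UNIV))"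
  have v_in: "v B r \<in> \<V>" if "B \<in> \<B>" for B r
    unfolding \<V>_def by (intro insertI2 image_eqI[of _ _ "(B, r)"]) (use that in auto)
  have "countable \<V>" unfolding \<V>_def using \<B>(1) by (intro countable_insert countable_image countable_SIGMA) auto
  have v_sets: "v B r \<in> sets ?P" if "B \<in> \<B>" for B r
  proof -
    have "B \<inter> S \<in> sets (borel_on S)" unfolding sets_borel_on using \<B>(2)[OF that] by blast
    then have [measurable]: "(\<lambda>p. measure p (B \<inter> S)) \<in> borel_measurable ?P"
      by (rule measurable_measure_prob_algebra)
    show ?thesis unfolding v_def by measurable
  qed
  have \<V>_sets: "V \<in> sets ?P" if "V \<in> \<V>" for V using that v_sets by (auto simp: \<V>_def)
  define T where "T = topology_generated_by \<V>"
  have T_open: "openin T V" if "V \<in> \<V>" for V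
    unfolding T_def by (rule topology_generated_by_Basis[OF that])
  have lsc: "\<exists>V. openin T V \<and> p0 \<in> V \<and> (\<forall>p\<in>V. p \<in> space ?P \<and> c < (\<integral>x. f x \<partial>p))"
    if f: "continuous_on S f" "bounded (f ` S)" and p0: "p0 \<in> space ?P" and c: "c < (\<integral>x. f x \<partial>p0)"
    for f :: "'a \<Rightarrow> real" and p0 c
  proof -
    obtain b0 where b0: "\<And>x. x \<in> S \<Longrightarrow> \<bar>f x\<bar> \<le> b0"
      using f(2) unfolding bounded_iff by (metis image_eqI real_norm_def)
    define b where "b = \<bar>b0\<bar> + 1"
    have b: "b > 0" "\<And>x. x \<in> S \<Longrightarrow> \<bar>f x\<bar> \<le> b" using b0 by (force simp: b_def)+
    define h where "h x = (f x + b) / (2 * b)" for x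
    have h: "continuous_on S h" unfolding h_def using b by (auto intro!: continuous_intros f)
    have h01: "x \<in> S \<Longrightarrow> 0 \<le> h x \<and> h x \<le> 1" for x
      using b(1) b(2)[of x] by (auto simp: h_def field_simps abs_le_iff)
    have int_h: "(\<integral>x. h x \<partial>p) = ((\<integral>x. f x \<partial>p) + b) / (2 * b)" if p: "p \<in> space ?P" for p
    proof -
      interpret prob_space p using p by (rule prob_algebra_prob_space)
      have "f \<in> borel_measurable p"
        unfolding measurable_cong_sets[OF sets_prob_algebra_cong[OF p] refl]
        by (intro borel_measurable_continuous_on_restrict f)
      moreover have "space p = S" using space_prob_algebra_cong[OF p] by (simp add: space_restrict_space)
      ultimately have "integrable p f"
        by (intro integrable_const_bound[of _ b]) (use b in auto)
      then show ?thesis unfolding h_def by (simp add: prob_space)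
    qed
    have iff: "(c + b) / (2 * b) < (\<integral>x. h x \<partial>p) \<longleftrightarrow> c < (\<integral>x. f x \<partial>p)" if "p \<in> space ?P" for p
      unfolding int_h[OF that] using b(1) by (simp add: divide_less_cancel)
    have c': "(c + b) / (2 * b) < (\<integral>x. h x \<partial>p0)" using iff[OF p0] c by simp
    have "\<exists>N B (r :: nat \<Rightarrow> rat). (\<forall>k. B k \<in> \<B>) \<and> (\<forall>k. of_rat (r k) < measure p0 (B k \<inter> S)) \<and>
      (\<forall>p. p \<in> space ?P \<longrightarrow>
        (\<forall>k\<in>{1..N}. of_rat (r k) < measure p (B k \<inter> S)) \<longrightarrow> (c + b) / (2 * b) < (\<integral>x. h x \<partial>p))"
    proof (rule weak_lower_semicontinuity[OF h _ _ _ p0 c'])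
      show "0 \<le> h x \<and> h x \<le> 1" if "x \<in> S" for x using that by (rule h01)
      show "\<exists>B\<in>\<B>. B \<subseteq> U \<and> c < measure p (B \<inter> S)"
        if "open U" "p \<in> space ?P" "c < measure p (U \<inter> S)" for p U c
        using that by (rule \<B>(3))
      show "open B" if "B \<in> \<B>" for B using that by (rule \<B>(2))
    qed
    then obtain N B and r :: "nat \<Rightarrow> rat" where NBr: "\<forall>k. B k \<in> \<B>"
      "\<forall>k. of_rat (r k) < measure p0 (B k \<inter> S)"
      "\<forall>p. p \<in> space ?P \<longrightarrow>
        (\<forall>k\<in>{1..N}. of_rat (r k) < measure p (B k \<inter> S)) \<longrightarrow> (c + b) / (2 * b) < (\<integral>x. h x \<partial>p)"
      by (elim exE conjE)
    define V where "V = space ?P \<inter> (\<Inter>k\<in>{1..N}. v (B k) (r k))"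
    have "openin T V"
    proof (cases "N = 0")
      case True
      then show ?thesis unfolding V_def by (simp add: T_open \<V>_def)
    next
      case False
      then have "openin T (\<Inter>k\<in>{1..N}. v (B k) (r k))"
        using NBr(1) by (intro openin_INT2 T_open v_in) auto
      then show ?thesis unfolding V_def by (intro openin_Int T_open[of "space ?P"]) (auto simp: \<V>_def)
    qed
    moreover have "p0 \<in> V" using p0 NBr(2) by (auto simp: V_def v_def)
    moreover have "p \<in> space ?P \<and> c < (\<integral>x. f x \<partial>p)" if "p \<in> V" for p
    proof -
      have p: "p \<in> space ?P" "\<forall>k\<in>{1..N}. of_rat (r k) < measure p (B k \<inter> S)"
        using that by (auto simp: V_def v_def)
      then have "(c + b) / (2 * b) < (\<integral>x. h x \<partial>p)" using NBr(3) by blast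
      with p(1) show ?thesis using iff by blast
    qed
    ultimately show ?thesis by blast
  qed
  have sub_open: "openin T {p \<in> prob_measures S. (\<integral>x. f x \<partial>p) \<in> U}"
    if f: "continuous_on S f" "bounded (f ` S)" "open U" for f :: "'a \<Rightarrow> real" and U
  proof (subst openin_subopen, intro ballI)
    fix p0 assume "p0 \<in> {p \<in> prob_measures S. (\<integral>x. f x \<partial>p) \<in> U}"
    then have p0: "p0 \<in> space ?P" "(\<integral>x. f x \<partial>p0) \<in> U" by (auto simp: prob_measures_def)
    then obtain \<epsilon> where \<epsilon>: "\<epsilon> > 0" "ball (\<integral>x. f x \<partial>p0) \<epsilon> \<subseteq> U" using f(3) openE by blast
    obtain V where V: "openin T V" "p0 \<in> V" "\<forall>p\<in>V. p \<in> space ?P \<and> (\<integral>x. f x \<partial>p0) - \<epsilon> < (\<integral>x. f x \<partial>p)"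
      using lsc[OF f(1,2) p0(1), of "(\<integral>x. f x \<partial>p0) - \<epsilon>"] \<epsilon> by auto
    \<comment> \<open>Only lower bounds are open so far; a lower bound for -f is an upper bound for
      f.\<close>
    have "continuous_on S (\<lambda>x. - f x)" "bounded ((\<lambda>x. - f x) ` S)"
      using f by (auto intro!: continuous_intros simp: bounded_iff)
    then obtain V' where V': "openin T V'" "p0 \<in> V'"
      "\<forall>p\<in>V'. p \<in> space ?P \<and> (\<integral>x. - f x \<partial>p0) - \<epsilon> < (\<integral>x. - f x \<partial>p)"
      using lsc[of "\<lambda>x. - f x" p0 "(\<integral>x. - f x \<partial>p0) - \<epsilon>"] \<epsilon> p0 by auto
    have "V \<inter> V' \<subseteq> {p \<in> prob_measures S. (\<integral>x. f x \<partial>p) \<in> U}"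
    proof
      fix p assume "p \<in> V \<inter> V'"
      then have "p \<in> space ?P" "\<bar>(\<integral>x. f x \<partial>p0) - (\<integral>x. f x \<partial>p)\<bar> < \<epsilon>" using V(3) V'(3) by (fastforce simp: abs_less_iff)+
      then have "(\<integral>x. f x \<partial>p) \<in> ball (\<integral>x. f x \<partial>p0) \<epsilon>" by (simp add: dist_real_def)
      with \<epsilon>(2) \<open>p \<in> space ?P\<close> show "p \<in> {p \<in> prob_measures S. (\<integral>x. f x \<partial>p) \<in> U}"
        by (auto simp: prob_measures_def)
    qed
    then show "\<exists>V. openin T V \<and> p0 \<in> V \<and> V \<subseteq> {p \<in> prob_measures S. (\<integral>x. f x \<partial>p) \<in> U}"
      using V V' by (intro exI[of _ "V \<inter> V'"]) auto
  qed
  have "generate_topology_on {{p \<in> prob_measures S. (\<integral>x. f x \<partial>p) \<in> U} | (f :: 'a \<Rightarrow> real) U.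
        continuous_on S f \<and> bounded (f ` S) \<and> open U} W"
    using assms unfolding weak_topology_def by (rule openin_topology_generated_by)
  then have "openin T W"
  proof (induction rule: generate_topology_on.induct)
    case (Basis s)
    then show ?case using sub_open by blast
  qed auto
  then have "generate_topology_on \<V> W" unfolding T_def by (rule openin_topology_generated_by)
  \<comment> \<open>The empty family is excluded since its intersection is the whole type; the whole
    space of measures is a member of \<V> instead.\<close>
  define \<F> where "\<F> = Inter ` {\<G>. finite \<G> \<and> \<G> \<subseteq> \<V> \<and> \<G> \<noteq> {}}"
  have \<F>_Int: "x \<inter> y \<in> \<F>" if x: "x \<in> \<F>" and y: "y \<in> \<F>" for x y
  proof -
    from x obtain \<G> where G: "finite \<G>" "\<G> \<subseteq> \<V>" "\<G> \<noteq> {}" "x = \<Inter>\<G>" unfolding \<F>_def by blast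
    from y obtain \<H> where H: "finite \<H>" "\<H> \<subseteq> \<V>" "\<H> \<noteq> {}" "y = \<Inter>\<H>" unfolding \<F>_def by blast
    have "x \<inter> y = \<Inter>(\<G> \<union> \<H>)" using G(4) H(4) by (simp add: Inter_Un_distrib)
    then show ?thesis unfolding \<F>_def by (rule image_eqI) (use G H in simp)
  qed
  have \<V>\<F>: "s \<in> \<F>" if "s \<in> \<V>" for s
    unfolding \<F>_def by (rule image_eqI[of _ _ "{s}"]) (use that in simp_all)
  from \<open>generate_topology_on \<V> W\<close> have "\<exists>C. C \<subseteq> \<F> \<and> W = \<Union>C"
  proof (induction rule: generate_topology_on.induct)
    case Empty
    then show ?case by (intro exI[of _ "{}"]) simp
  next
    case (Int a b)
    then obtain C D where CD: "C \<subseteq> \<F>" "a = \<Union>C" "D \<subseteq> \<F>" "b = \<Union>D" by blast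
    have "(\<lambda>(x, y). x \<inter> y) ` (C \<times> D) \<subseteq> \<F>" using CD(1,3) \<F>_Int by auto
    moreover have "a \<inter> b = \<Union>((\<lambda>(x, y). x \<inter> y) ` (C \<times> D))" unfolding CD(2,4) by auto
    ultimately show ?case by blast
  next
    case (UN K)
    then obtain C where C: "\<And>k. k \<in> K \<Longrightarrow> C k \<subseteq> \<F> \<and> k = \<Union>(C k)" by metis
    have "(\<Union>k\<in>K. C k) \<subseteq> \<F>" using C by blast
    moreover have "\<Union>K = \<Union>(\<Union>k\<in>K. C k)"
    proof -
      have "\<Union>K = (\<Union>k\<in>K. k)" by simp
      also have "\<dots> = (\<Union>k\<in>K. \<Union>(C k))" by (rule SUP_cong[OF refl]) (rule conjunct2[OF C])
      finally show ?thesis by auto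
    qed
    ultimately show ?case by blast
  next
    case (Basis s)
    then have "{s} \<subseteq> \<F>" using \<V>\<F> by simp
    then show ?case by (intro exI[of _ "{s}"]) simp
  qed
  then obtain C where C: "C \<subseteq> \<F>" "W = \<Union>C" by blast
  have "\<F> \<subseteq> Inter ` {\<G>. finite \<G> \<and> \<G> \<subseteq> \<V>}" unfolding \<F>_def by (rule image_mono) blast
  then have "countable \<F>"
    using countable_Collect_finite_subset[OF \<open>countable \<V>\<close>]
    by (meson countable_image countable_subset)
  then have "countable C" using C(1) countable_subset by blast
  moreover have "c \<in> sets ?P" if "c \<in> C" for c
  proof -
    from that C(1) have "c \<in> \<F>" by (rule subsetD[rotated])
    then obtain \<G> where G: "finite \<G>" "\<G> \<subseteq> \<V>" "\<G> \<noteq> {}" "c = \<Inter>\<G>" unfolding \<F>_def by blast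
    then have "\<G> \<subseteq> sets ?P" using \<V>_sets by blast
    with G show ?thesis using sets.finite_INT[of \<G> "\<lambda>x. x" ?P] by auto
  qed
  ultimately show ?thesis unfolding C(2) by (intro sets.countable_Union) auto
qed

text \<open>From here on the weak topology is replaced by the \<sigma>-algebra generated by
  evaluations, where measurability of maps into spaces of measures is a matter of kernels.\<close>

theorem sets_borel_of_weak_topology:
  fixes S :: "'a::{metric_space, second_countable_topology} set"
  shows "sets (borel_of (weak_topology S)) = sets (prob_algebra (borel_on S))"
proof
  show "sets (borel_of (weak_topology S)) \<subseteq> sets (prob_algebra (borel_on S))"
    unfolding sets_borel_of space_borel_of[symmetric] space_borel_of_weak
    by (rule sets.sigma_sets_subset) (auto intro: openin_weak_in_prob_algebra)
  show "sets (prob_algebra (borel_on S)) \<subseteq> sets (borel_of (weak_topology S))"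
  proof
    fix A assume A: "A \<in> sets (prob_algebra (borel_on S))"
    then have "(\<lambda>p. p) -` A \<inter> space (borel_of (weak_topology S)) \<in> sets (borel_of (weak_topology S))"
      by (rule measurable_sets[OF measurable_weak_to_prob_algebra])
    then show "A \<in> sets (borel_of (weak_topology S))"
      using sets.sets_into_space[OF A] by (simp add: space_borel_of_weak Int_absorb2)
  qed
qed

section \<open>Universally measurable maps\<close>

lemma space_universal [simp]: "space (universal M) = space M"
  unfolding universal_def by (rule space_measure_of) auto

lemma sets_universal:
  "sets (universal M) = {B. B \<subseteq> space M \<and> (\<forall>p\<in>space (prob_algebra M). B \<in> sets (completion p))}"
    (is "_ = ?U")
proof -
  have "sets (universal M) = sigma_sets (space M) ?U"
    unfolding universal_def by (rule sets_measure_of) auto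
  also have "\<dots> = ?U"
  proof (rule sigma_algebra.sigma_sets_eq, unfold sigma_algebra_iff2, intro conjI)
    show "\<forall>s\<in>?U. space M - s \<in> ?U"
    proof (intro ballI CollectI conjI)
      fix s p assume s: "s \<in> ?U" and p: "p \<in> space (prob_algebra M)"
      then have "space (completion p) - s \<in> sets (completion p)" by (intro sets.compl_sets) auto
      then show "space M - s \<in> sets (completion p)" by (simp add: space_prob_algebra_cong[OF p])
    qed auto
    show "\<forall>A. range A \<subseteq> ?U \<longrightarrow> (\<Union>i::nat. A i) \<in> ?U" by (auto intro!: sets.countable_UN)
  qed auto
  finally show ?thesis .
qed

lemma sets_universal_completion:
  "B \<in> sets (universal M) \<Longrightarrow> p \<in> space (prob_algebra M) \<Longrightarrow> B \<in> sets (completion p)"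
  by (simp add: sets_universal)

lemma sets_universalI_borel: "B \<in> sets M \<Longrightarrow> B \<in> sets (universal M)"
  using sets.sets_into_space[of B M] by (auto simp: sets_universal space_prob_algebra)

lemma measurable_universal_completion:
  assumes f: "f \<in> universal M \<rightarrow>\<^sub>M N" and p: "p \<in> space (prob_algebra M)"
  shows "f \<in> completion p \<rightarrow>\<^sub>M N"
proof (rule measurableI)
  fix x assume "x \<in> space (completion p)"
  then show "f x \<in> space N" using measurable_space[OF f] by (simp add: space_prob_algebra_cong[OF p])
next
  fix B assume "B \<in> sets N"
  then have "f -` B \<inter> space M \<in> sets (universal M)" using measurable_sets[OF f] by simp
  from sets_universal_completion[OF this p]
  show "f -` B \<inter> space (completion p) \<in> sets (completion p)"
    by (simp add: space_prob_algebra_cong[OF p])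
qed

lemma measurable_universalI:
  assumes "f \<in> space M \<rightarrow> space N"
    and "\<And>p. p \<in> space (prob_algebra M) \<Longrightarrow> f \<in> completion p \<rightarrow>\<^sub>M N"
  shows "f \<in> universal M \<rightarrow>\<^sub>M N"
proof (rule measurableI)
  fix B assume B: "B \<in> sets N"
  have "f -` B \<inter> space M \<in> sets (completion p)" if p: "p \<in> space (prob_algebra M)" for p
    using measurable_sets[OF assms(2)[OF p] B] by (simp add: space_prob_algebra_cong[OF p])
  then show "f -` B \<inter> space (universal M) \<in> sets (universal M)" by (simp add: sets_universal)
qed (use assms(1) in auto)

lemma measurable_universal_borel: "f \<in> M \<rightarrow>\<^sub>M N \<Longrightarrow> f \<in> universal M \<rightarrow>\<^sub>M N"
  by (rule measurable_mono[OF order_refl refl _ , THEN subsetD, of M]) (auto intro: sets_universalI_borel)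

lemma completion_vimage:
  assumes f: "f \<in> M \<rightarrow>\<^sub>M N" and p: "p \<in> space (prob_algebra M)"
    and B: "B \<in> sets (completion (distr p N f))"
  shows "f -` B \<inter> space M \<in> sets (completion p)"
proof -
  have fp: "f \<in> p \<rightarrow>\<^sub>M N" using f measurable_cong_sets[OF sets_prob_algebra_cong[OF p] refl] by blast
  have sp: "space p = space M" by (rule space_prob_algebra_cong[OF p])
  obtain S K K' where S: "B = S \<union> K" "K \<subseteq> K'" "K' \<in> null_sets (distr p N f)" "S \<in> sets N"
    using B by (elim sets_completionE) auto
  show ?thesis
  proof (rule sets_completionI)
    show "f -` B \<inter> space M = (f -` S \<inter> space M) \<union> (f -` K \<inter> space M)" using S by auto
    show "f -` K \<inter> space M \<subseteq> f -` K' \<inter> space M" using S by auto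
    show "f -` K' \<inter> space M \<in> null_sets p"
      using S(3) fp sp by (auto simp: null_sets_distr_iff)
    show "f -` S \<inter> space M \<in> sets p" using measurable_sets[OF fp S(4)] sp by simp
  qed
qed

text \<open>A measure sees a preimage under f through its image measure, for which the set is
  measurable in the completion by universality.\<close>

lemma measurable_universal_compose:
  assumes f: "f \<in> M \<rightarrow>\<^sub>M N" and g: "g \<in> universal N \<rightarrow>\<^sub>M L"
  shows "(\<lambda>x. g (f x)) \<in> universal M \<rightarrow>\<^sub>M L"
proof (rule measurable_compose[OF _ g], rule measurableI)
  fix B assume B: "B \<in> sets (universal N)"
  have "f -` B \<inter> space M \<in> sets (completion p)" if p: "p \<in> space (prob_algebra M)" for p
    by (rule completion_vimage[OF f p sets_universal_completion[OF B distr_in_prob_algebra[OF p f]]])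
  then show "f -` B \<inter> space (universal M) \<in> sets (universal M)" by (simp add: sets_universal)
qed (use measurable_space[OF f] in simp)

text \<open>Each function x \<mapsto> f x (G r) has a measurable version. On a common null set the
  whole kernel is replaced by its value at a fixed point x0, since replacing the values separately
  could destroy being a probability measure.\<close>

lemma universal_kernel_borel_version:
  assumes N: "real_retract N" and f: "f \<in> universal M \<rightarrow>\<^sub>M prob_algebra N" and p: "p \<in> space (prob_algebra M)"
  obtains f' where "f' \<in> M \<rightarrow>\<^sub>M prob_algebra N" "AE x in p. f x = f' x"
proof -
  obtain G where G: "borel_chain N G" using real_retract_obtain_chain[OF N] .
  have fp: "f \<in> completion p \<rightarrow>\<^sub>M prob_algebra N" by (rule measurable_universal_completion[OF f p])
  have "\<exists>g\<in>borel_measurable p. AE x in p. measure (f x) (G r) = g x" for r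
    by (rule completion_ex_borel_measurable_real)
       (rule measurable_compose[OF fp measurable_measure_prob_algebra[OF borel_chain_sets[OF G]]])
  then obtain g where g: "\<And>r. g r \<in> borel_measurable p" "\<And>r. AE x in p. measure (f x) (G r) = g r x" by metis
  have "AE x in p. \<forall>r. measure (f x) (G r) = g r x" using g(2) by (simp add: AE_all_countable)
  then obtain K where K: "K \<in> null_sets p" "\<And>x. x \<in> space p \<Longrightarrow> x \<notin> K \<Longrightarrow> \<forall>r. measure (f x) (G r) = g r x"
    unfolding eventually_ae_filter by blast
  obtain x0 where x0: "x0 \<in> space M"
    using prob_space.not_empty[OF prob_algebra_prob_space[OF p]] space_prob_algebra_cong[OF p] by auto
  define f' where "f' x = (if x \<in> K then f x0 else f x)" for x
  have f_in: "f x \<in> space (prob_algebra N)" if "x \<in> space M" for x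
    using measurable_space[OF f, of x] that by simp
  have f'_in: "f' x \<in> space (prob_algebra N)" if "x \<in> space M" for x
    using f_in x0 that by (simp add: f'_def)
  have "f' \<in> p \<rightarrow>\<^sub>M prob_algebra N"
  proof (rule measurable_prob_algebra_generated[where \<Omega>="space N" and G="range G"])
    show "sets N = sigma_sets (space N) (range G)" using G by (simp add: borel_chain_def)
    show "Int_stable (range G)" by (rule borel_chain_Int_stable[OF G])
    show "range G \<subseteq> Pow (space N)" using borel_chain_sets[OF G] sets.sets_into_space by blast
    fix A assume "A \<in> range G"
    then obtain r where A: "A = G r" by blast
    have [measurable]: "K \<in> sets p" "g r \<in> borel_measurable p" using K(1) g(1) by auto
    have "emeasure (f' x) A = (if x \<in> K then emeasure (f x0) (G r) else ennreal (g r x))" if "x \<in> space p" for x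
    proof (cases "x \<in> K")
      case False
      interpret prob_space "f x"
        using f_in that by (intro prob_algebra_prob_space[of _ N]) (simp add: space_prob_algebra_cong[OF p])
      show ?thesis using False K(2)[OF that False] A by (simp add: f'_def emeasure_eq_measure)
    qed (simp add: f'_def A)
    then have "(\<lambda>x. emeasure (f' x) A) \<in> borel_measurable p \<longleftrightarrow>
        (\<lambda>x. if x \<in> K then emeasure (f x0) (G r) else ennreal (g r x)) \<in> borel_measurable p"
      by (rule measurable_cong)
    then show "(\<lambda>x. emeasure (f' x) A) \<in> borel_measurable p" by simp
  qed (use f'_in in \<open>auto simp: space_prob_algebra_cong[OF p] space_prob_algebra\<close>)
  then have "f' \<in> M \<rightarrow>\<^sub>M prob_algebra N"
    using measurable_cong_sets[OF sets_prob_algebra_cong[OF p] refl] by blast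
  moreover have "AE x in p. f x = f' x"
    using AE_not_in[OF K(1)] by eventually_elim (simp add: f'_def)
  ultimately show thesis by (rule that)
qed

text \<open>The rules for almost-everywhere statements under image measures and kernels ask for
  measurable predicates. Passing to E on the way in and to L on the way out makes them available for
  an analytic R.\<close>

lemma analytic_AE_borel_bounds:
  fixes R :: "'a::metric_space set"
  assumes R: "analytic R" and S: "S \<in> sets borel" and p: "p \<in> space (prob_algebra (borel_on S))"
  obtains L E where "L \<in> sets (borel_on S)" "E \<in> sets (borel_on S)" "L \<subseteq> R" "R \<inter> S \<subseteq> E"
    "AE x in p. x \<in> E \<longrightarrow> x \<in> L"
proof -
  have id: "(\<lambda>x. x) \<in> borel_on S \<rightarrow>\<^sub>M borel" by (intro measurable_restrict_space1) simp
  define p' where "p' = distr p borel (\<lambda>x. x)"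
  have "p' \<in> space (prob_algebra borel)" unfolding p'_def by (rule distr_in_prob_algebra[OF p id])
  then have "R \<in> sets (completion p')"
    by (intro analytic_universally_measurable[OF R])
       (auto simp: space_prob_algebra prob_space.finite_measure)
  then have "R \<inter> S \<in> sets (completion p)"
    using completion_vimage[OF id p] by (simp add: p'_def space_restrict_space)
  then obtain L K K' where L: "R \<inter> S = L \<union> K" "K \<subseteq> K'" "K' \<in> null_sets p" "L \<in> sets p"
    by (elim sets_completionE)
  have "L \<union> K' \<in> sets (borel_on S)" "L \<in> sets (borel_on S)"
    using L sets_prob_algebra_cong[OF p] by auto
  moreover have "AE x in p. x \<in> L \<union> K' \<longrightarrow> x \<in> L"
    using AE_not_in[OF L(3)] by eventually_elim auto
  ultimately show thesis using L by (intro that[of L "L \<union> K'"]) auto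
qed

lemma lex_select_universal:
  fixes g :: "(nat \<Rightarrow> nat) \<Rightarrow> 'a::metric_space"
  assumes g: "continuous_on UNIV g" and S: "S \<in> sets borel"
  shows "lex_select g \<in> universal (borel_on S) \<rightarrow>\<^sub>M borel"
proof (rule measurable_universalI)
  fix p assume p: "p \<in> space (prob_algebra (borel_on S))"
  have id: "(\<lambda>x. x) \<in> borel_on S \<rightarrow>\<^sub>M borel" by (intro measurable_restrict_space1) simp
  have p': "distr p borel (\<lambda>x. x) \<in> space (prob_algebra borel)" by (rule distr_in_prob_algebra[OF p id])
  have meas: "lex_select g \<in> completion (distr p borel (\<lambda>x. x)) \<rightarrow>\<^sub>M borel"
    by (rule measurable_lex_select[OF g]) (use p' in \<open>auto simp: space_prob_algebra prob_space.finite_measure\<close>)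
  show "lex_select g \<in> completion p \<rightarrow>\<^sub>M borel"
  proof (rule measurableI)
    fix B :: "(nat \<Rightarrow> nat) set" assume "B \<in> sets borel"
    then have "lex_select g -` B \<in> sets (completion (distr p borel (\<lambda>x. x)))"
      using measurable_sets[OF meas] by simp
    from completion_vimage[OF id p this]
    show "lex_select g -` B \<inter> space (completion p) \<in> sets (completion p)"
      by (simp add: space_prob_algebra_cong[OF p])
  qed simp
qed simp

section \<open>Measures concentrated on an analytic set\<close>

text \<open>By measurable selection, a probability measure concentrated on the range of \<open>g\<close> is an image
  measure under \<open>g\<close>, and the probability measures on the domain are the image measures of
  distribution functions.\<close>

lemma analytic_in_concentrated:
  fixes S R :: "'a::polish_space set"
  assumes S: "S \<in> sets borel" and R: "analytic R" "R \<subseteq> S"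
    and C: "C \<in> sets (prob_algebra (borel_on S))"
  shows "analytic_in (weak_topology S) {p\<in>C. AE x in p. x \<in> R}"
proof (cases "R = {}")
  case True
  have "\<not> (AE x in p. x \<in> R)" if "p \<in> C" for p
  proof -
    interpret prob_space p
      using that sets.sets_into_space[OF C] by (intro prob_algebra_prob_space[of _ "borel_on S"]) auto
    show ?thesis using True AE_False by simp
  qed
  then have empty: "{p\<in>C. AE x in p. x \<in> R} = {}" by blast
  show ?thesis unfolding empty analytic_in_def by simp
next
  case False
  then obtain g :: "(nat \<Rightarrow> nat) \<Rightarrow> 'a" where g: "continuous_on UNIV g" "range g = R"
    using R unfolding analytic_def by blast
  have gS [measurable]: "g \<in> borel \<rightarrow>\<^sub>M borel_on S"
    by (rule measurable_restrict_space2) (use g R in \<open>auto intro: borel_measurable_continuous_onI\<close>)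
  obtain e d where e [measurable]: "e \<in> borel \<rightarrow>\<^sub>M (borel :: real measure)" and d [measurable]: "d \<in> borel \<rightarrow>\<^sub>M borel"
    and de: "\<And>\<sigma> :: nat \<Rightarrow> nat. d (e \<sigma>) = \<sigma>"
    using real_retract_baire unfolding real_retract_def by auto
  define \<Phi> where "\<Phi> F = distr (cdf_kernel F) (borel_on S) (\<lambda>t. g (d t))" for F
  have gd: "(\<lambda>t. g (d t)) \<in> borel \<rightarrow>\<^sub>M borel_on S" by (rule measurable_compose[OF d gS])
  have \<Phi>: "\<Phi> \<in> borel \<rightarrow>\<^sub>M prob_algebra (borel_on S)"
    unfolding \<Phi>_def by (rule measurable_compose[OF measurable_cdf_kernel measurable_distr_prob_space[OF gd]])
  define D where "D = \<Phi> -` C"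
  have "\<Phi> -` C \<inter> space borel \<in> sets borel" by (rule measurable_sets[OF \<Phi> C])
  then have D: "D \<in> sets borel" by (simp add: D_def)
  have "\<Phi> \<in> restrict_space borel D \<rightarrow>\<^sub>M borel_of (weak_topology S)"
    unfolding measurable_cong_sets[OF refl sets_borel_of_weak_topology]
    by (intro measurable_restrict_space1 \<Phi>)
  moreover have "\<Phi> ` D = {p\<in>C. AE x in p. x \<in> R}"
  proof (intro equalityI subsetI)
    fix p assume "p \<in> \<Phi> ` D"
    then obtain F where F: "p = \<Phi> F" "\<Phi> F \<in> C" by (auto simp: D_def)
    have k: "cdf_kernel F \<in> space (prob_algebra borel)" using measurable_space[OF measurable_cdf_kernel, of F] by simp
    have p: "p \<in> space (prob_algebra (borel_on S))" using measurable_space[OF \<Phi>, of F] F by simp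
    obtain L E where LE: "L \<in> sets (borel_on S)" "E \<in> sets (borel_on S)" "L \<subseteq> R" "R \<inter> S \<subseteq> E"
      "AE x in p. x \<in> E \<longrightarrow> x \<in> L"
      using analytic_AE_borel_bounds[OF R(1) S p] .
    have gdF: "(\<lambda>t. g (d t)) \<in> cdf_kernel F \<rightarrow>\<^sub>M borel_on S"
      unfolding measurable_cong_sets[OF sets_prob_algebra_cong[OF k] refl] by (rule gd)
    have "AE t in cdf_kernel F. g (d t) \<in> E"
      using g LE(4) R(2) by (intro AE_I2) auto
    then have "AE x in p. x \<in> E"
      unfolding F(1) \<Phi>_def using LE(2) gdF
      by (subst AE_distr_iff) (auto simp: Collect_conj_eq[symmetric] Int_def[symmetric])
    with LE(5) have "AE x in p. x \<in> R" by eventually_elim (use LE(3) in auto)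
    moreover have "p \<in> C" using F by simp
    ultimately show "p \<in> {p\<in>C. AE x in p. x \<in> R}" by blast
  next
    fix p assume "p \<in> {p\<in>C. AE x in p. x \<in> R}"
    then have pC: "p \<in> C" and ae: "AE x in p. x \<in> R" by auto
    then have p: "p \<in> space (prob_algebra (borel_on S))" using sets.sets_into_space[OF C] by blast
    interpret prob_space p using p by (rule prob_algebra_prob_space)
    have s: "lex_select g \<in> completion p \<rightarrow>\<^sub>M borel"
      by (rule measurable_universal_completion[OF lex_select_universal[OF g(1) S] p])
    \<comment> \<open>The law of the selected parameter, coded as a real number. The completion of p
      is needed because the selector is only universally measurable.\<close>
    define m where "m = distr (completion p) borel (\<lambda>x. e (lex_select g x))"
    have es: "(\<lambda>x. e (lex_select g x)) \<in> completion p \<rightarrow>\<^sub>M borel" by (rule measurable_compose[OF s e])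
    interpret cp: prob_space "completion p"
      by (rule prob_spaceI) (simp add: emeasure_space_1)
    have m: "m \<in> space (prob_algebra borel)"
      unfolding m_def space_prob_algebra using cp.prob_space_distr[OF es] by simp
    define F where "F r = measure m (rat_atMost r)" for r
    have "\<Phi> F = distr m (borel_on S) (\<lambda>t. g (d t))"
      unfolding \<Phi>_def F_def cdf_kernel_measure[OF m] ..
    also have "\<dots> = distr (completion p) (borel_on S) (\<lambda>x. g (d (e (lex_select g x))))"
      unfolding m_def by (subst distr_distr[OF gd es]) (simp add: comp_def)
    also have "\<dots> = p"
    proof (rule measure_eqI)
      show "sets (distr (completion p) (borel_on S) (\<lambda>x. g (d (e (lex_select g x))))) = sets p"
        using sets_prob_algebra_cong[OF p] by simp
      fix B assume "B \<in> sets (distr (completion p) (borel_on S) (\<lambda>x. g (d (e (lex_select g x)))))"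
      then have B: "B \<in> sets (borel_on S)" "B \<in> sets p" using sets_prob_algebra_cong[OF p] by auto
      have f: "(\<lambda>x. g (d (e (lex_select g x)))) \<in> completion p \<rightarrow>\<^sub>M borel_on S"
        using measurable_compose[OF es gd] by simp
      have "emeasure (distr (completion p) (borel_on S) (\<lambda>x. g (d (e (lex_select g x))))) B =
          emeasure (completion p) ((\<lambda>x. g (d (e (lex_select g x)))) -` B \<inter> space (completion p))"
        by (rule emeasure_distr[OF f B(1)])
      also have "\<dots> = emeasure (completion p) B"
      proof (rule emeasure_eq_AE)
        show "AE x in completion p. (x \<in> (\<lambda>x. g (d (e (lex_select g x)))) -` B \<inter> space (completion p)) = (x \<in> B)"
          using AE_completion[OF ae] AE_space
        proof eventually_elim
          case (elim x)
          then have "g (lex_select g x) = x" using lex_select_section[OF g(1), of x] g(2) by simp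
          then show ?case using elim by (simp add: de)
        qed
      qed (use measurable_sets[OF f B(1)] B in auto)
      also have "\<dots> = emeasure p B" using B by simp
      finally show "emeasure (distr (completion p) (borel_on S) (\<lambda>x. g (d (e (lex_select g x))))) B = emeasure p B" .
    qed
    finally have "\<Phi> F = p" .
    with pC show "p \<in> \<Phi> ` D" by (intro image_eqI[of _ _ F]) (auto simp: D_def)
  qed
  ultimately show ?thesis by (rule analytic_inI[OF D])
qed

section \<open>Laws of histories\<close>

lemma measurable_borel_onI:
  "f \<in> M \<rightarrow>\<^sub>M borel \<Longrightarrow> (\<And>x. x \<in> space M \<Longrightarrow> f x \<in> S) \<Longrightarrow> f \<in> M \<rightarrow>\<^sub>M borel_on S"
  by (rule measurable_restrict_space2) auto

lemma measurable_borel_on_id [measurable]: "(\<lambda>x. x) \<in> borel_on S \<rightarrow>\<^sub>M borel"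
  by (intro measurable_restrict_space1) simp

lemma space_borel_on [simp]: "space (borel_on S) = S"
  by (simp add: space_restrict_space)

lemma measurable_fst_borel [measurable]:
  "fst \<in> (borel :: ('a::second_countable_topology \<times> 'b::second_countable_topology) measure) \<rightarrow>\<^sub>M borel"
  unfolding borel_prod[symmetric] by simp

lemma measurable_snd_borel [measurable]:
  "snd \<in> (borel :: ('a::second_countable_topology \<times> 'b::second_countable_topology) measure) \<rightarrow>\<^sub>M borel"
  unfolding borel_prod[symmetric] by simp

lemma measurable_Pair_borel:
  fixes f :: "'c \<Rightarrow> 'a::second_countable_topology" and g :: "'c \<Rightarrow> 'b::second_countable_topology"
  shows "f \<in> M \<rightarrow>\<^sub>M borel \<Longrightarrow> g \<in> M \<rightarrow>\<^sub>M borel \<Longrightarrow> (\<lambda>x. (f x, g x)) \<in> M \<rightarrow>\<^sub>M borel"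
  unfolding borel_prod[symmetric] by (rule measurable_Pair)

lemma measurable_coordinate_borel:
  fixes f :: "'c \<Rightarrow> nat \<Rightarrow> 'b::second_countable_topology"
  shows "f \<in> M \<rightarrow>\<^sub>M borel \<Longrightarrow> (\<lambda>x. f x i) \<in> M \<rightarrow>\<^sub>M borel"
  by (rule measurable_compose[OF _ measurable_product_coordinates])

lemma measurable_coordinatewise_borel:
  fixes f :: "'c \<Rightarrow> nat \<Rightarrow> 'b::second_countable_topology"
  shows "(\<And>i. (\<lambda>x. f x i) \<in> M \<rightarrow>\<^sub>M borel) \<Longrightarrow> f \<in> M \<rightarrow>\<^sub>M borel"
  by (rule measurable_coordinatewise_then_product)

text \<open>\<open>X_nonempty\<close> supplies the base points for retractions and selectors; an
  empty state space is dealt with in the final theorem.\<close>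

locale mdp =
  fixes X :: "'x::polish_space set" and A :: "'a::polish_space set"
    and q :: "'x \<times> 'a \<Rightarrow> 'x measure" and Adm :: "'x \<Rightarrow> 'a set"
  assumes X: "X \<in> sets borel" and A: "A \<in> sets borel"
    and q: "q \<in> borel_on (X \<times> A) \<rightarrow>\<^sub>M prob_algebra (borel_on X)"
    and Adm: "\<And>x. x \<in> X \<Longrightarrow> Adm x \<noteq> {} \<and> Adm x \<subseteq> A"
    and graph: "analytic_in (top_of_set (X \<times> A)) {(x, a). x \<in> X \<and> a \<in> Adm x}"
    and X_nonempty: "X \<noteq> {}"
begin

abbreviation "MX \<equiv> borel_on X"
abbreviation "MA \<equiv> borel_on A"
abbreviation "MH n \<equiv> borel_on (histories X A n)"
abbreviation "MT \<equiv> borel_on (trajectories X A)"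

lemma A_nonempty: "A \<noteq> {}"
  using X_nonempty Adm by blast

lemma XA_borel: "X \<times> A \<in> sets borel"
  unfolding borel_prod[symmetric] using X A by simp

lemma histories_iff:
  "h \<in> histories X A n \<longleftrightarrow> (\<forall>i. (i < n \<longrightarrow> fst h i \<in> X \<times> A) \<and> (\<not> i < n \<longrightarrow> fst h i = undefined)) \<and> snd h \<in> X"
  by (cases h) (auto simp: histories_def PiE_iff extensional_def)

lemma histories_borel: "histories X A n \<in> sets borel"
proof -
  have coord [measurable]: "(\<lambda>h :: ('x, 'a) history. fst h i) \<in> borel \<rightarrow>\<^sub>M borel" for i
    by (rule measurable_coordinate_borel) simp
  have [measurable]: "X \<times> A \<in> sets borel" "X \<in> sets borel" "{undefined :: 'x \<times> 'a} \<in> sets borel"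
    using XA_borel X by auto
  have "{h \<in> space (borel :: ('x, 'a) history measure).
      (\<forall>i. (i < n \<longrightarrow> fst h i \<in> X \<times> A) \<and> (\<not> i < n \<longrightarrow> fst h i \<in> {undefined})) \<and> snd h \<in> X} \<in> sets borel"
    by measurable
  also have "{h \<in> space (borel :: ('x, 'a) history measure).
      (\<forall>i. (i < n \<longrightarrow> fst h i \<in> X \<times> A) \<and> (\<not> i < n \<longrightarrow> fst h i \<in> {undefined})) \<and> snd h \<in> X} = histories X A n"
    by (auto simp: histories_iff)
  finally show ?thesis .
qed

lemma trajectories_borel: "trajectories X A \<in> sets borel"
proof -
  have [measurable]: "(\<lambda>\<omega> :: nat \<Rightarrow> 'x \<times> 'a. \<omega> i) \<in> borel \<rightarrow>\<^sub>M borel" for i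
    by (rule measurable_product_coordinates)
  have [measurable]: "X \<times> A \<in> sets borel" by (rule XA_borel)
  have "{\<omega> \<in> space (borel :: (nat \<Rightarrow> 'x \<times> 'a) measure). \<forall>i. \<omega> i \<in> X \<times> A} \<in> sets borel" by measurable
  then show ?thesis by (simp add: trajectories_def)
qed

lemma real_retract_A: "real_retract MA"
  by (rule real_retract_polish[OF A A_nonempty])

lemma histories_nonempty: "histories X A n \<noteq> {}"
proof -
  obtain x a where "x \<in> X" "a \<in> A" using X_nonempty A_nonempty by blast
  then have "(restrict (\<lambda>_. (x, a)) {..<n}, x) \<in> histories X A n" by (simp add: histories_iff)
  then show ?thesis by blast
qed

lemma real_retract_H: "real_retract (MH n)"
  by (rule real_retract_polish[OF histories_borel histories_nonempty])

lemma measurable_hist_fst [measurable]: "fst \<in> MH n \<rightarrow>\<^sub>M borel"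
  and measurable_hist_snd [measurable]: "snd \<in> MH n \<rightarrow>\<^sub>M borel"
  by (intro measurable_restrict_space1; simp)+

lemma measurable_hist_state [measurable]: "snd \<in> MH n \<rightarrow>\<^sub>M MX"
  by (rule measurable_borel_onI) (auto simp: histories_iff)

lemma measurable_traj_coord [measurable]: "(\<lambda>\<omega>. \<omega> i) \<in> MT \<rightarrow>\<^sub>M borel"
  by (intro measurable_restrict_space1) (rule measurable_product_coordinates)

lemma measurable_traj_XA: "(\<lambda>\<omega>. \<omega> i) \<in> MT \<rightarrow>\<^sub>M borel_on (X \<times> A)"
  by (rule measurable_borel_onI[OF measurable_traj_coord]) (auto simp: trajectories_def)

lemma measurable_history_of [measurable]: "history_of n \<in> MT \<rightarrow>\<^sub>M MH n"
proof (rule measurable_borel_onI)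
  have "(\<lambda>\<omega>. restrict \<omega> {..<n} :: nat \<Rightarrow> 'x \<times> 'a) \<in> MT \<rightarrow>\<^sub>M borel"
  proof (rule measurable_coordinatewise_borel)
    show "(\<lambda>\<omega>. restrict \<omega> {..<n} i) \<in> MT \<rightarrow>\<^sub>M borel" for i
      by (cases "i < n") simp_all
  qed
  then show "history_of n \<in> MT \<rightarrow>\<^sub>M borel"
    unfolding history_of_def by (rule measurable_Pair_borel) simp
  show "history_of n \<omega> \<in> histories X A n" if "\<omega> \<in> space MT" for \<omega>
    using that by (auto simp: histories_iff history_of_def trajectories_def mem_Times_iff)
qed

lemma measurable_traj_action [measurable]: "(\<lambda>\<omega>. snd (\<omega> n)) \<in> MT \<rightarrow>\<^sub>M MA"
  by (rule measurable_borel_onI[OF measurable_compose[OF measurable_traj_coord measurable_snd_borel]])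
     (auto simp: trajectories_def mem_Times_iff)

lemma measurable_hist_action [measurable]: "(\<lambda>(h, a). (snd h, a)) \<in> MH n \<Otimes>\<^sub>M MA \<rightarrow>\<^sub>M borel_on (X \<times> A)"
proof (rule measurable_borel_onI)
  show "(\<lambda>(h, a). (snd h, a)) \<in> MH n \<Otimes>\<^sub>M MA \<rightarrow>\<^sub>M borel"
    unfolding split_beta by (rule measurable_Pair_borel) measurable
qed (auto simp: space_pair_measure histories_iff)

lemma measurable_hist_extend:
  "(\<lambda>((h, a), y). ((fst h)(n := (snd h, a)), y)) \<in> (MH n \<Otimes>\<^sub>M MA) \<Otimes>\<^sub>M MX \<rightarrow>\<^sub>M MH (Suc n)"
proof (rule measurable_borel_onI)
  let ?M = "(MH n \<Otimes>\<^sub>M MA) \<Otimes>\<^sub>M MX"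
  have 1: "(\<lambda>z. fst (fst (fst z))) \<in> ?M \<rightarrow>\<^sub>M borel" by measurable
  have 2: "(\<lambda>z. (snd (fst (fst z)), snd (fst z))) \<in> ?M \<rightarrow>\<^sub>M borel"
    by (rule measurable_Pair_borel) measurable
  have "(\<lambda>z. (fst (fst (fst z)))(n := (snd (fst (fst z)), snd (fst z)))) \<in> ?M \<rightarrow>\<^sub>M borel"
  proof (rule measurable_coordinatewise_borel)
    show "(\<lambda>z. ((fst (fst (fst z)))(n := (snd (fst (fst z)), snd (fst z)))) i) \<in> ?M \<rightarrow>\<^sub>M borel" for i
      using 2 measurable_coordinate_borel[OF 1] by (cases "i = n") simp_all
  qed
  then show "(\<lambda>((h, a), y). ((fst h)(n := (snd h, a)), y)) \<in> ?M \<rightarrow>\<^sub>M borel"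
    unfolding split_beta by (rule measurable_Pair_borel) measurable
qed (auto simp: space_pair_measure histories_iff less_Suc_eq)

definition law :: "nat \<Rightarrow> (nat \<Rightarrow> 'x \<times> 'a) measure \<Rightarrow> ('x, 'a) history measure" where
  "law n p = distr p (MH n) (history_of n)"

definition action_law :: "nat \<Rightarrow> (nat \<Rightarrow> 'x \<times> 'a) measure \<Rightarrow> (('x, 'a) history \<times> 'a) measure" where
  "action_law n p = distr p (MH n \<Otimes>\<^sub>M MA) (\<lambda>\<omega>. (history_of n \<omega>, snd (\<omega> n)))"

definition trans :: "nat \<Rightarrow> ('x, 'a) history \<times> 'a \<Rightarrow> ('x, 'a) history measure" where
  "trans n z = distr (q (snd (fst z), snd z)) (MH (Suc n)) (\<lambda>y. ((fst (fst z))(n := (snd (fst z), snd z)), y))"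

definition step :: "nat \<Rightarrow> (('x, 'a) history \<Rightarrow> 'a measure) \<Rightarrow> ('x, 'a) history measure \<Rightarrow> ('x, 'a) history measure" where
  "step n k m = kernel_prod (MH n) MA m k \<bind> trans n"

text \<open>One-step consistency of the laws of successive histories. The initial law is left free
  because strategic measures range over all initial distributions.\<close>

definition generated :: "(nat \<Rightarrow> 'x \<times> 'a) measure \<Rightarrow> (nat \<Rightarrow> ('x, 'a) history \<Rightarrow> 'a measure) \<Rightarrow> bool" where
  "generated p k \<longleftrightarrow> (\<forall>n. law (Suc n) p = step n (k n) (law n p))"

lemma measurable_law: "law n \<in> prob_algebra MT \<rightarrow>\<^sub>M prob_algebra (MH n)"
  unfolding law_def by (rule measurable_distr_prob_space) simp

lemma law_in: "p \<in> space (prob_algebra MT) \<Longrightarrow> law n p \<in> space (prob_algebra (MH n))"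
  by (rule measurable_space[OF measurable_law])

lemma measurable_history_action [measurable]:
  "(\<lambda>\<omega>. (history_of n \<omega>, snd (\<omega> n))) \<in> MT \<rightarrow>\<^sub>M MH n \<Otimes>\<^sub>M MA"
  by measurable

lemma measurable_action_law: "action_law n \<in> prob_algebra MT \<rightarrow>\<^sub>M prob_algebra (MH n \<Otimes>\<^sub>M MA)"
  unfolding action_law_def by (rule measurable_distr_prob_space) simp

lemma action_law_in: "p \<in> space (prob_algebra MT) \<Longrightarrow> action_law n p \<in> space (prob_algebra (MH n \<Otimes>\<^sub>M MA))"
  by (rule measurable_space[OF measurable_action_law])

lemma measurable_trans_q: "(\<lambda>z. q (snd (fst z), snd z)) \<in> MH n \<Otimes>\<^sub>M MA \<rightarrow>\<^sub>M prob_algebra MX"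
  using measurable_compose[OF measurable_hist_action q] by (simp add: split_beta)

lemma measurable_trans: "trans n \<in> MH n \<Otimes>\<^sub>M MA \<rightarrow>\<^sub>M prob_algebra (MH (Suc n))"
  unfolding trans_def
  by (rule measurable_distr_prob_space2[OF measurable_trans_q])
     (use measurable_hist_extend[of n] in \<open>simp add: split_beta'\<close>)

lemma step_in:
  "m \<in> space (prob_algebra (MH n)) \<Longrightarrow> k \<in> MH n \<rightarrow>\<^sub>M prob_algebra MA \<Longrightarrow> step n k m \<in> space (prob_algebra (MH (Suc n)))"
  unfolding step_def by (rule bind_in_prob_algebra[OF kernel_prod_in_prob_algebra measurable_trans])

text \<open>Undoes the extension of a history: it forgets the last state and splits the last pair,
  leaving h_n and a_n.\<close>

definition hist_cut :: "nat \<Rightarrow> ('x, 'a) history \<Rightarrow> ('x, 'a) history \<times> 'a" where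
  "hist_cut n h = ((restrict (fst h) {..<n}, fst (fst h n)), snd (fst h n))"

lemma measurable_hist_cut: "hist_cut n \<in> MH (Suc n) \<rightarrow>\<^sub>M MH n \<Otimes>\<^sub>M MA"
  unfolding hist_cut_def
proof (rule measurable_Pair)
  have c: "(\<lambda>h. fst h i) \<in> MH (Suc n) \<rightarrow>\<^sub>M borel" for i
    by (rule measurable_coordinate_borel) simp
  show "(\<lambda>h. (restrict (fst h) {..<n}, fst (fst h n))) \<in> MH (Suc n) \<rightarrow>\<^sub>M MH n"
  proof (rule measurable_borel_onI)
    have "(\<lambda>h. restrict (fst h) {..<n}) \<in> MH (Suc n) \<rightarrow>\<^sub>M borel"
    proof (rule measurable_coordinatewise_borel)
      show "(\<lambda>h. restrict (fst h) {..<n} i) \<in> MH (Suc n) \<rightarrow>\<^sub>M borel" for i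
        using c[of i] by (cases "i < n") simp_all
    qed
    then show "(\<lambda>h. (restrict (fst h) {..<n}, fst (fst h n))) \<in> MH (Suc n) \<rightarrow>\<^sub>M borel"
      by (rule measurable_Pair_borel) (rule measurable_compose[OF c measurable_fst_borel])
  qed (auto simp: histories_iff less_Suc_eq mem_Times_iff)
  show "(\<lambda>h. snd (fst h n)) \<in> MH (Suc n) \<rightarrow>\<^sub>M MA"
    by (rule measurable_borel_onI[OF measurable_compose[OF c measurable_snd_borel]])
       (auto simp: histories_iff mem_Times_iff)
qed

lemma hist_cut_history_of: "hist_cut n (history_of (Suc n) \<omega>) = (history_of n \<omega>, snd (\<omega> n))"
  by (auto simp: hist_cut_def history_of_def restrict_def fun_eq_iff)

lemma hist_cut_extend:
  "h \<in> histories X A n \<Longrightarrow> hist_cut n ((fst h)(n := (snd h, a)), y) = (h, a)"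
  by (cases h) (auto simp: hist_cut_def histories_iff restrict_def fun_eq_iff)

lemma action_law_eq: "p \<in> space (prob_algebra MT) \<Longrightarrow>
    action_law n p = distr (law (Suc n) p) (MH n \<Otimes>\<^sub>M MA) (hist_cut n)"
  unfolding law_def action_law_def
  by (simp add: distr_distr_prob_algebra[OF _ measurable_history_of measurable_hist_cut] hist_cut_history_of)

lemma distr_fst_action_law: "p \<in> space (prob_algebra MT) \<Longrightarrow> distr (action_law n p) (MH n) fst = law n p"
  unfolding action_law_def law_def
  by (subst distr_distr_prob_algebra[OF _ measurable_history_action]) auto

text \<open>The transition adds a state and keeps the past, so the law of history and action can be
  read off from the next law. Hence a generating kernel disintegrates
  \<open>action_law\<close>.\<close>

lemma distr_hist_cut_step:
  assumes m: "m \<in> space (prob_algebra (MH n))" and k: "k \<in> MH n \<rightarrow>\<^sub>M prob_algebra MA"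
  shows "distr (step n k m) (MH n \<Otimes>\<^sub>M MA) (hist_cut n) = kernel_prod (MH n) MA m k"
proof -
  note kp = kernel_prod_in_prob_algebra[OF m k]
  have "distr (step n k m) (MH n \<Otimes>\<^sub>M MA) (hist_cut n) =
      kernel_prod (MH n) MA m k \<bind> (\<lambda>z. distr (trans n z) (MH n \<Otimes>\<^sub>M MA) (hist_cut n))"
    unfolding step_def by (rule distr_bind_prob_algebra[OF kp measurable_trans measurable_hist_cut])
  also have "\<dots> = kernel_prod (MH n) MA m k \<bind> return (MH n \<Otimes>\<^sub>M MA)"
  proof (rule bind_cong_prob_algebra[OF kp])
    fix z assume z: "z \<in> space (MH n \<Otimes>\<^sub>M MA)"
    then obtain h a where ha: "z = (h, a)" "h \<in> histories X A n" "a \<in> A" by (auto simp: space_pair_measure)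
    have qz: "q (snd h, a) \<in> space (prob_algebra MX)"
      using measurable_space[OF measurable_trans_q z] ha by simp
    then interpret prob_space "q (snd h, a)" by (rule prob_algebra_prob_space)
    have e: "(\<lambda>y. ((fst h)(n := (snd h, a)), y)) \<in> MX \<rightarrow>\<^sub>M MH (Suc n)"
      using measurable_compose[OF measurable_Pair1'[OF z] measurable_hist_extend[of n]] ha
      by (simp add: split_beta)
    have "distr (trans n z) (MH n \<Otimes>\<^sub>M MA) (hist_cut n) =
        distr (q (snd h, a)) (MH n \<Otimes>\<^sub>M MA) (\<lambda>y. (h, a))"
      unfolding trans_def ha fst_conv snd_conv
      by (subst distr_distr_prob_algebra[OF qz e measurable_hist_cut]) (simp add: hist_cut_extend[OF ha(2)])
    also have "\<dots> = return (MH n \<Otimes>\<^sub>M MA) z"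
      using z ha by (simp add: distr_const)
    finally show "distr (trans n z) (MH n \<Otimes>\<^sub>M MA) (hist_cut n) = return (MH n \<Otimes>\<^sub>M MA) z" .
  qed
  also have "\<dots> = kernel_prod (MH n) MA m k"
    using bind_return'[of "kernel_prod (MH n) MA m k"] return_sets_cong[OF sets_prob_algebra_cong[OF kp]] by simp
  finally show ?thesis .
qed

lemma generated_action_law:
  assumes p: "p \<in> space (prob_algebra MT)" and k: "k n \<in> MH n \<rightarrow>\<^sub>M prob_algebra MA" and "generated p k"
  shows "action_law n p = kernel_prod (MH n) MA (law n p) (k n)"
  using assms(3) distr_hist_cut_step[OF law_in[OF p] k] action_law_eq[OF p, of n]
  by (simp add: generated_def)

lemma law_Suc_eq_trans:
  assumes p: "p \<in> space (prob_algebra MT)" and k: "\<And>n. k n \<in> MH n \<rightarrow>\<^sub>M prob_algebra MA" and "generated p k"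
  shows "law (Suc n) p = action_law n p \<bind> trans n"
  using generated_action_law[OF p k assms(3)] assms(3) by (simp add: generated_def step_def)

lemma generatedI:
  assumes "\<And>n. law (Suc n) p = action_law n p \<bind> trans n"
    and "\<And>n. action_law n p = kernel_prod (MH n) MA (law n p) (k n)"
  shows "generated p k"
  using assms by (simp add: generated_def step_def)

text \<open>Cylinders over histories generate the Borel sets. They are closed under intersection
  because two of them can be lifted to the common length n + n' along
  \<open>hist_cut\<close>.\<close>

lemma trajectory_measure_eqI:
  assumes p: "p \<in> space (prob_algebra MT)" and p': "p' \<in> space (prob_algebra MT)"
    and eq: "\<And>n. law n p = law n p'"
  shows "p = p'"
proof -
  let ?\<Omega> = "trajectories X A"
  define E where "E = {history_of n -` D \<inter> ?\<Omega> | n D. D \<in> sets (MH n)}"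
  have up: "\<exists>D'. D' \<in> sets (MH (n + j)) \<and> history_of n -` D \<inter> ?\<Omega> = history_of (n + j) -` D' \<inter> ?\<Omega>"
    if "D \<in> sets (MH n)" for n j D
  proof (induction j)
    case (Suc j)
    then obtain D' where D': "D' \<in> sets (MH (n + j))" "history_of n -` D \<inter> ?\<Omega> = history_of (n + j) -` D' \<inter> ?\<Omega>"
      by blast
    define D'' where "D'' = (\<lambda>h. fst (hist_cut (n + j) h)) -` D' \<inter> space (MH (Suc (n + j)))"
    have "D'' \<in> sets (MH (Suc (n + j)))"
      unfolding D''_def
      by (rule measurable_sets[OF measurable_compose[OF measurable_hist_cut measurable_fst] D'(1)])
    moreover have "history_of (n + j) -` D' \<inter> ?\<Omega> = history_of (Suc (n + j)) -` D'' \<inter> ?\<Omega>"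
    proof (rule set_eqI)
      fix \<omega>
      have "\<omega> \<in> ?\<Omega> \<Longrightarrow> history_of (Suc (n + j)) \<omega> \<in> space (MH (Suc (n + j)))"
        using measurable_space[OF measurable_history_of[of "Suc (n + j)"], of \<omega>] by simp
      then show "\<omega> \<in> history_of (n + j) -` D' \<inter> ?\<Omega> \<longleftrightarrow> \<omega> \<in> history_of (Suc (n + j)) -` D'' \<inter> ?\<Omega>"
        unfolding D''_def vimage_eq Int_iff hist_cut_history_of fst_conv by blast
    qed
    ultimately show ?case using D'(2) by (intro exI[of _ D'']) simp
  qed (use that in auto)
  have "Int_stable E"
  proof (rule Int_stableI)
    fix a b assume "a \<in> E" "b \<in> E"
    then obtain n D n' D' where ab: "D \<in> sets (MH n)" "a = history_of n -` D \<inter> ?\<Omega>"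
      "D' \<in> sets (MH n')" "b = history_of n' -` D' \<inter> ?\<Omega>" unfolding E_def by blast
    obtain C where C: "C \<in> sets (MH (n + n'))" "a = history_of (n + n') -` C \<inter> ?\<Omega>"
      using up[OF ab(1), of n'] ab(2) by auto
    obtain C' where C': "C' \<in> sets (MH (n + n'))" "b = history_of (n + n') -` C' \<inter> ?\<Omega>"
      using up[OF ab(3), of n] ab(4) by (auto simp: add.commute)
    have "a \<inter> b = history_of (n + n') -` (C \<inter> C') \<inter> ?\<Omega>" using C C' by auto
    then show "a \<inter> b \<in> E" unfolding E_def using C C' by (blast intro: sets.Int)
  qed
  have EP: "E \<subseteq> Pow ?\<Omega>" unfolding E_def by blast
  define N where "N = sigma ?\<Omega> E"
  have N: "space N = ?\<Omega>" "sets N = sigma_sets ?\<Omega> E"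
    unfolding N_def using EP by (auto intro!: space_measure_of sets_measure_of)
  have hN: "history_of n \<in> N \<rightarrow>\<^sub>M MH n" for n
  proof (rule measurableI)
    fix D assume "D \<in> sets (MH n)"
    then have "history_of n -` D \<inter> ?\<Omega> \<in> E" unfolding E_def by blast
    then show "history_of n -` D \<inter> space N \<in> sets N" unfolding N by blast
  qed (use measurable_space[OF measurable_history_of] in \<open>simp add: N\<close>)
  have "(\<lambda>\<omega>. \<omega>) \<in> N \<rightarrow>\<^sub>M borel"
  proof (rule measurable_coordinatewise_borel)
    fix i
    have "(\<lambda>\<omega>. fst (history_of (Suc i) \<omega>) i) \<in> N \<rightarrow>\<^sub>M borel"
      by (rule measurable_coordinate_borel) (rule measurable_compose[OF hN measurable_hist_fst])
    then show "(\<lambda>\<omega>. \<omega> i) \<in> N \<rightarrow>\<^sub>M borel" by (simp add: history_of_def)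
  qed
  then have id: "(\<lambda>\<omega>. \<omega>) \<in> N \<rightarrow>\<^sub>M MT" by (rule measurable_borel_onI) (simp add: N)
  have "sets MT = sigma_sets ?\<Omega> E"
  proof
    show "sets MT \<subseteq> sigma_sets ?\<Omega> E"
    proof
      fix B assume B: "B \<in> sets MT"
      then have "(\<lambda>\<omega>. \<omega>) -` B \<inter> space N \<in> sets N" by (rule measurable_sets[OF id])
      then show "B \<in> sigma_sets ?\<Omega> E"
        using sets.sets_into_space[OF B] by (simp add: N Int_absorb2)
    qed
    show "sigma_sets ?\<Omega> E \<subseteq> sets MT"
      using sets.sigma_sets_subset[of E MT] measurable_sets[OF measurable_history_of]
      unfolding E_def by fastforce
  qed
  moreover have "emeasure p B = emeasure p' B" if B: "B \<in> E" for B
  proof -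
    obtain n D where D: "D \<in> sets (MH n)" "B = history_of n -` D \<inter> ?\<Omega>" using B unfolding E_def by blast
    have law_B: "emeasure (law n r) D = emeasure r B" if r: "r \<in> space (prob_algebra MT)" for r
    proof -
      have h: "history_of n \<in> r \<rightarrow>\<^sub>M MH n"
        unfolding measurable_cong_sets[OF sets_prob_algebra_cong[OF r] refl] by (rule measurable_history_of)
      show ?thesis
        unfolding law_def D(2) emeasure_distr[OF h D(1)] by (simp add: space_prob_algebra_cong[OF r])
    qed
    show ?thesis unfolding law_B[OF p, symmetric] law_B[OF p', symmetric] eq ..
  qed
  moreover have "?\<Omega> \<in> E"
  proof -
    have "?\<Omega> = history_of 0 -` space (MH 0) \<inter> ?\<Omega>"
      using measurable_space[OF measurable_history_of[of 0]] by auto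
    then show ?thesis unfolding E_def by blast
  qed
  moreover have "emeasure p ?\<Omega> \<noteq> \<infinity>"
    using prob_algebra_prob_space[OF p] by (simp add: prob_space.finite_measure finite_measure.emeasure_finite)
  ultimately show ?thesis
    using sets_prob_algebra_cong[OF p] sets_prob_algebra_cong[OF p'] \<open>Int_stable E\<close> EP
    by (intro measure_eqI_generator_eq[where E=E and \<Omega>="?\<Omega>" and A="\<lambda>_. ?\<Omega>"]) simp_all
qed

section \<open>Strategic measures and iterated integrals\<close>

definition initial :: "'x measure \<Rightarrow> ('x, 'a) history measure" where
  "initial p0 = distr p0 (MH 0) (\<lambda>x. (\<lambda>_. undefined, x))"

lemma measurable_initial_history: "(\<lambda>x. (\<lambda>_. undefined, x)) \<in> MX \<rightarrow>\<^sub>M MH 0"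
proof (rule measurable_borel_onI)
  show "(\<lambda>x. (\<lambda>_. undefined, x)) \<in> MX \<rightarrow>\<^sub>M (borel :: ('x, 'a) history measure)"
    by (rule measurable_Pair_borel) simp_all
qed (simp add: histories_iff)

text \<open>The inner integrals of a universally measurable policy are not Borel functions of the
  history, so the induction is over integrands f that agree almost surely with a Borel f'. The step
  works since a set that is null for the law of h_{n+1} is null for \<open>trans n z\<close> for
  almost every z.\<close>

lemma iter_integral_eq_law:
  assumes p0: "p0 \<in> space (prob_algebra MX)" and p: "p \<in> space (prob_algebra MT)"
    and init: "law 0 p = initial p0" and gen: "generated p k"
    and k: "\<And>n. k n \<in> MH n \<rightarrow>\<^sub>M prob_algebra MA"
    and ae: "\<And>n. AE h in law n p. \<mu> n h = k n h"
  shows "f' \<in> borel_measurable (MH n) \<Longrightarrow> (AE h in law n p. f h = f' h) \<Longrightarrow>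
    iter_integral q p0 \<mu> n f = (\<integral>\<^sup>+h. f' h \<partial>law n p)"
proof (induction n arbitrary: f f')
  case 0
  have i: "(\<lambda>x. (\<lambda>_. undefined, x)) \<in> p0 \<rightarrow>\<^sub>M MH 0"
    unfolding measurable_cong_sets[OF sets_prob_algebra_cong[OF p0] refl] by (rule measurable_initial_history)
  have "AE x in p0. f (\<lambda>_. undefined, x) = f' (\<lambda>_. undefined, x)"
    using 0(2) unfolding init initial_def by (rule AE_distrD[OF i])
  then have "iter_integral q p0 \<mu> 0 f = (\<integral>\<^sup>+x. f' (\<lambda>_. undefined, x) \<partial>p0)"
    by (simp add: nn_integral_completion nn_integral_cong_AE)
  also have "\<dots> = (\<integral>\<^sup>+h. f' h \<partial>law 0 p)"
    unfolding init initial_def using i 0(1) by (simp add: nn_integral_distr)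
  finally show ?case .
next
  case (Suc n)
  have L: "law n p \<in> space (prob_algebra (MH n))" by (rule law_in[OF p])
  note kp = kernel_prod_in_prob_algebra[OF L k]
  define I where "I z = (\<integral>\<^sup>+h. f' h \<partial>trans n z)" for z
  have I: "I \<in> borel_measurable (MH n \<Otimes>\<^sub>M MA)"
    unfolding I_def
    by (rule measurable_compose[OF measurable_prob_algebraD[OF measurable_trans]
          nn_integral_measurable_subprob_algebra[OF Suc(2)]])
  define J where "J h = (\<integral>\<^sup>+a. I (h, a) \<partial>k n h)" for h
  have J: "J \<in> borel_measurable (MH n)"
    unfolding J_def using I by (intro nn_integral_measurable_subprob_algebra2[OF _ measurable_prob_algebraD[OF k]]) (simp add: split_beta')
  define g where "g = (\<lambda>(h, x). \<integral>\<^sup>+a. (\<integral>\<^sup>+y. f (h(n := (x, a)), y) \<partial>completion (q (x, a))) \<partial>completion (\<mu> n (h, x)))"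
  \<comment> \<open>The exceptional set is covered by a measurable null set, to which the rules for
    bind apply.\<close>
  obtain K where K: "K \<in> null_sets (law (Suc n) p)" "\<And>h. h \<in> histories X A (Suc n) \<Longrightarrow> h \<notin> K \<Longrightarrow> f h = f' h"
    using Suc(3) unfolding eventually_ae_filter by (auto simp: space_prob_algebra_cong[OF law_in[OF p]])
  have [measurable]: "K \<in> sets (MH (Suc n))"
    using K(1) sets_prob_algebra_cong[OF law_in[OF p]] by auto
  have law_Suc: "law (Suc n) p = kernel_prod (MH n) MA (law n p) (k n) \<bind> trans n"
    using gen unfolding generated_def step_def by (rule spec)
  have "AE h in law (Suc n) p. h \<notin> K" by (rule AE_not_in[OF K(1)])
  then have "AE z in kernel_prod (MH n) MA (law n p) (k n). AE h in trans n z. h \<notin> K"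
    unfolding law_Suc by (subst (asm) AE_bind_prob_algebra[OF kp measurable_trans]) simp_all
  then have "AE z in kernel_prod (MH n) MA (law n p) (k n). emeasure (trans n z) K = 0"
    using AE_space
  proof eventually_elim
    case (elim z)
    then have "trans n z \<in> space (prob_algebra (MH (Suc n)))"
      using measurable_space[OF measurable_trans] by (simp add: space_prob_algebra_cong[OF kp])
    then have "sets (trans n z) = sets (MH (Suc n))" by (rule sets_prob_algebra_cong)
    then have K: "K \<in> sets (trans n z)" by simp
    then show ?case using elim(1) AE_iff_null_sets[OF K] null_setsD1 by blast
  qed
  moreover have "(\<lambda>z. emeasure (trans n z) K) \<in> borel_measurable (MH n \<Otimes>\<^sub>M MA)"
    by (rule measurable_compose[OF measurable_prob_algebraD[OF measurable_trans] measurable_emeasure_subprob_algebra]) simp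
  then have "Measurable.pred (MH n \<Otimes>\<^sub>M MA) (\<lambda>z. emeasure (trans n z) K = 0)" by measurable
  ultimately have "AE h in law n p. AE a in k n h. emeasure (trans n (h, a)) K = 0"
    by (simp add: AE_kernel_prod[OF L k])
  then have "AE h in law n p. g h = J h"
    using ae[of n] AE_space
  proof eventually_elim
    case (elim h)
    then have h: "h \<in> histories X A n" by (simp add: space_prob_algebra_cong[OF L])
    have kh: "k n h \<in> space (prob_algebra MA)" using measurable_space[OF k, of h n] h by simp
    have "g h = (\<integral>\<^sup>+a. (\<integral>\<^sup>+y. f ((fst h)(n := (snd h, a)), y) \<partial>q (snd h, a)) \<partial>k n h)"
      using elim(2) by (cases h) (simp add: g_def nn_integral_completion)
    also have "\<dots> = J h"
      unfolding J_def
    proof (rule nn_integral_cong_AE)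
      show "AE a in k n h. (\<integral>\<^sup>+y. f ((fst h)(n := (snd h, a)), y) \<partial>q (snd h, a)) = I (h, a)"
        using elim(1) AE_space
      proof eventually_elim
        case (elim a)
        then have z: "(h, a) \<in> space (MH n \<Otimes>\<^sub>M MA)"
          using h by (simp add: space_pair_measure space_prob_algebra_cong[OF kh])
        let ?e = "\<lambda>y. ((fst h)(n := (snd h, a)), y)"
        have qz: "q (snd h, a) \<in> space (prob_algebra MX)"
          using measurable_space[OF measurable_trans_q z] by simp
        have "?e \<in> MX \<rightarrow>\<^sub>M MH (Suc n)"
          using measurable_compose[OF measurable_Pair1'[OF z] measurable_hist_extend[of n]]
          by (simp add: split_beta)
        then have e: "?e \<in> q (snd h, a) \<rightarrow>\<^sub>M MH (Suc n)"
          using measurable_cong_sets[OF sets_prob_algebra_cong[OF qz] refl] by blast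
        have t: "trans n (h, a) = distr (q (snd h, a)) (MH (Suc n)) ?e" by (simp add: trans_def)
        have "emeasure (q (snd h, a)) (?e -` K \<inter> space (q (snd h, a))) = 0"
          using elim(1) unfolding t by (subst (asm) emeasure_distr[OF e]) auto
        then have "?e -` K \<inter> space (q (snd h, a)) \<in> null_sets (q (snd h, a))"
          using measurable_sets[OF e, of K] by (intro null_setsI) auto
        then have "AE y in q (snd h, a). y \<notin> ?e -` K \<inter> space (q (snd h, a))" by (rule AE_not_in)
        then have "AE y in q (snd h, a). f (?e y) = f' (?e y)"
          using AE_space
        proof eventually_elim
          case (elim y)
          then show ?case using measurable_space[OF e, of y] by (intro K(2)) auto
        qed
        then have "(\<integral>\<^sup>+y. f (?e y) \<partial>q (snd h, a)) = (\<integral>\<^sup>+y. f' (?e y) \<partial>q (snd h, a))"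
          by (rule nn_integral_cong_AE)
        also have "\<dots> = I (h, a)"
          unfolding I_def t using e Suc(2) by (simp add: nn_integral_distr)
        finally show ?case .
      qed
    qed
    finally show ?case .
  qed
  then have "iter_integral q p0 \<mu> n g = (\<integral>\<^sup>+h. J h \<partial>law n p)" by (rule Suc.IH[OF J])
  also have "\<dots> = (\<integral>\<^sup>+z. I z \<partial>kernel_prod (MH n) MA (law n p) (k n))"
    unfolding J_def by (rule nn_integral_kernel_prod[OF L k I, symmetric])
  also have "\<dots> = (\<integral>\<^sup>+h. f' h \<partial>law (Suc n) p)"
    unfolding law_Suc I_def
    by (rule nn_integral_bind_prob_algebra[OF kp measurable_trans Suc(2), symmetric])
  finally show ?case by (simp add: g_def)
qed

text \<open>The description in \<open>policy_measure\<close> is uniquely satisfied by the completion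
  of p restricted to the universally measurable sets: the cylinders fix the Borel part, and every
  universally measurable set lies between two Borel sets of equal p-measure.\<close>

lemma strategic_measure_eqI:
  assumes p0: "p0 \<in> space (prob_algebra MX)" and p: "p \<in> space (prob_algebra MT)"
    and init: "law 0 p = initial p0" and gen: "generated p k"
    and k: "\<And>n. k n \<in> MH n \<rightarrow>\<^sub>M prob_algebra MA"
    and ae: "\<And>n. AE h in law n p. \<mu> n h = k n h"
  shows "strategic_measure X A q p0 \<mu> = p"
proof -
  interpret prob_space p using p by (rule prob_algebra_prob_space)
  let ?\<Omega> = "trajectories X A"
  have sp: "space p = ?\<Omega>" and setsp: "sets p = sets MT"
    using space_prob_algebra_cong[OF p] sets_prob_algebra_cong[OF p] by auto
  have iter: "iter_integral q p0 \<mu> n (indicator D) = emeasure p {\<omega> \<in> ?\<Omega>. history_of n \<omega> \<in> D}"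
    if D: "D \<in> sets (MH n)" for n D
  proof -
    have h: "history_of n \<in> p \<rightarrow>\<^sub>M MH n"
      using measurable_history_of measurable_cong_sets[OF setsp refl] by blast
    have "iter_integral q p0 \<mu> n (indicator D) = (\<integral>\<^sup>+h. indicator D h \<partial>law n p)"
      by (rule iter_integral_eq_law[OF p0 p init gen k ae]) (use D in auto)
    also have "\<dots> = emeasure (law n p) D"
      using D sets_prob_algebra_cong[OF law_in[OF p]] by simp
    also have "\<dots> = emeasure p (history_of n -` D \<inter> ?\<Omega>)"
      unfolding law_def using emeasure_distr[OF h D] sp by simp
    also have "history_of n -` D \<inter> ?\<Omega> = {\<omega> \<in> ?\<Omega>. history_of n \<omega> \<in> D}" by auto
    finally show ?thesis .
  qed
  define P where "P = restr_to_subalg (completion p) (universal MT)"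
  have sub: "subalgebra (completion p) (universal MT)"
    unfolding subalgebra_def using sets_universal_completion[OF _ p] sp by auto
  have P: "sets P = sets (universal MT)" "space P = ?\<Omega>"
    unfolding P_def using sub by (auto simp: sets_restr_to_subalg space_restr_to_subalg sp)
  have P_emeasure: "emeasure P B = emeasure (completion p) B" if "B \<in> sets (universal MT)" for B
    unfolding P_def by (rule emeasure_restr_to_subalg[OF sub that])
  have P_borel: "emeasure P B = emeasure p B" if "B \<in> sets MT" for B
    using P_emeasure[OF sets_universalI_borel[OF that]] that setsp by simp
  have PM: "prob_space P"
    using P_borel[of ?\<Omega>] emeasure_space_1 sp sets.top[of MT] by (intro prob_spaceI) (simp add: P)
  have cyl: "{\<omega> \<in> ?\<Omega>. history_of n \<omega> \<in> D} \<in> sets MT" if "D \<in> sets (MH n)" for n D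
    using measurable_sets[OF measurable_history_of that] by (simp add: vimage_def Int_def conj_commute)
  have "policy_measure X A q p0 \<mu> = P"
    unfolding policy_measure_def
  proof (rule the_equality)
    show "prob_space P \<and> sets P = sets (universal MT) \<and>
      (\<forall>n. \<forall>D\<in>sets (MH n). emeasure P {\<omega> \<in> ?\<Omega>. history_of n \<omega> \<in> D} = iter_integral q p0 \<mu> n (indicator D))"
      using PM P P_borel[OF cyl] iter by simp
  next
    fix P' assume P': "prob_space P' \<and> sets P' = sets (universal MT) \<and>
      (\<forall>n. \<forall>D\<in>sets (MH n). emeasure P' {\<omega> \<in> ?\<Omega>. history_of n \<omega> \<in> D} = iter_integral q p0 \<mu> n (indicator D))"
    have sP': "space P' = ?\<Omega>" using P' sets_eq_imp_space_eq[of P' "universal MT"] by simp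
    have id: "(\<lambda>\<omega>. \<omega>) \<in> P' \<rightarrow>\<^sub>M MT"
    proof (rule measurableI)
      fix B assume B: "B \<in> sets MT"
      then have "B \<in> sets P'" using P' sets_universalI_borel by simp
      moreover have "B \<subseteq> ?\<Omega>" using sets.sets_into_space[OF B] by simp
      ultimately show "(\<lambda>\<omega>. \<omega>) -` B \<inter> space P' \<in> sets P'" by (simp add: sP' Int_absorb2)
    qed (simp add: sP')
    define r where "r = distr P' MT (\<lambda>\<omega>. \<omega>)"
    have r: "r \<in> space (prob_algebra MT)"
      unfolding r_def space_prob_algebra using P' prob_space.prob_space_distr[OF _ id] by simp
    have r_eq: "emeasure r B = emeasure P' B" if "B \<in> sets MT" for B
      unfolding r_def using emeasure_distr[OF id that] sets.sets_into_space[OF that] sP' by (simp add: Int_absorb2)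
    have "r = p"
    proof (rule trajectory_measure_eqI[OF r p])
      fix n
      show "law n r = law n p"
      proof (rule measure_eqI)
        fix D assume "D \<in> sets (law n r)"
        then have D: "D \<in> sets (MH n)" by (simp add: law_def)
        have e: "emeasure (law n s) D = emeasure s {\<omega> \<in> ?\<Omega>. history_of n \<omega> \<in> D}"
          if s: "s \<in> space (prob_algebra MT)" for s
        proof -
          have h: "history_of n \<in> s \<rightarrow>\<^sub>M MH n"
            unfolding measurable_cong_sets[OF sets_prob_algebra_cong[OF s] refl] by (rule measurable_history_of)
          show ?thesis unfolding law_def using emeasure_distr[OF h D]
            by (simp add: space_prob_algebra_cong[OF s] vimage_def Int_def conj_commute)
        qed
        show "emeasure (law n r) D = emeasure (law n p) D"
          unfolding e[OF r] e[OF p] r_eq[OF cyl[OF D]] using P' iter[OF D] D by simp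
      qed (simp add: law_def)
    qed
    then have P'_borel: "emeasure P' B = emeasure p B" if "B \<in> sets MT" for B using r_eq[OF that] by simp
    show "P' = P"
    proof (rule measure_eqI)
      show "sets P' = sets P" using P' P by simp
      fix B assume "B \<in> sets P'"
      then have B: "B \<in> sets (universal MT)" using P' by simp
      then have "B \<in> sets (completion p)" by (rule sets_universal_completion[OF _ p])
      then obtain L K K' where L: "B = L \<union> K" "K \<subseteq> K'" "K' \<in> null_sets p" "L \<in> sets p"
        by (elim sets_completionE)
      then have LK: "L \<in> sets MT" "L \<union> K' \<in> sets MT" "B \<subseteq> L \<union> K'" "L \<subseteq> B" using setsp by auto
      have "emeasure p (L \<union> K') = emeasure p L" using L(3,4) by (simp add: emeasure_Un_null_set)
      moreover have "emeasure Q L \<le> emeasure Q B" "emeasure Q B \<le> emeasure Q (L \<union> K')"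
        if "sets Q = sets (universal MT)" for Q
        using that B LK by (auto intro!: emeasure_mono sets_universalI_borel)
      ultimately show "emeasure P' B = emeasure P B"
        using P' P P_borel[OF LK(1)] P_borel[OF LK(2)] P'_borel[OF LK(1)] P'_borel[OF LK(2)]
        by (metis order_antisym)
    qed
  qed
  then have "strategic_measure X A q p0 \<mu> = restr_to_subalg P MT" by (simp add: strategic_measure_def)
  also have "\<dots> = p"
  proof -
    have sub': "subalgebra P MT" unfolding subalgebra_def P using sets_universalI_borel by auto
    show ?thesis
      by (rule measure_eqI) (simp_all add: sets_restr_to_subalg[OF sub'] emeasure_restr_to_subalg[OF sub'] P_borel setsp)
  qed
  finally show ?thesis .
qed

end

section \<open>Existence of the process for Borel kernels\<close>

context mdp
begin

lemma measurable_step_kernel: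
  assumes k: "k \<in> MH n \<rightarrow>\<^sub>M prob_algebra MA"
  shows "(\<lambda>h. k h \<bind> (\<lambda>a. trans n (h, a))) \<in> MH n \<rightarrow>\<^sub>M prob_algebra (MH (Suc n))"
  by (rule measurable_bind_prob_space2[OF k]) (simp add: measurable_trans)

lemma step_eq_bind:
  assumes m: "m \<in> space (prob_algebra (MH n))" and k: "k \<in> MH n \<rightarrow>\<^sub>M prob_algebra MA"
  shows "step n k m = m \<bind> (\<lambda>h. k h \<bind> (\<lambda>a. trans n (h, a)))"
proof -
  have "step n k m = m \<bind> (\<lambda>h. distr (k h) (MH n \<Otimes>\<^sub>M MA) (Pair h) \<bind> trans n)"
    unfolding step_def kernel_prod_def
    by (rule bind_assoc_prob_algebra[OF m measurable_kernel_prod_slice[OF k] measurable_trans])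
  also have "\<dots> = m \<bind> (\<lambda>h. k h \<bind> (\<lambda>a. trans n (h, a)))"
  proof (rule bind_cong_prob_algebra[OF m])
    fix h assume h: "h \<in> space (MH n)"
    then have "k h \<in> space (prob_algebra MA)" by (rule measurable_space[OF k])
    then show "distr (k h) (MH n \<Otimes>\<^sub>M MA) (Pair h) \<bind> trans n = k h \<bind> (\<lambda>a. trans n (h, a))"
      by (rule bind_distr_prob_algebra[OF _ measurable_Pair1'[OF h] measurable_trans])
  qed
  finally show ?thesis .
qed

abbreviation "MXA \<equiv> borel_on (X \<times> A)"

abbreviation "prefix_space n \<equiv> PiM {0..<n} (\<lambda>_. MXA)"

definition next_state :: "'x measure \<Rightarrow> nat \<Rightarrow> (nat \<Rightarrow> 'x \<times> 'a) \<Rightarrow> 'x measure" where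
  "next_state p0 n \<omega> = (if n = 0 then p0 else q (\<omega> (n - 1)))"

text \<open>Regroups the process into steps producing a pair (x_n, a_n) from the preceding pairs,
  the form to which the Ionescu-Tulcea construction applies.\<close>

definition next_pair :: "'x measure \<Rightarrow> (nat \<Rightarrow> ('x, 'a) history \<Rightarrow> 'a measure) \<Rightarrow> nat \<Rightarrow> (nat \<Rightarrow> 'x \<times> 'a) \<Rightarrow> ('x \<times> 'a) measure" where
  "next_pair p0 k n \<omega> = next_state p0 n \<omega> \<bind> (\<lambda>x. distr (k n (\<omega>, x)) MXA (Pair x))"

lemma measurable_next_state:
  assumes p0: "p0 \<in> space (prob_algebra MX)"
  shows "next_state p0 n \<in> prefix_space n \<rightarrow>\<^sub>M prob_algebra MX"
proof (cases n)
  case 0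
  then show ?thesis using p0 by (simp add: next_state_def[abs_def])
next
  case (Suc m)
  have "(\<lambda>\<omega>. \<omega> m) \<in> prefix_space (Suc m) \<rightarrow>\<^sub>M MXA" by (rule measurable_component_singleton) simp
  from measurable_compose[OF this q] show ?thesis by (simp add: next_state_def[abs_def] Suc)
qed

text \<open>Elements of the finite product are \<open>undefined\<close> from index n on, exactly as
  histories are, so the two spaces consist of the same functions and only the \<sigma>-algebras have
  to be compared.\<close>

lemma measurable_prefix_history: "(\<lambda>z. z) \<in> prefix_space n \<Otimes>\<^sub>M MX \<rightarrow>\<^sub>M MH n"
proof (rule measurable_borel_onI)
  have "fst \<in> prefix_space n \<Otimes>\<^sub>M MX \<rightarrow>\<^sub>M (borel :: (nat \<Rightarrow> 'x \<times> 'a) measure)"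
  proof (rule measurable_coordinatewise_borel)
    fix i
    show "(\<lambda>z. fst z i) \<in> prefix_space n \<Otimes>\<^sub>M MX \<rightarrow>\<^sub>M borel"
    proof (cases "i < n")
      case True
      then have c: "(\<lambda>\<omega>. \<omega> i) \<in> prefix_space n \<rightarrow>\<^sub>M MXA" by (intro measurable_component_singleton) simp
      show ?thesis
        by (rule measurable_compose[OF measurable_compose[OF measurable_fst c] measurable_borel_on_id])
    next
      case False
      have "(\<lambda>z. fst z i) \<in> prefix_space n \<Otimes>\<^sub>M MX \<rightarrow>\<^sub>M borel \<longleftrightarrow>
        (\<lambda>z. undefined :: 'x \<times> 'a) \<in> prefix_space n \<Otimes>\<^sub>M MX \<rightarrow>\<^sub>M borel"
        using False by (intro measurable_cong) (auto simp: space_pair_measure space_PiM PiE_iff extensional_def)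
      then show ?thesis by simp
    qed
  qed
  moreover have "snd \<in> prefix_space n \<Otimes>\<^sub>M MX \<rightarrow>\<^sub>M borel"
    using measurable_compose[OF measurable_snd measurable_borel_on_id] by simp
  ultimately have "(\<lambda>z. (fst z, snd z)) \<in> prefix_space n \<Otimes>\<^sub>M MX \<rightarrow>\<^sub>M borel" by (rule measurable_Pair_borel)
  then show "(\<lambda>z. z) \<in> prefix_space n \<Otimes>\<^sub>M MX \<rightarrow>\<^sub>M borel" by simp
qed (auto simp: space_pair_measure space_PiM PiE_iff extensional_def histories_iff)

lemma measurable_Pair_MXA: "(\<lambda>(z, a). (snd z, a)) \<in> (prefix_space n \<Otimes>\<^sub>M MX) \<Otimes>\<^sub>M MA \<rightarrow>\<^sub>M MXA"
proof (rule measurable_borel_onI)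
  have "(\<lambda>w. snd (fst w)) \<in> (prefix_space n \<Otimes>\<^sub>M MX) \<Otimes>\<^sub>M MA \<rightarrow>\<^sub>M borel"
    using measurable_compose[OF measurable_compose[OF measurable_fst measurable_snd] measurable_borel_on_id] by simp
  moreover have "snd \<in> (prefix_space n \<Otimes>\<^sub>M MX) \<Otimes>\<^sub>M MA \<rightarrow>\<^sub>M borel"
    using measurable_compose[OF measurable_snd measurable_borel_on_id] by simp
  ultimately show "(\<lambda>(z, a). (snd z, a)) \<in> (prefix_space n \<Otimes>\<^sub>M MX) \<Otimes>\<^sub>M MA \<rightarrow>\<^sub>M borel"
    unfolding split_beta by (rule measurable_Pair_borel)
qed (auto simp: space_pair_measure)

lemma measurable_next_pair_slice:
  assumes k: "k n \<in> MH n \<rightarrow>\<^sub>M prob_algebra MA"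
  shows "(\<lambda>z. distr (k n z) MXA (Pair (snd z))) \<in> prefix_space n \<Otimes>\<^sub>M MX \<rightarrow>\<^sub>M prob_algebra MXA"
  using measurable_compose[OF measurable_prefix_history k] measurable_Pair_MXA
  by (intro measurable_distr_prob_space2[where M=MA]) (simp_all add: split_beta')

lemma measurable_next_pair:
  assumes p0: "p0 \<in> space (prob_algebra MX)" and k: "k n \<in> MH n \<rightarrow>\<^sub>M prob_algebra MA"
  shows "next_pair p0 k n \<in> prefix_space n \<rightarrow>\<^sub>M prob_algebra MXA"
  unfolding next_pair_def
  using measurable_next_pair_slice[of k n, OF k]
  by (intro measurable_bind_prob_space2[OF measurable_next_state[OF p0]]) (simp add: split_beta')

text \<open>The construction yields laws of prefixes of pairs, whereas a history ends with a state.
  So the law of h_n is the law of n pairs followed by \<open>next_state\<close>, and the one-step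
  equations are rearranged by associativity of bind.\<close>

theorem trajectory_measure_exists:
  assumes p0: "p0 \<in> space (prob_algebra MX)" and k: "\<And>n. k n \<in> MH n \<rightarrow>\<^sub>M prob_algebra MA"
  obtains p where "p \<in> space (prob_algebra MT)" "law 0 p = initial p0" "generated p k"
proof -
  let ?P = "next_pair p0 k"
  have P: "?P n \<in> prefix_space n \<rightarrow>\<^sub>M prob_algebra MXA" for n by (rule measurable_next_pair[OF p0 k])
  interpret IT: Ionescu_Tulcea ?P "\<lambda>_. MXA"
    by (rule Ionescu_Tulcea.intro)
       (rule measurable_prob_algebraD[OF P], rule prob_algebra_prob_space[OF measurable_space[OF P]])
  let ?u = "\<lambda>_::nat. undefined :: 'x \<times> 'a"
  have u: "?u \<in> space (prefix_space 0)" by (simp add: space_PiM)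
  define C where "C n = IT.C 0 n ?u" for n
  have C: "C n \<in> space (prob_algebra (prefix_space n))" for n
    using IT.sets_C[OF u, of n] IT.prob_space_C[OF u, of n] by (simp add: C_def space_prob_algebra)
  have eP: "IT.eP n \<in> prefix_space n \<rightarrow>\<^sub>M prob_algebra (prefix_space (Suc n))" for n
    by (rule measurable_prob_algebraI[OF IT.prob_space_eP IT.measurable_eP])
  have C0: "C 0 = return (prefix_space 0) ?u" by (simp add: C_def)
  have C_Suc: "C (Suc n) = C n \<bind> IT.eP n" for n by (simp add: C_def)
  have restrict_meas: "(\<lambda>\<omega>. restrict \<omega> {0..<n}) \<in> PiM UNIV (\<lambda>_. MXA) \<rightarrow>\<^sub>M prefix_space n" for n
    by (rule measurable_restrict_subset) simp
  have lim_C: "distr IT.PF.lim (prefix_space n) (\<lambda>\<omega>. restrict \<omega> {0..<n}) = C n" for n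
  proof -
    have "IT.up_to {0..<n} = n"
    proof (rule antisym)
      show "IT.up_to {0..<n} \<le> n" by (simp add: IT.up_to_iff)
      show "n \<le> IT.up_to {0..<n}"
      proof (cases n)
        case (Suc m)
        then show ?thesis using IT.up_to_less[of "{0..<n}" m] by simp
      qed simp
    qed
    then have "distr IT.PF.lim (prefix_space n) (\<lambda>\<omega>. restrict \<omega> {0..<n}) = distr (C n) (prefix_space n) (\<lambda>\<omega>. restrict \<omega> {0..<n})"
      using IT.distr_lim[of "{0..<n}"] by (simp add: IT.CI_def C_def)
    also have "\<dots> = C n"
      by (rule distr_id_prob_algebra[OF C]) (auto simp: space_PiM PiE_iff extensional_restrict)
    finally show ?thesis .
  qed
  have "prob_space (distr IT.PF.lim (prefix_space 0) (\<lambda>\<omega>. restrict \<omega> {0..<0}))"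
    unfolding lim_C using prob_algebra_prob_space[OF C] .
  moreover have "(\<lambda>\<omega>. restrict \<omega> {0..<0}) \<in> IT.PF.lim \<rightarrow>\<^sub>M prefix_space 0"
    unfolding measurable_cong_sets[OF IT.PF.sets_lim refl] by (rule restrict_meas)
  ultimately have "prob_space IT.PF.lim" by (rule prob_space_distrD[rotated])
  then have lim: "IT.PF.lim \<in> space (prob_algebra (PiM UNIV (\<lambda>_. MXA)))"
    by (simp add: space_prob_algebra)
  have id: "(\<lambda>\<omega>. \<omega>) \<in> PiM UNIV (\<lambda>_. MXA) \<rightarrow>\<^sub>M MT"
  proof (rule measurable_borel_onI)
    show "(\<lambda>\<omega> :: nat \<Rightarrow> 'x \<times> 'a. \<omega>) \<in> PiM UNIV (\<lambda>_. MXA) \<rightarrow>\<^sub>M borel"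
    proof (rule measurable_coordinatewise_borel)
      fix i :: nat
      have "(\<lambda>\<omega>. \<omega> i) \<in> PiM UNIV (\<lambda>_. MXA) \<rightarrow>\<^sub>M MXA" by (rule measurable_component_singleton) simp
      from measurable_compose[OF this measurable_borel_on_id]
      show "(\<lambda>\<omega>. \<omega> i) \<in> PiM UNIV (\<lambda>_. MXA) \<rightarrow>\<^sub>M borel" .
    qed
  qed (auto simp: space_PiM trajectories_def)
  define p where "p = distr IT.PF.lim MT (\<lambda>\<omega>. \<omega>)"
  have p: "p \<in> space (prob_algebra MT)" unfolding p_def by (rule distr_in_prob_algebra[OF lim id])
  \<comment> \<open>n + 1 pairs determine h_n once the last action is forgotten.\<close>
  define cut where "cut n f = (restrict f {..<n}, fst (f n))" for n and f :: "nat \<Rightarrow> 'x \<times> 'a"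
  have cut: "cut n \<in> prefix_space (Suc n) \<rightarrow>\<^sub>M MH n" for n
  proof -
    have "(\<lambda>f. restrict f {0..<n}) \<in> prefix_space (Suc n) \<rightarrow>\<^sub>M prefix_space n"
      by (rule measurable_restrict_subset) auto
    moreover have "(\<lambda>f. fst (f n)) \<in> prefix_space (Suc n) \<rightarrow>\<^sub>M MX"
    proof (rule measurable_borel_onI)
      have "(\<lambda>f. f n) \<in> prefix_space (Suc n) \<rightarrow>\<^sub>M MXA" by (rule measurable_component_singleton) simp
      from measurable_compose[OF measurable_compose[OF this measurable_borel_on_id] measurable_fst_borel]
      show "(\<lambda>f. fst (f n)) \<in> prefix_space (Suc n) \<rightarrow>\<^sub>M borel" .
    qed (auto simp: space_PiM PiE_iff mem_Times_iff)
    ultimately have "(\<lambda>f. (restrict f {0..<n}, fst (f n))) \<in> prefix_space (Suc n) \<rightarrow>\<^sub>M prefix_space n \<Otimes>\<^sub>M MX"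
      by (rule measurable_Pair)
    from measurable_compose[OF this measurable_prefix_history] show ?thesis
      by (simp add: cut_def[abs_def] lessThan_atLeast0)
  qed
  have law_C: "law n p = C n \<bind> (\<lambda>\<omega>. distr (next_state p0 n \<omega>) (MH n) (Pair \<omega>))" for n
  proof -
    have "law n p = distr IT.PF.lim (MH n) (history_of n)"
      unfolding law_def p_def by (simp add: distr_distr_prob_algebra[OF lim id measurable_history_of])
    also have "\<dots> = distr IT.PF.lim (MH n) (\<lambda>\<omega>. cut n (restrict \<omega> {0..<Suc n}))"
      by (rule distr_cong_prob_algebra[OF lim]) (auto simp: history_of_def cut_def restrict_def fun_eq_iff)
    also have "\<dots> = distr (C (Suc n)) (MH n) (cut n)"
      unfolding lim_C[symmetric] by (rule distr_distr_prob_algebra[OF lim restrict_meas cut, symmetric])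
    also have "\<dots> = C n \<bind> (\<lambda>\<omega>. distr (IT.eP n \<omega>) (MH n) (cut n))"
      unfolding C_Suc by (rule distr_bind_prob_algebra[OF C eP cut])
    also have "\<dots> = C n \<bind> (\<lambda>\<omega>. distr (next_state p0 n \<omega>) (MH n) (Pair \<omega>))"
    proof (rule bind_cong_prob_algebra[OF C])
      fix \<omega> assume \<omega>: "\<omega> \<in> space (prefix_space n)"
      have Pn: "?P n \<omega> \<in> space (prob_algebra MXA)" by (rule measurable_space[OF P \<omega>])
      have s: "next_state p0 n \<omega> \<in> space (prob_algebra MX)"
        by (rule measurable_space[OF measurable_next_state[OF p0] \<omega>])
      have upd: "fun_upd \<omega> n \<in> MXA \<rightarrow>\<^sub>M prefix_space (Suc n)"
        using \<omega> by (intro measurable_fun_upd[where J="{0..<n}"]) auto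
      have cut_upd: "cut n (fun_upd \<omega> n z) = (\<omega>, fst z)" for z
        using \<omega> by (auto simp: cut_def space_PiM PiE_iff extensional_def restrict_def fun_eq_iff)
      have pair: "Pair \<omega> \<in> MX \<rightarrow>\<^sub>M MH n"
        using measurable_compose[OF measurable_Pair1'[OF \<omega>] measurable_prefix_history] by simp
      have slice: "(\<lambda>x. distr (k n (\<omega>, x)) MXA (Pair x)) \<in> MX \<rightarrow>\<^sub>M prob_algebra MXA"
        using measurable_compose[OF measurable_Pair1'[OF \<omega>] measurable_next_pair_slice[of k n, OF k]] by simp
      have fstp: "(\<lambda>z. (\<omega>, fst z)) \<in> MXA \<rightarrow>\<^sub>M MH n"
        using measurable_compose[OF upd cut] by (simp add: cut_upd)
      have "distr (IT.eP n \<omega>) (MH n) (cut n) = distr (?P n \<omega>) (MH n) (\<lambda>z. (\<omega>, fst z))"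
        unfolding IT.eP_def by (simp add: distr_distr_prob_algebra[OF Pn upd cut] cut_upd)
      also have "\<dots> = next_state p0 n \<omega> \<bind> (\<lambda>x. distr (distr (k n (\<omega>, x)) MXA (Pair x)) (MH n) (\<lambda>z. (\<omega>, fst z)))"
        unfolding next_pair_def by (rule distr_bind_prob_algebra[OF s slice fstp])
      also have "\<dots> = next_state p0 n \<omega> \<bind> (\<lambda>x. return (MH n) (\<omega>, x))"
      proof (rule bind_cong_prob_algebra[OF s])
        fix x assume x: "x \<in> space MX"
        have h: "(\<omega>, x) \<in> space (MH n)" using measurable_space[OF pair x] .
        have kn: "k n (\<omega>, x) \<in> space (prob_algebra MA)" by (rule measurable_space[OF k h])
        then interpret prob_space "k n (\<omega>, x)" by (rule prob_algebra_prob_space)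
        have "Pair x \<in> MA \<rightarrow>\<^sub>M MXA"
        proof (rule measurable_borel_onI)
          show "Pair x \<in> MA \<rightarrow>\<^sub>M borel" by (rule measurable_Pair_borel) auto
        qed (use x in auto)
        then have "distr (distr (k n (\<omega>, x)) MXA (Pair x)) (MH n) (\<lambda>z. (\<omega>, fst z)) = distr (k n (\<omega>, x)) (MH n) (\<lambda>_. (\<omega>, x))"
          using distr_distr_prob_algebra[OF kn _ fstp] by simp
        also have "\<dots> = return (MH n) (\<omega>, x)" by (rule distr_const[OF h])
        finally show "distr (distr (k n (\<omega>, x)) MXA (Pair x)) (MH n) (\<lambda>z. (\<omega>, fst z)) = return (MH n) (\<omega>, x)" .
      qed
      also have "\<dots> = distr (next_state p0 n \<omega>) (MH n) (Pair \<omega>)"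
        using pair measurable_cong_sets[OF sets_prob_algebra_cong[OF s] refl] prob_space.not_empty[OF prob_algebra_prob_space[OF s]]
        by (intro bind_return_distr') auto
      finally show "distr (IT.eP n \<omega>) (MH n) (cut n) = distr (next_state p0 n \<omega>) (MH n) (Pair \<omega>)" .
    qed
    finally show ?thesis .
  qed
  have state_meas: "(\<lambda>\<omega>. distr (next_state p0 n \<omega>) (MH n) (Pair \<omega>)) \<in> prefix_space n \<rightarrow>\<^sub>M prob_algebra (MH n)" for n
    using measurable_prefix_history
    by (intro measurable_distr_prob_space2[OF measurable_next_state[OF p0]]) simp
  have "law 0 p = initial p0"
  proof -
    have "law 0 p = distr p0 (MH 0) (Pair ?u)"
      unfolding law_C C0
      by (subst bind_return[OF measurable_prob_algebraD[OF state_meas] u]) (simp add: next_state_def)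
    then show ?thesis by (simp add: initial_def)
  qed
  moreover have "generated p k"
    unfolding generated_def
  proof
    fix n
    let ?F = "\<lambda>\<omega>. distr (next_state p0 (Suc n) \<omega>) (MH (Suc n)) (Pair \<omega>)"
    let ?S = "\<lambda>h. k n h \<bind> (\<lambda>a. trans n (h, a))"
    have L: "law n p \<in> space (prob_algebra (MH n))" by (rule law_in[OF p])
    have "law (Suc n) p = C n \<bind> (\<lambda>\<omega>. IT.eP n \<omega> \<bind> ?F)"
      unfolding law_C C_Suc by (rule bind_assoc_prob_algebra[OF C eP state_meas])
    also have "\<dots> = C n \<bind> (\<lambda>\<omega>. distr (next_state p0 n \<omega>) (MH n) (Pair \<omega>) \<bind> ?S)"
    proof (rule bind_cong_prob_algebra[OF C])
      fix \<omega> assume \<omega>: "\<omega> \<in> space (prefix_space n)"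
      have Pn: "?P n \<omega> \<in> space (prob_algebra MXA)" by (rule measurable_space[OF P \<omega>])
      have s: "next_state p0 n \<omega> \<in> space (prob_algebra MX)"
        by (rule measurable_space[OF measurable_next_state[OF p0] \<omega>])
      have upd: "fun_upd \<omega> n \<in> MXA \<rightarrow>\<^sub>M prefix_space (Suc n)"
        using \<omega> by (intro measurable_fun_upd[where J="{0..<n}"]) auto
      have pair: "Pair \<omega> \<in> MX \<rightarrow>\<^sub>M MH n"
        using measurable_compose[OF measurable_Pair1'[OF \<omega>] measurable_prefix_history] by simp
      have slice: "(\<lambda>x. distr (k n (\<omega>, x)) MXA (Pair x)) \<in> MX \<rightarrow>\<^sub>M prob_algebra MXA"
        using measurable_compose[OF measurable_Pair1'[OF \<omega>] measurable_next_pair_slice[of k n, OF k]] by simp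
      have F': "(\<lambda>z. ?F (fun_upd \<omega> n z)) \<in> MXA \<rightarrow>\<^sub>M prob_algebra (MH (Suc n))"
        by (rule measurable_compose[OF upd state_meas])
      have F_trans: "?F (fun_upd \<omega> n (x, a)) = trans n ((\<omega>, x), a)" for x a
        by (simp add: next_state_def trans_def)
      have "IT.eP n \<omega> \<bind> ?F = ?P n \<omega> \<bind> (\<lambda>z. ?F (fun_upd \<omega> n z))"
        unfolding IT.eP_def by (rule bind_distr_prob_algebra[OF Pn upd state_meas])
      also have "\<dots> = next_state p0 n \<omega> \<bind> (\<lambda>x. distr (k n (\<omega>, x)) MXA (Pair x) \<bind> (\<lambda>z. ?F (fun_upd \<omega> n z)))"
        unfolding next_pair_def by (rule bind_assoc_prob_algebra[OF s slice F'])
      also have "\<dots> = next_state p0 n \<omega> \<bind> (\<lambda>x. ?S (\<omega>, x))"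
      proof (rule bind_cong_prob_algebra[OF s])
        fix x assume x: "x \<in> space MX"
        have kn: "k n (\<omega>, x) \<in> space (prob_algebra MA)"
          by (rule measurable_space[OF k measurable_space[OF pair x]])
        have "Pair x \<in> MA \<rightarrow>\<^sub>M MXA"
        proof (rule measurable_borel_onI)
          show "Pair x \<in> MA \<rightarrow>\<^sub>M borel" by (rule measurable_Pair_borel) auto
        qed (use x in auto)
        from bind_distr_prob_algebra[OF kn this F']
        show "distr (k n (\<omega>, x)) MXA (Pair x) \<bind> (\<lambda>z. ?F (fun_upd \<omega> n z)) = ?S (\<omega>, x)"
          by (simp add: F_trans)
      qed
      also have "\<dots> = distr (next_state p0 n \<omega>) (MH n) (Pair \<omega>) \<bind> ?S"
        by (rule bind_distr_prob_algebra[OF s pair measurable_step_kernel[OF k], symmetric])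
      finally show "IT.eP n \<omega> \<bind> ?F = distr (next_state p0 n \<omega>) (MH n) (Pair \<omega>) \<bind> ?S" .
    qed
    also have "\<dots> = law n p \<bind> ?S"
      unfolding law_C by (rule bind_assoc_prob_algebra[OF C state_meas measurable_step_kernel[OF k], symmetric])
    also have "\<dots> = step n (k n) (law n p)" by (rule step_eq_bind[OF L k, symmetric])
    finally show "law (Suc n) p = step n (k n) (law n p)" .
  qed
  ultimately show thesis using p that by blast
qed

end

section \<open>Strategic measures of a class of policies\<close>

text \<open>One fixed choice that depends on the two spaces only. Times with the same space of views
  and the same mixture thus get identical kernels, not just almost surely equal ones.\<close>

definition disintegration :: "'a measure \<Rightarrow> 'b measure \<Rightarrow> ('a \<times> 'b) measure \<Rightarrow> 'a \<Rightarrow> 'b measure" where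
  "disintegration M N = (SOME K. (\<lambda>(\<nu>, x). K \<nu> x) \<in> prob_algebra (M \<Otimes>\<^sub>M N) \<Otimes>\<^sub>M M \<rightarrow>\<^sub>M prob_algebra N \<and>
    (\<forall>\<nu>\<in>space (prob_algebra (M \<Otimes>\<^sub>M N)). kernel_prod M N (distr \<nu> M fst) (K \<nu>) = \<nu>))"

lemma
  assumes "real_retract M" "real_retract N"
  shows measurable_disintegration_kernel:
      "(\<lambda>(\<nu>, x). disintegration M N \<nu> x) \<in> prob_algebra (M \<Otimes>\<^sub>M N) \<Otimes>\<^sub>M M \<rightarrow>\<^sub>M prob_algebra N" (is ?P)
    and kernel_prod_disintegration:
      "\<nu> \<in> space (prob_algebra (M \<Otimes>\<^sub>M N)) \<Longrightarrow>
        kernel_prod M N (distr \<nu> M fst) (disintegration M N \<nu>) = \<nu>"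
proof -
  obtain K where "(\<lambda>(\<nu>, x). K \<nu> x) \<in> prob_algebra (M \<Otimes>\<^sub>M N) \<Otimes>\<^sub>M M \<rightarrow>\<^sub>M prob_algebra N"
    "\<And>\<nu>. \<nu> \<in> space (prob_algebra (M \<Otimes>\<^sub>M N)) \<Longrightarrow> kernel_prod M N (distr \<nu> M fst) (K \<nu>) = \<nu>"
    using measurable_disintegration[OF assms] by metis
  then have ex: "\<exists>K. (\<lambda>(\<nu>, x). K \<nu> x) \<in> prob_algebra (M \<Otimes>\<^sub>M N) \<Otimes>\<^sub>M M \<rightarrow>\<^sub>M prob_algebra N \<and>
    (\<forall>\<nu>\<in>space (prob_algebra (M \<Otimes>\<^sub>M N)). kernel_prod M N (distr \<nu> M fst) (K \<nu>) = \<nu>)" by blast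
  show ?P unfolding disintegration_def by (rule conjunct1[OF someI_ex[OF ex]])
  show "\<nu> \<in> space (prob_algebra (M \<Otimes>\<^sub>M N)) \<Longrightarrow>
        kernel_prod M N (distr \<nu> M fst) (disintegration M N \<nu>) = \<nu>"
    unfolding disintegration_def by (rule bspec[OF conjunct2[OF someI_ex[OF ex]]])
qed

text \<open>In this direction a measurable null set covering the exceptions is enough, so P may be a
  condition such as membership in an analytic set.\<close>

lemma AE_bindD:
  assumes m: "m \<in> space (prob_algebra M)" and k: "k \<in> M \<rightarrow>\<^sub>M prob_algebra N" and ae: "AE y in m \<bind> k. P y"
  shows "AE x in m. AE y in k x. P y"
proof -
  note b = bind_in_prob_algebra[OF m k]
  obtain K where K: "K \<in> null_sets (m \<bind> k)" "{y\<in>space (m \<bind> k). \<not> P y} \<subseteq> K"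
    using ae unfolding eventually_ae_filter by blast
  have K_sets: "K \<in> sets N" using K(1) sets_prob_algebra_cong[OF b] by auto
  have "AE y in m \<bind> k. y \<notin> K" by (rule AE_not_in[OF K(1)])
  moreover have "Measurable.pred N (\<lambda>y. y \<notin> K)" using K_sets by measurable
  ultimately have "AE x in m. AE y in k x. y \<notin> K" using AE_bind_prob_algebra[OF m k] by blast
  then show ?thesis using AE_space
  proof eventually_elim
    case (elim x)
    then have "k x \<in> space (prob_algebra N)"
      using measurable_space[OF k] by (simp add: space_prob_algebra_cong[OF m])
    then have sp: "space (k x) = space (m \<bind> k)"
      by (simp add: space_prob_algebra_cong space_prob_algebra_cong[OF b])
    show ?case using elim(1) AE_space by eventually_elim (use K(2) sp in auto)
  qed
qed

lemma pmf_in_prob_algebra: "measure_pmf w \<in> space (prob_algebra (count_space UNIV))"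
  by (simp add: space_prob_algebra measure_pmf.prob_space_axioms)

lemma distr_kernel_prod:
  assumes m: "m \<in> space (prob_algebra M)" and f: "f \<in> M \<rightarrow>\<^sub>M M'" and k: "k \<in> M' \<rightarrow>\<^sub>M prob_algebra N"
  shows "distr (kernel_prod M N m (\<lambda>x. k (f x))) (M' \<Otimes>\<^sub>M N) (\<lambda>z. (f (fst z), snd z)) =
    kernel_prod M' N (distr m M' f) k"
proof -
  have kf: "(\<lambda>x. k (f x)) \<in> M \<rightarrow>\<^sub>M prob_algebra N" by (rule measurable_compose[OF f k])
  have g: "(\<lambda>z. (f (fst z), snd z)) \<in> M \<Otimes>\<^sub>M N \<rightarrow>\<^sub>M M' \<Otimes>\<^sub>M N"
    by (intro measurable_Pair measurable_compose[OF measurable_fst f] measurable_snd)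
  have "distr (kernel_prod M N m (\<lambda>x. k (f x))) (M' \<Otimes>\<^sub>M N) (\<lambda>z. (f (fst z), snd z)) =
      m \<bind> (\<lambda>x. distr (distr (k (f x)) (M \<Otimes>\<^sub>M N) (Pair x)) (M' \<Otimes>\<^sub>M N) (\<lambda>z. (f (fst z), snd z)))"
    unfolding kernel_prod_def by (rule distr_bind_prob_algebra[OF m measurable_kernel_prod_slice[OF kf] g])
  also have "\<dots> = m \<bind> (\<lambda>x. distr (k (f x)) (M' \<Otimes>\<^sub>M N) (Pair (f x)))"
  proof (rule bind_cong_prob_algebra[OF m])
    fix x assume x: "x \<in> space M"
    have "k (f x) \<in> space (prob_algebra N)" by (rule measurable_space[OF kf x])
    from distr_distr_prob_algebra[OF this measurable_Pair1'[OF x] g]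
    show "distr (distr (k (f x)) (M \<Otimes>\<^sub>M N) (Pair x)) (M' \<Otimes>\<^sub>M N) (\<lambda>z. (f (fst z), snd z)) =
        distr (k (f x)) (M' \<Otimes>\<^sub>M N) (Pair (f x))" by simp
  qed
  also have "\<dots> = distr m M' f \<bind> (\<lambda>y. distr (k y) (M' \<Otimes>\<^sub>M N) (Pair y))"
    by (rule bind_distr_prob_algebra[OF m f measurable_kernel_prod_slice[OF k], symmetric])
  finally show ?thesis unfolding kernel_prod_def .
qed

lemma kernel_prod_bind:
  assumes m: "m \<in> space (prob_algebra L)" and f: "f \<in> L \<rightarrow>\<^sub>M prob_algebra M" and k: "k \<in> M \<rightarrow>\<^sub>M prob_algebra N"
  shows "kernel_prod M N (m \<bind> f) k = m \<bind> (\<lambda>x. kernel_prod M N (f x) k)"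
  unfolding kernel_prod_def by (rule bind_assoc_prob_algebra[OF m f measurable_kernel_prod_slice[OF k]])

lemma kernel_prod_cong_AE:
  assumes m: "m \<in> space (prob_algebra M)" and k: "k \<in> M \<rightarrow>\<^sub>M prob_algebra N" and k': "k' \<in> M \<rightarrow>\<^sub>M prob_algebra N"
    and ae: "AE x in m. k x = k' x"
  shows "kernel_prod M N m k = kernel_prod M N m k'"
  unfolding kernel_prod_def
  by (rule bind_cong_AE'[OF m measurable_kernel_prod_slice[OF k] measurable_kernel_prod_slice[OF k']])
     (use ae in eventually_elim, simp)

definition point_masses :: "'a measure \<Rightarrow> 'a measure set" where
  "point_masses M = {return M a | a. a \<in> space M}"

text \<open>A point mass is recovered from its median.\<close>

lemma point_masses_in_sets:
  assumes "real_retract M"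
  shows "point_masses M \<in> sets (prob_algebra M)"
proof -
  obtain e d where e: "e \<in> M \<rightarrow>\<^sub>M (borel :: real measure)" and d: "d \<in> borel \<rightarrow>\<^sub>M M"
    and de: "\<And>x. x \<in> space M \<Longrightarrow> d (e x) = x" using assms unfolding real_retract_def by blast
  define F where "F m r = measure (distr m borel e) (rat_atMost r)" for m and r :: rat
  define T where "T m = d (quantile (F m) (1/2))" for m
  have "F \<in> prob_algebra M \<rightarrow>\<^sub>M borel"
    unfolding F_def
    by (intro measurable_coordinatewise_then_product
        measurable_compose[OF measurable_distr_prob_space[OF e] measurable_measure_prob_algebra]) simp
  then have "(\<lambda>m. (F m, 1/2)) \<in> prob_algebra M \<rightarrow>\<^sub>M borel \<Otimes>\<^sub>M uniform01"
    by (intro measurable_Pair measurable_const) (auto simp: space_restrict_space)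
  from measurable_compose[OF measurable_compose[OF this measurable_quantile] d]
  have T: "T \<in> prob_algebra M \<rightarrow>\<^sub>M M" by (simp add: T_def[abs_def])
  have T_return: "T (return M a) = a" if a: "a \<in> space M" for a
  proof -
    have R: "distr (return M a) borel e = return borel (e a)" by (rule distr_return[OF e a])
    have "return borel (e a) \<in> space (prob_algebra borel)" by (simp add: space_prob_algebra prob_space_return)
    then have cdf: "rat_cdf (F (return M a))" unfolding F_def R by (rule rat_cdf_measure)
    have "quantile (F (return M a)) (1/2) \<le> of_rat r \<longleftrightarrow> e a \<le> of_rat r" for r
      by (subst quantile_le_iff[OF cdf]) (auto simp: F_def R measure_return indicator_def)
    then have "quantile (F (return M a)) (1/2) = e a"
      using of_rat_dense[of "quantile (F (return M a)) (1/2)" "e a"] of_rat_dense[of "e a" "quantile (F (return M a)) (1/2)"]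
      by (metis linorder_neqE_linordered_idom not_le less_imp_le)
    then show ?thesis by (simp add: T_def de[OF a])
  qed
  have "{m\<in>space (prob_algebra M). m = return M (T m)} \<in> sets (prob_algebra M)"
    by (rule sets_eq_prob_kernels[OF assms measurable_ident measurable_compose[OF T measurable_return_prob_space], simplified])
  also have "{m\<in>space (prob_algebra M). m = return M (T m)} = point_masses M"
  proof (intro equalityI subsetI)
    fix m assume "m \<in> {m\<in>space (prob_algebra M). m = return M (T m)}"
    then show "m \<in> point_masses M" using measurable_space[OF T] unfolding point_masses_def by blast
  next
    fix m assume "m \<in> point_masses M"
    then obtain a where a: "a \<in> space M" "m = return M a" unfolding point_masses_def by blast
    then show "m \<in> {m\<in>space (prob_algebra M). m = return M (T m)}"
      by (simp add: T_return space_prob_algebra prob_space_return)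
  qed
  finally show ?thesis .
qed

lemma completion_prob_one_iff_AE:
  assumes m: "prob_space m" and B: "B \<subseteq> space m"
  shows "emeasure (completion m) B = 1 \<longleftrightarrow> (AE x in m. x \<in> B)"
proof -
  interpret prob_space m by (rule m)
  interpret c: prob_space "completion m" by (rule prob_spaceI) (simp add: emeasure_space_1)
  show ?thesis
  proof
    assume 1: "emeasure (completion m) B = 1"
    \<comment> \<open>Sets outside the \<sigma>-algebra get the value 0, so the value 1 forces
      measurability.\<close>
    have "B \<in> sets (completion m)"
    proof (rule ccontr)
      assume "B \<notin> sets (completion m)"
      then have "emeasure (completion m) B = 0" by (rule emeasure_notin_sets)
      with 1 show False by simp
    qed
    moreover have "c.prob B = 1" using 1 by (simp add: measure_def)
    ultimately have "AE x in completion m. x \<in> B" by (simp only: c.AE_in_set_eq_1)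
    then show "AE x in m. x \<in> B" by (simp add: AE_completion_iff)
  next
    assume ae: "AE x in m. x \<in> B"
    then obtain K where K: "K \<in> null_sets m" "{x\<in>space m. x \<notin> B} \<subseteq> K"
      unfolding eventually_ae_filter by blast
    have "B \<in> sets (completion m)"
    proof (rule completion_sandwich)
      show "space m - K \<in> sets m" using K by auto
      have "space m - (space m - K) = K" using K(1) sets.sets_into_space[of K m] by auto
      then show "emeasure m (space m - (space m - K)) = 0" using K(1) by auto
    qed (use B K in auto)
    then show "emeasure (completion m) B = 1" by (rule c.emeasure_eq_1_AE[OF _ AE_completion[OF ae]])
  qed
qed

section \<open>The graph of the constraint and its selector\<close>

context mdp
begin

definition \<Gamma> :: "('x \<times> 'a) set" where "\<Gamma> = {(x, a). x \<in> X \<and> a \<in> Adm x}"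

lemma analytic_\<Gamma>: "analytic \<Gamma>"
  unfolding \<Gamma>_def by (rule analytic_in_subset_imp_analytic[OF graph])

lemma \<Gamma>_subset: "\<Gamma> \<subseteq> X \<times> A"
  using Adm by (auto simp: \<Gamma>_def)

text \<open>The first component of a parametrization of \<Gamma> maps Baire space onto X. Its
  lexicographic section picks a point of \<Gamma> above each state, whose second component is an
  admissible action.\<close>

lemma selector_exists:
  obtains \<phi> where "\<phi> \<in> universal MX \<rightarrow>\<^sub>M MA" "\<And>x. x \<in> X \<Longrightarrow> \<phi> x \<in> Adm x"
proof -
  obtain x0 where "x0 \<in> X" using X_nonempty by blast
  then have "\<Gamma> \<noteq> {}" using Adm by (auto simp: \<Gamma>_def)
  then obtain g :: "(nat \<Rightarrow> nat) \<Rightarrow> 'x \<times> 'a" where g: "continuous_on UNIV g" "range g = \<Gamma>"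
    using analytic_\<Gamma> unfolding analytic_def by blast
  have f: "continuous_on UNIV (\<lambda>\<sigma>. fst (g \<sigma>))" by (intro continuous_on_fst g)
  define \<phi> where "\<phi> x = snd (g (lex_select (\<lambda>\<sigma>. fst (g \<sigma>)) x))" for x
  have mem: "(x, \<phi> x) \<in> \<Gamma>" if x: "x \<in> X" for x
  proof -
    obtain a where "(x, a) \<in> \<Gamma>" using Adm[OF x] x by (auto simp: \<Gamma>_def)
    then have "x \<in> range (\<lambda>\<sigma>. fst (g \<sigma>))" using g(2) by (metis fst_conv rangeE rangeI)
    then have "fst (g (lex_select (\<lambda>\<sigma>. fst (g \<sigma>)) x)) = x" by (rule lex_select_section[OF f])
    then show ?thesis using g(2) unfolding \<phi>_def by (metis prod.collapse rangeI)
  qed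
  have sg: "(\<lambda>\<sigma>. snd (g \<sigma>)) \<in> borel \<rightarrow>\<^sub>M borel"
    by (intro borel_measurable_continuous_onI continuous_on_snd g)
  have "\<phi> \<in> universal MX \<rightarrow>\<^sub>M borel"
    unfolding \<phi>_def by (rule measurable_compose[OF lex_select_universal[OF f X] sg])
  then have "\<phi> \<in> universal MX \<rightarrow>\<^sub>M MA"
    by (rule measurable_borel_onI) (use mem \<Gamma>_subset in auto)
  then show thesis using mem that unfolding \<Gamma>_def by blast
qed

lemma AE_action_in_graph:
  assumes p: "p \<in> space (prob_algebra MT)"
    and B: "B \<in> sets MXA"
  shows "(AE \<omega> in p. \<omega> n \<in> B) \<longleftrightarrow> (AE z in action_law n p. (snd (fst z), snd z) \<in> B)"
proof -
  have f: "(\<lambda>\<omega>. (history_of n \<omega>, snd (\<omega> n))) \<in> p \<rightarrow>\<^sub>M MH n \<Otimes>\<^sub>M MA"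
    unfolding measurable_cong_sets[OF sets_prob_algebra_cong[OF p] refl] by (rule measurable_history_action)
  have "(\<lambda>z. (snd (fst z), snd z)) -` B \<inter> space (MH n \<Otimes>\<^sub>M MA) \<in> sets (MH n \<Otimes>\<^sub>M MA)"
    using measurable_sets[OF measurable_hist_action B] by (simp add: split_beta')
  then have "{z \<in> space (MH n \<Otimes>\<^sub>M MA). (snd (fst z), snd z) \<in> B} \<in> sets (MH n \<Otimes>\<^sub>M MA)"
    by (simp add: vimage_def Int_def conj_commute)
  moreover have "snd (history_of n \<omega>) = fst (\<omega> n)" for \<omega> :: "nat \<Rightarrow> 'x \<times> 'a" by (simp add: history_of_def)
  ultimately show ?thesis
    unfolding action_law_def using AE_distr_iff[OF f] by simp
qed

end

section \<open>Policies that depend on a view of the history\<close>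

locale mdp_view = mdp X A q Adm
  for X :: "'x::polish_space set" and A :: "'a::polish_space set" and q Adm +
  fixes view :: "nat \<Rightarrow> ('x, 'a) history \<Rightarrow> ('x, 'a) history"
    and W :: "nat \<Rightarrow> ('x, 'a) history set"
    and w :: "nat \<Rightarrow> nat pmf"
    and sec :: "nat \<Rightarrow> ('x, 'a) history \<Rightarrow> ('x, 'a) history"
  assumes W_borel: "W n \<in> sets borel" and W_nonempty: "W n \<noteq> {}"
    and view: "m \<in> set_pmf (w n) \<Longrightarrow> view m \<in> borel_on (histories X A m) \<rightarrow>\<^sub>M borel_on (W n)"
    and w_self: "n \<in> set_pmf (w n)"
    and w_class: "m \<in> set_pmf (w n) \<Longrightarrow> w m = w n \<and> W m = W n"
    and snd_view: "h \<in> histories X A n \<Longrightarrow> snd (view n h) = snd h"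
    and W_snd: "v \<in> W n \<Longrightarrow> snd v \<in> X"
    and sec: "sec n \<in> borel_on (W n) \<rightarrow>\<^sub>M borel_on (histories X A n)"
    and view_sec: "v \<in> W n \<Longrightarrow> view n (sec n v) = v"
begin

text \<open>A view extracts the part of the history on which the action may depend; the kernels at the
  times in the support of \<open>w n\<close> have to agree as functions of the view.  The identity view with
  unit masses gives all policies, the current state with unit masses the Markov policies, and the
  current state with a weight of full support the stationary policies.\<close>

abbreviation "MW n \<equiv> borel_on (W n)"

text \<open>Indices outside the support are sent into it, so that \<open>view_law\<close> is a
  kernel on all of \<open>nat\<close>; \<open>w n\<close> gives them no mass.\<close>

definition rep :: "nat \<Rightarrow> nat \<Rightarrow> nat" where
  "rep n m = (if m \<in> set_pmf (w n) then m else (SOME j. j \<in> set_pmf (w n)))"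

lemma rep_in: "rep n m \<in> set_pmf (w n)"
  unfolding rep_def using w_self[of n] by (auto intro: someI)

definition view_law :: "nat \<Rightarrow> (nat \<Rightarrow> 'x \<times> 'a) measure \<Rightarrow> nat \<Rightarrow> (('x, 'a) history \<times> 'a) measure" where
  "view_law n p m = distr (action_law (rep n m) p) (MW n \<Otimes>\<^sub>M MA) (\<lambda>z. (view (rep n m) (fst z), snd z))"

definition mixture :: "nat \<Rightarrow> (nat \<Rightarrow> 'x \<times> 'a) measure \<Rightarrow> (('x, 'a) history \<times> 'a) measure" where
  "mixture n p = measure_pmf (w n) \<bind> view_law n p"

definition view_kernel :: "nat \<Rightarrow> (nat \<Rightarrow> 'x \<times> 'a) measure \<Rightarrow> ('x, 'a) history \<Rightarrow> 'a measure" where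
  "view_kernel n p = disintegration (MW n) MA (mixture n p)"

definition hist_kernel :: "(nat \<Rightarrow> 'x \<times> 'a) measure \<Rightarrow> nat \<Rightarrow> ('x, 'a) history \<Rightarrow> 'a measure" where
  "hist_kernel p n h = view_kernel n p (view n h)"

lemma real_retract_W: "real_retract (MW n)"
  by (rule real_retract_polish[OF W_borel W_nonempty])

lemma measurable_view_action:
  "m \<in> set_pmf (w n) \<Longrightarrow> (\<lambda>z. (view m (fst z), snd z)) \<in> MH m \<Otimes>\<^sub>M MA \<rightarrow>\<^sub>M MW n \<Otimes>\<^sub>M MA"
  by (intro measurable_Pair measurable_compose[OF measurable_fst view] measurable_snd)

lemma measurable_view_law: "(\<lambda>p. view_law n p m) \<in> prob_algebra MT \<rightarrow>\<^sub>M prob_algebra (MW n \<Otimes>\<^sub>M MA)"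
  unfolding view_law_def
  by (rule measurable_compose[OF measurable_action_law measurable_distr_prob_space[OF measurable_view_action[OF rep_in]]])

lemma measurable_view_law_index:
  "p \<in> space (prob_algebra MT) \<Longrightarrow> view_law n p \<in> count_space UNIV \<rightarrow>\<^sub>M prob_algebra (MW n \<Otimes>\<^sub>M MA)"
  using measurable_space[OF measurable_view_law] by auto

lemma measurable_mixture: "mixture n \<in> prob_algebra MT \<rightarrow>\<^sub>M prob_algebra (MW n \<Otimes>\<^sub>M MA)"
  unfolding mixture_def
proof (rule measurable_bind_prob_space2[where N="count_space UNIV"])
  show "(\<lambda>(p, m). view_law n p m) \<in> prob_algebra MT \<Otimes>\<^sub>M count_space UNIV \<rightarrow>\<^sub>M prob_algebra (MW n \<Otimes>\<^sub>M MA)"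
    unfolding split_beta'
    by (rule measurable_compose_countable'[where f="\<lambda>m z. view_law n (fst z) m" and g=snd and I=UNIV])
       (auto intro: measurable_compose[OF measurable_fst measurable_view_law])
qed (simp add: pmf_in_prob_algebra)

lemma mixture_in: "p \<in> space (prob_algebra MT) \<Longrightarrow> mixture n p \<in> space (prob_algebra (MW n \<Otimes>\<^sub>M MA))"
  by (rule measurable_space[OF measurable_mixture])

text \<open>Equality is literal, as needed later: a policy of the class has to use one kernel at all
  its times and at every history.\<close>

lemma mixture_class:
  assumes "m \<in> set_pmf (w n)"
  shows "mixture m p = mixture n p" "view_kernel m p = view_kernel n p"
proof -
  have "w m = w n" "W m = W n" using w_class[OF assms] by auto
  moreover have "rep m = rep n" unfolding rep_def[abs_def] \<open>w m = w n\<close> ..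
  ultimately show "mixture m p = mixture n p"
    unfolding mixture_def view_law_def[abs_def] by simp
  then show "view_kernel m p = view_kernel n p"
    unfolding view_kernel_def using \<open>W m = W n\<close> by simp
qed

lemma measurable_hist_kernel_joint:
  "(\<lambda>(p, h). hist_kernel p n h) \<in> prob_algebra MT \<Otimes>\<^sub>M MH n \<rightarrow>\<^sub>M prob_algebra MA"
proof -
  have "(\<lambda>z. (mixture n (fst z), view n (snd z))) \<in> prob_algebra MT \<Otimes>\<^sub>M MH n \<rightarrow>\<^sub>M
      prob_algebra (MW n \<Otimes>\<^sub>M MA) \<Otimes>\<^sub>M MW n"
    by (intro measurable_Pair measurable_compose[OF measurable_fst measurable_mixture]
        measurable_compose[OF measurable_snd view[OF w_self]])
  from measurable_compose[OF this measurable_disintegration_kernel[OF real_retract_W real_retract_A]]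
  show ?thesis by (simp add: hist_kernel_def view_kernel_def split_beta')
qed

lemma measurable_view_kernel:
  assumes "p \<in> space (prob_algebra MT)"
  shows "view_kernel n p \<in> MW n \<rightarrow>\<^sub>M prob_algebra MA"
  unfolding view_kernel_def
  using measurable_Pair2[OF measurable_disintegration_kernel[OF real_retract_W real_retract_A] mixture_in[OF assms]]
  by simp

lemma measurable_hist_kernel:
  "p \<in> space (prob_algebra MT) \<Longrightarrow> hist_kernel p n \<in> MH n \<rightarrow>\<^sub>M prob_algebra MA"
  unfolding hist_kernel_def by (rule measurable_compose[OF view[OF w_self] measurable_view_kernel])

definition view_marginal :: "nat \<Rightarrow> (nat \<Rightarrow> 'x \<times> 'a) measure \<Rightarrow> ('x, 'a) history measure" where
  "view_marginal n p = distr (mixture n p) (MW n) fst"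

lemma view_marginal_in:
  "p \<in> space (prob_algebra MT) \<Longrightarrow> view_marginal n p \<in> space (prob_algebra (MW n))"
  unfolding view_marginal_def by (rule distr_in_prob_algebra[OF mixture_in]) simp_all

lemma mixture_eq_kernel_prod:
  "p \<in> space (prob_algebra MT) \<Longrightarrow>
    kernel_prod (MW n) MA (view_marginal n p) (view_kernel n p) = mixture n p"
  unfolding view_marginal_def view_kernel_def
  by (rule kernel_prod_disintegration[OF real_retract_W real_retract_A mixture_in])

text \<open>Every time in the support has positive mass, so what is null for the mixture is null at
  that time.\<close>

lemma AE_mixtureD:
  assumes p: "p \<in> space (prob_algebra MT)" and ae: "AE z in mixture n p. P z" and m: "m \<in> set_pmf (w n)"
  shows "AE z in action_law m p. P (view m (fst z), snd z)"
proof -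
  have "AE j in measure_pmf (w n). AE z in view_law n p j. P z"
    by (rule AE_bindD[OF pmf_in_prob_algebra measurable_view_law_index[OF p]]) (rule ae[unfolded mixture_def])
  then have "AE z in view_law n p m. P z" using m by (simp add: AE_measure_pmf_iff)
  then have *: "AE z in distr (action_law m p) (MW n \<Otimes>\<^sub>M MA) (\<lambda>z. (view m (fst z), snd z)). P z"
    unfolding view_law_def rep_def if_P[OF m] .
  have "(\<lambda>z. (view m (fst z), snd z)) \<in> action_law m p \<rightarrow>\<^sub>M MW n \<Otimes>\<^sub>M MA"
    unfolding measurable_cong_sets[OF sets_prob_algebra_cong[OF action_law_in[OF p]] refl]
    by (rule measurable_view_action[OF m])
  from AE_distrD[OF this *] show ?thesis .
qed

text \<open>For a nonmeasurable P, an almost sure statement cannot be passed from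
  \<open>action_law\<close> to its marginal by the rule for image measures. Disintegrating
  \<open>action_law\<close> leaves, for almost every h, a statement constant in the action.\<close>

lemma AE_view_marginalD:
  assumes p: "p \<in> space (prob_algebra MT)" and ae: "AE v in view_marginal n p. P v" and m: "m \<in> set_pmf (w n)"
  shows "AE h in law m p. P (view m h)"
proof -
  have f: "fst \<in> mixture n p \<rightarrow>\<^sub>M MW n"
    unfolding measurable_cong_sets[OF sets_prob_algebra_cong[OF mixture_in[OF p]] refl] by simp
  have "AE z in mixture n p. P (fst z)"
    using ae unfolding view_marginal_def by (rule AE_distrD[OF f])
  from AE_mixtureD[OF p this m] have *: "AE z in action_law m p. P (view m (fst z))" by simp
  let ?k = "disintegration (MH m) MA (action_law m p)"
  have eq: "kernel_prod (MH m) MA (law m p) ?k = action_law m p"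
    using kernel_prod_disintegration[OF real_retract_H real_retract_A action_law_in[OF p]]
    by (simp add: distr_fst_action_law[OF p])
  have k: "?k \<in> MH m \<rightarrow>\<^sub>M prob_algebra MA"
    using measurable_Pair2[OF measurable_disintegration_kernel[OF real_retract_H real_retract_A] action_law_in[OF p]] by simp
  have "AE h in law m p. AE z in distr (?k h) (MH m \<Otimes>\<^sub>M MA) (Pair h). P (view m (fst z))"
    by (rule AE_bindD[OF law_in[OF p] measurable_kernel_prod_slice[OF k]])
       (unfold eq[unfolded kernel_prod_def], rule *)
  then show ?thesis
    using AE_space
  proof eventually_elim
    case (elim h)
    then have h: "h \<in> space (MH m)" by (simp add: space_prob_algebra_cong[OF law_in[OF p]])
    interpret prob_space "?k h" by (rule prob_algebra_prob_space[OF measurable_space[OF k h]])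
    have "AE a in ?k h. P (view m h)"
      using AE_distrD[OF measurable_Pair_slice[OF k h] elim(1)] by simp
    then show ?case by (simp add: AE_const)
  qed
qed

text \<open>By uniqueness of the disintegration of the mixture.\<close>

lemma AE_hist_kernel_eq:
  assumes p: "p \<in> space (prob_algebra MT)" and gen: "generated p k"
    and k: "\<And>n. k n \<in> MH n \<rightarrow>\<^sub>M prob_algebra MA"
    and \<kappa>: "\<kappa> \<in> MW n \<rightarrow>\<^sub>M prob_algebra MA"
    and eq: "\<And>m. m \<in> set_pmf (w n) \<Longrightarrow> AE h in law m p. k m h = \<kappa> (view m h)"
  shows "AE h in law n p. k n h = hist_kernel p n h"
proof -
  define \<nu> where "\<nu> m = distr (law (rep n m) p) (MW n) (view (rep n m))" for m
  have \<nu>: "\<nu> \<in> count_space UNIV \<rightarrow>\<^sub>M prob_algebra (MW n)"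
    unfolding \<nu>_def using distr_in_prob_algebra[OF law_in[OF p] view[OF rep_in]] by auto
  have vl: "view_law n p m = kernel_prod (MW n) MA (\<nu> m) \<kappa>" for m
  proof -
    let ?r = "rep n m"
    have \<kappa>v: "(\<lambda>h. \<kappa> (view ?r h)) \<in> MH ?r \<rightarrow>\<^sub>M prob_algebra MA" by (rule measurable_compose[OF view[OF rep_in] \<kappa>])
    have "action_law ?r p = kernel_prod (MH ?r) MA (law ?r p) (k ?r)"
      by (rule generated_action_law[OF p k gen])
    also have "\<dots> = kernel_prod (MH ?r) MA (law ?r p) (\<lambda>h. \<kappa> (view ?r h))"
      by (rule kernel_prod_cong_AE[OF law_in[OF p] k \<kappa>v eq[OF rep_in]])
    finally show ?thesis
      unfolding view_law_def \<nu>_def using distr_kernel_prod[OF law_in[OF p] view[OF rep_in] \<kappa>] by simp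
  qed
  have b: "measure_pmf (w n) \<bind> \<nu> \<in> space (prob_algebra (MW n))"
    by (rule bind_in_prob_algebra[OF pmf_in_prob_algebra \<nu>])
  have mix: "mixture n p = kernel_prod (MW n) MA (measure_pmf (w n) \<bind> \<nu>) \<kappa>"
    unfolding mixture_def vl[abs_def] kernel_prod_bind[OF pmf_in_prob_algebra \<nu> \<kappa>] ..
  then have marg: "view_marginal n p = measure_pmf (w n) \<bind> \<nu>"
    unfolding view_marginal_def using distr_fst_kernel_prod[OF b \<kappa>] by simp
  have "AE v in view_marginal n p. \<kappa> v = view_kernel n p v"
    by (rule kernel_prod_unique[OF real_retract_A view_marginal_in[OF p] \<kappa> measurable_view_kernel[OF p]])
       (subst mixture_eq_kernel_prod[OF p], subst marg, rule mix[symmetric])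
  from AE_view_marginalD[OF p this w_self] eq[OF w_self]
  show ?thesis by eventually_elim (simp add: hist_kernel_def)
qed

lemma generated_hist_kernel:
  assumes p: "p \<in> space (prob_algebra MT)" and gen: "generated p k"
    and k: "\<And>n. k n \<in> MH n \<rightarrow>\<^sub>M prob_algebra MA"
    and eq: "\<And>n. AE h in law n p. k n h = hist_kernel p n h"
  shows "generated p (hist_kernel p)"
proof (rule generatedI)
  show "law (Suc n) p = action_law n p \<bind> trans n" for n by (rule law_Suc_eq_trans[OF p k gen])
  show "action_law n p = kernel_prod (MH n) MA (law n p) (hist_kernel p n)" for n
    using generated_action_law[OF p k gen] kernel_prod_cong_AE[OF law_in[OF p] k measurable_hist_kernel[OF p] eq] by simp
qed

end

lemma AE_kernel_prodD:
  assumes m: "m \<in> space (prob_algebra M)" and k: "k \<in> M \<rightarrow>\<^sub>M prob_algebra N"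
    and ae: "AE z in kernel_prod M N m k. P z"
  shows "AE x in m. AE y in k x. P (x, y)"
proof -
  have "AE x in m. AE z in distr (k x) (M \<Otimes>\<^sub>M N) (Pair x). P z"
    by (rule AE_bindD[OF m measurable_kernel_prod_slice[OF k] ae[unfolded kernel_prod_def]])
  then show ?thesis using AE_space
  proof eventually_elim
    case (elim x)
    then have "x \<in> space M" by (simp add: space_prob_algebra_cong[OF m])
    from AE_distrD[OF measurable_Pair_slice[OF k this] elim(1)] show ?case .
  qed
qed

text \<open>Passing from sections to the joint law needs measurability. The condition is weakened to
  a Borel set E above R and then strengthened to a Borel set L below R, which differ by a null set
  of the image measure.\<close>

lemma AE_kernel_prod_analyticI:
  fixes R :: "'c::metric_space set"
  assumes m: "m \<in> space (prob_algebra M)" and k: "k \<in> M \<rightarrow>\<^sub>M prob_algebra N"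
    and g: "g \<in> M \<Otimes>\<^sub>M N \<rightarrow>\<^sub>M borel_on S" and S: "S \<in> sets borel" and R: "analytic R" "R \<subseteq> S"
    and ae: "AE x in m. AE y in k x. g (x, y) \<in> R"
  shows "AE z in kernel_prod M N m k. g z \<in> R"
proof -
  note kp = kernel_prod_in_prob_algebra[OF m k]
  have g': "g \<in> kernel_prod M N m k \<rightarrow>\<^sub>M borel_on S"
    unfolding measurable_cong_sets[OF sets_prob_algebra_cong[OF kp] refl] by (rule g)
  obtain L E where "L \<in> sets (borel_on S)" and LE: "E \<in> sets (borel_on S)" "L \<subseteq> R" "R \<inter> S \<subseteq> E"
    "AE y in distr (kernel_prod M N m k) (borel_on S) g. y \<in> E \<longrightarrow> y \<in> L"
    using analytic_AE_borel_bounds[OF R(1) S distr_in_prob_algebra[OF kp g]] .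
  have "Measurable.pred (M \<Otimes>\<^sub>M N) (\<lambda>z. g z \<in> E)" by (rule pred_sets2[OF LE(1) g])
  moreover have "AE x in m. AE y in k x. g (x, y) \<in> E"
    using ae by eventually_elim (erule eventually_mono, use LE(3) R(2) in blast)
  ultimately have "AE z in kernel_prod M N m k. g z \<in> E" by (simp add: AE_kernel_prod[OF m k])
  then show ?thesis using AE_distrD[OF g' LE(4)] by eventually_elim (use LE(2) in blast)
qed

lemma sets_Collect_AE_prob_algebra:
  assumes L: "L \<in> M \<rightarrow>\<^sub>M prob_algebra N" and P: "Measurable.pred (M \<Otimes>\<^sub>M N) (\<lambda>(x, y). P x y)"
  shows "{x\<in>space M. AE y in L x. P x y} \<in> sets M"
proof -
  have sec: "{y\<in>space N. P x y} \<in> sets N" if x: "x \<in> space M" for x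
    using measurable_compose[OF measurable_Pair1'[OF x] P] by simp
  have "(SIGMA x:space M. {y\<in>space N. P x y}) = {z\<in>space (M \<Otimes>\<^sub>M N). (\<lambda>(x, y). P x y) z}"
    by (auto simp: space_pair_measure)
  then have "(\<lambda>x. emeasure (L x) {y\<in>space N. P x y}) \<in> borel_measurable M"
    using P by (intro emeasure_measurable_subprob_algebra2[OF _ measurable_prob_algebraD[OF L]]) simp
  then have "{x\<in>space M. emeasure (L x) {y\<in>space N. P x y} = 1} \<in> sets M" by measurable
  also have "{x\<in>space M. emeasure (L x) {y\<in>space N. P x y} = 1} = {x\<in>space M. AE y in L x. P x y}"
  proof (intro Collect_cong conj_cong refl)
    fix x assume x: "x \<in> space M"
    note Lx = measurable_space[OF L x]
    interpret prob_space "L x" by (rule prob_algebra_prob_space[OF Lx])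
    have "Measurable.pred (L x) (P x)"
      using sec[OF x] by (simp add: pred_def space_prob_algebra_cong[OF Lx] sets_prob_algebra_cong[OF Lx])
    from AE_iff_emeasure_eq_1[OF this]
    show "emeasure (L x) {y\<in>space N. P x y} = 1 \<longleftrightarrow> (AE y in L x. P x y)"
      by (simp add: space_prob_algebra_cong[OF Lx])
  qed
  finally show ?thesis .
qed

section \<open>From policies to processes\<close>

context mdp
begin

text \<open>Which Borel version of the n-th kernel is correct depends on the law of h_n, and this
  depends on the earlier versions. So laws and versions are built by one recursion before the
  process is constructed.\<close>

lemma policy_realization:
  assumes \<mu>: "\<mu> \<in> policies X A Adm" and p0: "p0 \<in> space (prob_algebra MX)"
  obtains p k where "p \<in> space (prob_algebra MT)" "law 0 p = initial p0" "generated p k"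
    "\<And>n. k n \<in> MH n \<rightarrow>\<^sub>M prob_algebra MA" "\<And>n. AE h in law n p. \<mu> n h = k n h"
proof -
  have \<mu>m: "\<mu> n \<in> universal (MH n) \<rightarrow>\<^sub>M prob_algebra MA" for n using \<mu> unfolding policies_def by blast
  define version where "version n m = (SOME k. k \<in> MH n \<rightarrow>\<^sub>M prob_algebra MA \<and> (AE h in m. \<mu> n h = k h))" for n m
  have version: "version n m \<in> MH n \<rightarrow>\<^sub>M prob_algebra MA \<and> (AE h in m. \<mu> n h = version n m h)"
    if m: "m \<in> space (prob_algebra (MH n))" for n m
  proof -
    have "\<exists>k. k \<in> MH n \<rightarrow>\<^sub>M prob_algebra MA \<and> (AE h in m. \<mu> n h = k h)"
      using universal_kernel_borel_version[OF real_retract_A \<mu>m m] by blast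
    then show ?thesis unfolding version_def by (rule someI_ex)
  qed
  define m where "m = rec_nat (initial p0) (\<lambda>n m. step n (version n m) m)"
  define k where "k n = version n (m n)" for n
  have m0: "m 0 = initial p0" and mS: "m (Suc n) = step n (k n) (m n)" for n by (simp_all add: m_def k_def)
  have m: "m n \<in> space (prob_algebra (MH n))" for n
  proof (induction n)
    case 0
    show ?case unfolding m0 initial_def by (rule distr_in_prob_algebra[OF p0 measurable_initial_history])
  next
    case (Suc n)
    then show ?case unfolding mS by (intro step_in) (simp_all add: k_def version)
  qed
  have k: "k n \<in> MH n \<rightarrow>\<^sub>M prob_algebra MA" for n using version[OF m] by (simp add: k_def)
  obtain p where p: "p \<in> space (prob_algebra MT)" "law 0 p = initial p0" "generated p k"
    using trajectory_measure_exists[OF p0 k] by blast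
  have law_p: "law n p = m n" for n
    by (induction n) (use p in \<open>simp_all add: m0 mS generated_def\<close>)
  have "AE h in law n p. \<mu> n h = k n h" for n
    unfolding law_p k_def using version[OF m] by blast
  with p k show thesis using that by blast
qed

lemma policy_AE_admissible:
  assumes \<mu>: "\<mu> \<in> policies X A Adm" and h: "h \<in> histories X A n"
  shows "AE a in \<mu> n h. (snd h, a) \<in> \<Gamma>"
proof -
  have "\<mu> n \<in> universal (MH n) \<rightarrow>\<^sub>M prob_algebra MA" using \<mu> unfolding policies_def by blast
  from measurable_space[OF this] h have m: "\<mu> n h \<in> space (prob_algebra MA)" by simp
  have x: "snd h \<in> X" using h by (simp add: histories_iff)
  have "emeasure (completion (\<mu> n h)) (Adm (snd h)) = 1" using \<mu> h unfolding policies_def by blast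
  moreover have "Adm (snd h) \<subseteq> space (\<mu> n h)" using Adm[OF x] by (simp add: space_prob_algebra_cong[OF m])
  ultimately show ?thesis
    using completion_prob_one_iff_AE[OF prob_algebra_prob_space[OF m]] x by (simp add: \<Gamma>_def)
qed

definition \<Gamma>\<omega> :: "(nat \<Rightarrow> 'x \<times> 'a) set" where "\<Gamma>\<omega> = {\<omega>. \<forall>n. \<omega> n \<in> \<Gamma>}"

lemma \<Gamma>\<omega>_subset: "\<Gamma>\<omega> \<subseteq> trajectories X A"
  using \<Gamma>_subset by (auto simp: \<Gamma>\<omega>_def trajectories_def)

lemma AE_\<Gamma>\<omega>_iff: "(AE \<omega> in p. \<omega> \<in> \<Gamma>\<omega>) \<longleftrightarrow> (\<forall>n. AE \<omega> in p. \<omega> n \<in> \<Gamma>)"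
  by (simp add: \<Gamma>\<omega>_def AE_all_countable)

lemma analytic_\<Gamma>\<omega>: "analytic \<Gamma>\<omega>"
proof -
  obtain x where "x \<in> X" using X_nonempty by blast
  then have "\<Gamma> \<noteq> {}" using Adm by (auto simp: \<Gamma>_def)
  then obtain g :: "(nat \<Rightarrow> nat) \<Rightarrow> 'x \<times> 'a" where g: "continuous_on UNIV g" "range g = \<Gamma>"
    using analytic_\<Gamma> unfolding analytic_def by blast
  have c: "continuous_on UNIV (\<lambda>(\<tau> :: nat \<Rightarrow> nat \<Rightarrow> nat) n. g (\<tau> n))"
    by (intro continuous_on_coordinatewise_then_product continuous_on_compose2[OF g(1)]
        continuous_on_product_coordinates) auto
  have "analytic (UNIV :: (nat \<Rightarrow> nat \<Rightarrow> nat) set)" by (rule analytic_closed) simp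
  from analytic_continuous_image[OF this c] have "analytic (range (\<lambda>(\<tau> :: nat \<Rightarrow> nat \<Rightarrow> nat) n. g (\<tau> n)))" .
  also have "range (\<lambda>(\<tau> :: nat \<Rightarrow> nat \<Rightarrow> nat) n. g (\<tau> n)) = \<Gamma>\<omega>"
  proof (intro equalityI subsetI)
    fix \<omega> assume "\<omega> \<in> \<Gamma>\<omega>"
    then have "\<forall>n. \<exists>\<sigma>. \<omega> n = g \<sigma>" using g(2) by (auto simp: \<Gamma>\<omega>_def)
    then obtain \<tau> where "\<And>n. \<omega> n = g (\<tau> n)" by metis
    then have "\<omega> = (\<lambda>n. g (\<tau> n))" by blast
    then show "\<omega> \<in> range (\<lambda>(\<tau> :: nat \<Rightarrow> nat \<Rightarrow> nat) n. g (\<tau> n))" by blast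
  qed (use g(2) in \<open>auto simp: \<Gamma>\<omega>_def\<close>)
  finally show ?thesis .
qed

lemma action_law_AE_\<Gamma>:
  assumes p: "p \<in> space (prob_algebra MT)" and gen: "generated p k"
    and k: "\<And>n. k n \<in> MH n \<rightarrow>\<^sub>M prob_algebra MA"
    and ae: "AE h in law n p. AE a in k n h. (snd h, a) \<in> \<Gamma>"
  shows "AE \<omega> in p. \<omega> n \<in> \<Gamma>"
proof -
  have "AE z in action_law n p. (\<lambda>(h, a). (snd h, a)) z \<in> \<Gamma>"
    unfolding generated_action_law[OF p k gen]
    by (rule AE_kernel_prod_analyticI[OF law_in[OF p] k measurable_hist_action XA_borel analytic_\<Gamma> \<Gamma>_subset])
       (use ae in simp)
  then have *: "AE z in distr p (MH n \<Otimes>\<^sub>M MA) (\<lambda>\<omega>. (history_of n \<omega>, snd (\<omega> n))). (\<lambda>(h, a). (snd h, a)) z \<in> \<Gamma>"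
    unfolding action_law_def .
  have "(\<lambda>\<omega>. (history_of n \<omega>, snd (\<omega> n))) \<in> p \<rightarrow>\<^sub>M MH n \<Otimes>\<^sub>M MA"
    unfolding measurable_cong_sets[OF sets_prob_algebra_cong[OF p] refl] by (rule measurable_history_action)
  from AE_distrD[OF this *] show ?thesis by (simp add: history_of_def)
qed

lemma initial_of_law:
  assumes p: "p \<in> space (prob_algebra MT)"
  shows "initial (distr (law 0 p) MX snd) = law 0 p"
proof -
  have "(\<lambda>_. undefined, snd h) = h" if "h \<in> space (MH 0)" for h :: "('x, 'a) history"
    using that by (simp add: histories_iff prod_eq_iff fun_eq_iff)
  then have "distr (law 0 p) (MH 0) (\<lambda>h. (\<lambda>_. undefined, snd h)) = law 0 p"
    by (rule distr_id_prob_algebra[OF law_in[OF p]])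
  then show ?thesis
    unfolding initial_def distr_distr_prob_algebra[OF law_in[OF p] measurable_hist_state measurable_initial_history] .
qed

lemma AE_return_singleton:
  assumes "b \<in> A" "P b"
  shows "AE a in return MA b. P a"
proof -
  have "A \<inter> {b} \<in> sets MA" unfolding sets_restrict_space by (rule imageI) simp
  moreover have "{a \<in> space MA. a \<in> {b}} = A \<inter> {b}" by auto
  ultimately have "Measurable.pred MA (\<lambda>a. a \<in> {b})" by (simp add: pred_def)
  then have "AE a in return MA b. a \<in> {b}" using assms(1) AE_return[of b MA "\<lambda>a. a \<in> {b}"] by simp
  then show ?thesis by eventually_elim (use assms(2) in simp)
qed

end

section \<open>Characterization of strategic measures\<close>

context mdp_view
begin

definition view_policies :: "('x, 'a) policy set" where
  "view_policies = {\<mu> \<in> policies X A Adm.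
     \<exists>\<kappa>. \<forall>n. \<forall>m\<in>set_pmf (w n). \<forall>h\<in>histories X A m. \<mu> m h = \<kappa> n (view m h)}"

lemma AE_mixtureI:
  assumes p: "p \<in> space (prob_algebra MT)" and B: "B \<in> sets (MW n \<Otimes>\<^sub>M MA)"
    and ae: "\<And>m. m \<in> set_pmf (w n) \<Longrightarrow> AE z in action_law m p. (view m (fst z), snd z) \<in> B"
  shows "AE z in mixture n p. z \<in> B"
proof -
  have "AE z in view_law n p j. z \<in> B" for j
  proof -
    have f: "(\<lambda>z. (view (rep n j) (fst z), snd z)) \<in> action_law (rep n j) p \<rightarrow>\<^sub>M MW n \<Otimes>\<^sub>M MA"
      unfolding measurable_cong_sets[OF sets_prob_algebra_cong[OF action_law_in[OF p]] refl]
      by (rule measurable_view_action[OF rep_in])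
    have "{z \<in> space (MW n \<Otimes>\<^sub>M MA). z \<in> B} \<in> sets (MW n \<Otimes>\<^sub>M MA)" using B by measurable
    from AE_distr_iff[OF f this] ae[OF rep_in] show ?thesis unfolding view_law_def by blast
  qed
  moreover have "Measurable.pred (MW n \<Otimes>\<^sub>M MA) (\<lambda>z. z \<in> B)" using B by measurable
  ultimately show ?thesis
    unfolding mixture_def using AE_bind_prob_algebra[OF pmf_in_prob_algebra measurable_view_law_index[OF p]]
    by simp
qed

lemma AE_view_marginalI:
  assumes p: "p \<in> space (prob_algebra MT)" and B: "B \<in> sets (MW n)"
    and ae: "\<And>m. m \<in> set_pmf (w n) \<Longrightarrow> AE h in law m p. view m h \<in> B"
  shows "AE v in view_marginal n p. v \<in> B"
proof -
  have f: "fst \<in> mixture n p \<rightarrow>\<^sub>M MW n"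
    unfolding measurable_cong_sets[OF sets_prob_algebra_cong[OF mixture_in[OF p]] refl] by simp
  have sp: "space (mixture n p) = W n \<times> A"
    using space_prob_algebra_cong[OF mixture_in[OF p]] by (simp add: space_pair_measure)
  have "AE z in mixture n p. z \<in> B \<times> A"
  proof (rule AE_mixtureI[OF p])
    show "B \<times> A \<in> sets (MW n \<Otimes>\<^sub>M MA)" using B sets.top[of MA] by (intro pair_measureI) simp_all
    fix m assume m: "m \<in> set_pmf (w n)"
    have f: "fst \<in> action_law m p \<rightarrow>\<^sub>M MH m"
      unfolding measurable_cong_sets[OF sets_prob_algebra_cong[OF action_law_in[OF p]] refl] by simp
    have "AE h in distr (action_law m p) (MH m) fst. view m h \<in> B"
      unfolding distr_fst_action_law[OF p] by (rule ae[OF m])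
    from AE_distrD[OF f this] AE_space
    show "AE z in action_law m p. (view m (fst z), snd z) \<in> B \<times> A"
      by eventually_elim (auto simp: space_prob_algebra_cong[OF action_law_in[OF p]] space_pair_measure)
  qed
  then have "AE z in mixture n p. fst z \<in> B" by eventually_elim auto
  moreover have "{v \<in> space (MW n). v \<in> B} \<in> sets (MW n)" using B by measurable
  ultimately show ?thesis unfolding view_marginal_def using AE_distr_iff[OF f, of "\<lambda>v. v \<in> B"] by blast
qed

text \<open>Being in \<Gamma> is known at each time. It passes to the mixture through a Borel hull
  of \<Gamma>, comes back to \<Gamma> through a Borel core of equal mixture measure, and is then
  split by the disintegration.\<close>

lemma AE_view_kernel_\<Gamma>:
  assumes p: "p \<in> space (prob_algebra MT)" and \<Gamma>: "\<And>n. AE \<omega> in p. \<omega> n \<in> \<Gamma>"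
  shows "AE v in view_marginal n p. AE a in view_kernel n p v. (snd v, a) \<in> \<Gamma>"
proof -
  let ?g = "\<lambda>z :: ('x, 'a) history \<times> 'a. (snd (fst z), snd z)"
  have b: "(\<lambda>z. z) \<in> MW n \<rightarrow>\<^sub>M borel" by (rule measurable_borel_on_id)
  have "snd \<in> MW n \<rightarrow>\<^sub>M MX"
    using measurable_compose[OF b measurable_snd_borel] W_snd by (intro measurable_borel_onI) auto
  then have g1: "?g \<in> MW n \<Otimes>\<^sub>M MA \<rightarrow>\<^sub>M MX \<Otimes>\<^sub>M MA"
    by (intro measurable_Pair measurable_compose[OF measurable_fst] measurable_snd)
  have g: "?g \<in> MW n \<Otimes>\<^sub>M MA \<rightarrow>\<^sub>M MXA"
  proof (rule measurable_borel_onI)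
    show "?g \<in> MW n \<Otimes>\<^sub>M MA \<rightarrow>\<^sub>M borel"
      using measurable_compose[OF measurable_compose[OF g1 measurable_fst] measurable_borel_on_id]
        measurable_compose[OF measurable_compose[OF g1 measurable_snd] measurable_borel_on_id]
      by (intro measurable_Pair_borel) simp_all
  qed (use W_snd in \<open>auto simp: space_pair_measure\<close>)
  have g': "?g \<in> mixture n p \<rightarrow>\<^sub>M MXA"
    unfolding measurable_cong_sets[OF sets_prob_algebra_cong[OF mixture_in[OF p]] refl] by (rule g)
  obtain L E where "L \<in> sets MXA" and LE: "E \<in> sets MXA" "L \<subseteq> \<Gamma>" "\<Gamma> \<inter> (X \<times> A) \<subseteq> E"
    "AE y in distr (mixture n p) MXA ?g. y \<in> E \<longrightarrow> y \<in> L"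
    using analytic_AE_borel_bounds[OF analytic_\<Gamma> XA_borel distr_in_prob_algebra[OF mixture_in[OF p] g]] .
  let ?B = "?g -` E \<inter> space (MW n \<Otimes>\<^sub>M MA)"
  have "AE z in mixture n p. z \<in> ?B"
  proof (rule AE_mixtureI[OF p measurable_sets[OF g LE(1)]])
    fix m assume m: "m \<in> set_pmf (w n)"
    have "AE \<omega> in p. \<omega> m \<in> E" using \<Gamma>[of m] by eventually_elim (use LE(3) \<Gamma>_subset in blast)
    then have "AE z in action_law m p. ?g z \<in> E" using AE_action_in_graph[OF p LE(1)] by blast
    then show "AE z in action_law m p. (view m (fst z), snd z) \<in> ?B"
      using AE_space
    proof eventually_elim
      case (elim z)
      then have z: "z \<in> space (MH m \<Otimes>\<^sub>M MA)" by (simp add: space_prob_algebra_cong[OF action_law_in[OF p]])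
      then have "(view m (fst z), snd z) \<in> space (MW n \<Otimes>\<^sub>M MA)"
        by (rule measurable_space[OF measurable_view_action[OF m]])
      moreover have "snd (view m (fst z)) = snd (fst z)" using z by (intro snd_view) (auto simp: space_pair_measure)
      ultimately show ?case using elim(1) by simp
    qed
  qed
  then have "AE z in mixture n p. ?g z \<in> \<Gamma>"
    using AE_distrD[OF g' LE(4)] by eventually_elim (use LE(2) in auto)
  then have "AE z in kernel_prod (MW n) MA (view_marginal n p) (view_kernel n p). ?g z \<in> \<Gamma>"
    unfolding mixture_eq_kernel_prod[OF p] .
  from AE_kernel_prodD[OF view_marginal_in[OF p] measurable_view_kernel[OF p] this] show ?thesis by simp
qed

text \<open>The necessary conditions. Borel versions of the policy along its own process factor
  almost surely through the view, so uniqueness identifies them with the kernels computed from p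
  alone.\<close>

lemma measure_of_view_policy:
  assumes \<mu>: "\<mu> \<in> view_policies" and p0: "p0 \<in> space (prob_algebra MX)"
  shows "\<exists>p\<in>space (prob_algebra MT). strategic_measure X A q p0 \<mu> = p \<and> generated p (hist_kernel p) \<and>
    (AE \<omega> in p. \<omega> \<in> \<Gamma>\<omega>) \<and> (\<forall>n. AE h in law n p. \<mu> n h = hist_kernel p n h)"
proof -
  have \<mu>p: "\<mu> \<in> policies X A Adm" using \<mu> unfolding view_policies_def by blast
  have \<mu>m: "\<mu> n \<in> universal (MH n) \<rightarrow>\<^sub>M prob_algebra MA" for n using \<mu>p unfolding policies_def by blast
  obtain \<kappa> where \<kappa>: "\<And>n m h. m \<in> set_pmf (w n) \<Longrightarrow> h \<in> histories X A m \<Longrightarrow> \<mu> m h = \<kappa> n (view m h)"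
    using \<mu> unfolding view_policies_def by blast
  obtain p k where p: "p \<in> space (prob_algebra MT)" and init: "law 0 p = initial p0" and gen: "generated p k"
    and k: "\<And>n. k n \<in> MH n \<rightarrow>\<^sub>M prob_algebra MA" and ae: "\<And>n. AE h in law n p. \<mu> n h = k n h"
    by (rule policy_realization[OF \<mu>p p0]) (rule that, assumption+)
  have hk: "AE h in law n p. k n h = hist_kernel p n h" for n
  proof -
    \<comment> \<open>The factor \<kappa> has no known measurability. Feeding the policy the
      histories chosen by \<open>sec\<close> gives a universally measurable function of the view
      with the same values.\<close>
    obtain \<kappa>' where \<kappa>': "\<kappa>' \<in> MW n \<rightarrow>\<^sub>M prob_algebra MA" "AE v in view_marginal n p. \<mu> n (sec n v) = \<kappa>' v"
      using universal_kernel_borel_version[OF real_retract_A measurable_universal_compose[OF sec \<mu>m] view_marginal_in[OF p]] .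
    show ?thesis
    proof (rule AE_hist_kernel_eq[OF p gen k \<kappa>'(1)])
      fix m assume m: "m \<in> set_pmf (w n)"
      from AE_view_marginalD[OF p \<kappa>'(2) m] ae[of m] AE_space[of "law m p"]
      show "AE h in law m p. k m h = \<kappa>' (view m h)"
      proof eventually_elim
        case (elim h)
        then have h: "h \<in> histories X A m" by (simp add: space_prob_algebra_cong[OF law_in[OF p]])
        have v: "view m h \<in> W n" using measurable_space[OF view[OF m]] h by simp
        have "sec n (view m h) \<in> histories X A n" using measurable_space[OF sec] v by simp
        from \<kappa>[OF w_self this] view_sec[OF v] \<kappa>[OF m h] have "\<mu> n (sec n (view m h)) = \<mu> m h" by simp
        with elim show ?case by simp
      qed
    qed
  qed
  have "AE \<omega> in p. \<omega> n \<in> \<Gamma>" for n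
  proof (rule action_law_AE_\<Gamma>[OF p gen k])
    from ae[of n] AE_space[of "law n p"] show "AE h in law n p. AE a in k n h. (snd h, a) \<in> \<Gamma>"
    proof eventually_elim
      case (elim h)
      then have "h \<in> histories X A n" by (simp add: space_prob_algebra_cong[OF law_in[OF p]])
      from policy_AE_admissible[OF \<mu>p this] show ?case unfolding elim(1) .
    qed
  qed
  moreover have "AE h in law n p. \<mu> n h = hist_kernel p n h" for n
    using ae[of n] hk[of n] by eventually_elim simp
  moreover have "strategic_measure X A q p0 \<mu> = p" by (rule strategic_measure_eqI[OF p0 p init gen k ae])
  moreover have "generated p (hist_kernel p)" by (rule generated_hist_kernel[OF p gen k hk])
  ultimately show ?thesis using p by (auto simp: AE_\<Gamma>\<omega>_iff)
qed

text \<open>On a null set of views, chosen equally within a class, the disintegration is replaced by an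
  admissible selector.\<close>

lemma view_policy_of_measure:
  assumes p: "p \<in> space (prob_algebra MT)" and gen: "generated p (hist_kernel p)"
    and \<Gamma>: "AE \<omega> in p. \<omega> \<in> \<Gamma>\<omega>"
    and Q: "\<And>n. AE v in view_marginal n p. Q (view_kernel n p v)" and Q_return: "\<And>a. a \<in> A \<Longrightarrow> Q (return MA a)"
  shows "\<exists>p0\<in>space (prob_algebra MX). \<exists>\<mu>\<in>view_policies.
    strategic_measure X A q p0 \<mu> = p \<and> (\<forall>n. \<forall>h\<in>histories X A n. Q (\<mu> n h))"
proof -
  obtain \<phi> where \<phi>: "\<phi> \<in> universal MX \<rightarrow>\<^sub>M MA" "\<And>x. x \<in> X \<Longrightarrow> \<phi> x \<in> Adm x" by (rule selector_exists) (rule that, assumption+)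
  have \<phi>A: "\<phi> x \<in> A" if "x \<in> X" for x using measurable_space[OF \<phi>(1)] that by simp
  \<comment> \<open>Q carries an extra property of the kernels, such as being a point mass, through
    the modification on null sets.\<close>
  define good where "good n v \<longleftrightarrow> (AE a in view_kernel n p v. (snd v, a) \<in> \<Gamma>) \<and> Q (view_kernel n p v)" for n v
  \<comment> \<open>The choice is made from data that coincide throughout a class, so the same null
    set results at all its times.\<close>
  define N where "N n = (SOME N. N \<in> null_sets (view_marginal n p) \<and> {v\<in>W n. \<not> good n v} \<subseteq> N)" for n
  have N: "N n \<in> null_sets (view_marginal n p) \<and> {v\<in>W n. \<not> good n v} \<subseteq> N n" for n
  proof -
    have "AE v in view_marginal n p. good n v"
      using AE_view_kernel_\<Gamma>[OF p, of n] \<Gamma> Q[of n] unfolding good_def AE_\<Gamma>\<omega>_iff by simp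
    then have "\<exists>N. N \<in> null_sets (view_marginal n p) \<and> {v\<in>W n. \<not> good n v} \<subseteq> N"
      unfolding eventually_ae_filter using space_prob_algebra_cong[OF view_marginal_in[OF p, of n]] by auto
    then show ?thesis unfolding N_def by (rule someI_ex)
  qed
  define \<kappa> where "\<kappa> n v = (if v \<in> W n - N n then view_kernel n p v else return MA (\<phi> (snd v)))" for n v
  have \<kappa>_class: "\<kappa> m = \<kappa> n" if m: "m \<in> set_pmf (w n)" for m n
  proof -
    note c = mixture_class[OF m, of p] w_class[OF m]
    have "good m = good n" unfolding good_def[abs_def] c ..
    moreover have "view_marginal m p = view_marginal n p" using c by (simp add: view_marginal_def)
    ultimately have N_eq: "N m = N n" using c by (simp add: N_def)
    show ?thesis unfolding \<kappa>_def[abs_def] N_eq c(2) conjunct2[OF c(3)] ..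
  qed
  define \<mu> where "\<mu> n h = \<kappa> n (view n h)" for n h
  have "snd \<in> MW n \<rightarrow>\<^sub>M MX" for n
    using measurable_compose[OF measurable_borel_on_id measurable_snd_borel] W_snd
    by (intro measurable_borel_onI) auto
  from measurable_compose[OF measurable_universal_compose[OF this \<phi>(1)] measurable_return_prob_space]
  have "\<kappa> n \<in> universal (MW n) \<rightarrow>\<^sub>M prob_algebra MA" for n
    unfolding \<kappa>_def
  proof (intro measurable_If_set measurable_universal_borel[OF measurable_view_kernel[OF p]])
    have "N n \<in> sets (MW n)" using N[of n] sets_prob_algebra_cong[OF view_marginal_in[OF p]] by auto
    then have "W n - N n \<in> sets (MW n)" using sets.top[of "MW n"] by (intro sets.Diff) simp_all
    then show "(W n - N n) \<inter> space (universal (MW n)) \<in> sets (universal (MW n))"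
      using sets.sets_into_space[of "W n - N n" "MW n"] by (intro sets_universalI_borel) (simp add: Int_absorb2)
  qed
  from measurable_universal_compose[OF view[OF w_self] this]
  have \<mu>_meas: "\<mu> n \<in> universal (MH n) \<rightarrow>\<^sub>M prob_algebra MA" for n unfolding \<mu>_def .
  have admissible: "(AE a in \<mu> n h. a \<in> Adm (snd h)) \<and> Q (\<mu> n h)" if h: "h \<in> histories X A n" for n h
  proof -
    have v: "view n h \<in> W n" using measurable_space[OF view[OF w_self]] h by simp
    have s: "snd (view n h) = snd h" by (rule snd_view[OF h])
    have x: "snd h \<in> X" using h by (simp add: histories_iff)
    show ?thesis
    proof (cases "view n h \<in> N n")
      case True
      then have eq: "\<mu> n h = return MA (\<phi> (snd h))" by (simp add: \<mu>_def \<kappa>_def s)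
      show ?thesis
        unfolding eq using AE_return_singleton[OF \<phi>A[OF x], of "\<lambda>a. a \<in> Adm (snd h)"] \<phi>(2)[OF x] Q_return[OF \<phi>A[OF x]]
        by blast
    next
      case False
      then have eq: "\<mu> n h = view_kernel n p (view n h)" using v by (simp add: \<mu>_def \<kappa>_def)
      have "good n (view n h)" using False N[of n] v by blast
      then show ?thesis unfolding eq by (simp add: good_def s \<Gamma>_def x)
    qed
  qed
  have "\<mu> \<in> policies X A Adm"
    unfolding policies_def
  proof (intro CollectI allI conjI ballI \<mu>_meas)
    fix n h assume h: "h \<in> histories X A n"
    have m: "\<mu> n h \<in> space (prob_algebra MA)" using measurable_space[OF \<mu>_meas] h by simp
    have "Adm (snd h) \<subseteq> space (\<mu> n h)"
      using Adm[of "snd h"] h by (simp add: space_prob_algebra_cong[OF m] histories_iff)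
    from completion_prob_one_iff_AE[OF prob_algebra_prob_space[OF m] this] admissible[OF h]
    show "emeasure (completion (\<mu> n h)) (Adm (snd h)) = 1" by blast
  qed
  then have \<mu>: "\<mu> \<in> view_policies" unfolding view_policies_def using \<kappa>_class by (auto simp: \<mu>_def)
  have "AE h in law n p. \<mu> n h = hist_kernel p n h" for n
  proof -
    have "AE v in view_marginal n p. v \<notin> N n" using N[of n] by (intro AE_not_in) blast
    from AE_view_marginalD[OF p this w_self] AE_space
    show ?thesis
    proof eventually_elim
      case (elim h)
      then have "view n h \<in> W n"
        using measurable_space[OF view[OF w_self], of h n] by (simp add: space_prob_algebra_cong[OF law_in[OF p]])
      then show ?case using elim(1) by (simp add: \<mu>_def \<kappa>_def hist_kernel_def)
    qed
  qed
  from strategic_measure_eqI[OF _ p _ gen measurable_hist_kernel[OF p] this, of "distr (law 0 p) MX snd"]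
    distr_in_prob_algebra[OF law_in[OF p] measurable_hist_state] initial_of_law[OF p]
  have "strategic_measure X A q (distr (law 0 p) MX snd) \<mu> = p" by simp
  with \<mu> distr_in_prob_algebra[OF law_in[OF p] measurable_hist_state] show ?thesis using admissible by blast
qed

definition generated_measures :: "(nat \<Rightarrow> 'x \<times> 'a) measure set" where
  "generated_measures = {p\<in>space (prob_algebra MT). generated p (hist_kernel p)}"

definition deterministic_measures :: "(nat \<Rightarrow> 'x \<times> 'a) measure set" where
  "deterministic_measures = {p\<in>space (prob_algebra MT). \<forall>n. AE h in law n p. hist_kernel p n h \<in> point_masses MA}"

text \<open>Both sides of the one-step equation are kernels in p, the right-hand one because
  \<open>hist_kernel\<close> is jointly measurable; \<open>sets_eq_prob_kernels\<close> applies for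
  each n.\<close>

lemma generated_measures_in_sets: "generated_measures \<in> sets (prob_algebra MT)"
proof -
  have kp: "(\<lambda>p. kernel_prod (MH n) MA (law n p) (hist_kernel p n)) \<in> prob_algebra MT \<rightarrow>\<^sub>M prob_algebra (MH n \<Otimes>\<^sub>M MA)" for n
    unfolding kernel_prod_def
  proof (rule measurable_bind_prob_space2[OF measurable_law])
    have "(\<lambda>(z, a). (snd z, a)) \<in> (prob_algebra MT \<Otimes>\<^sub>M MH n) \<Otimes>\<^sub>M MA \<rightarrow>\<^sub>M MH n \<Otimes>\<^sub>M MA" by measurable
    from measurable_distr_prob_space2[OF measurable_hist_kernel_joint, of "\<lambda>z a. (snd z, a)", OF this]
    show "(\<lambda>(p, h). distr (hist_kernel p n h) (MH n \<Otimes>\<^sub>M MA) (Pair h)) \<in>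
        prob_algebra MT \<Otimes>\<^sub>M MH n \<rightarrow>\<^sub>M prob_algebra (MH n \<Otimes>\<^sub>M MA)"
      by (simp add: split_beta')
  qed
  have "(\<lambda>p. step n (hist_kernel p n) (law n p)) \<in> prob_algebra MT \<rightarrow>\<^sub>M prob_algebra (MH (Suc n))" for n
    unfolding step_def by (rule measurable_bind_prob_space[OF kp measurable_trans])
  from sets_eq_prob_kernels[OF real_retract_H measurable_law this]
  have "{p\<in>space (prob_algebra MT). \<forall>n. law (Suc n) p = step n (hist_kernel p n) (law n p)} \<in> sets (prob_algebra MT)"
    by (rule sets.sets_Collect_countable_All)
  then show ?thesis unfolding generated_measures_def generated_def .
qed

lemma deterministic_measures_in_sets: "deterministic_measures \<in> sets (prob_algebra MT)"
  unfolding deterministic_measures_def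
proof (rule sets.sets_Collect_countable_All, rule sets_Collect_AE_prob_algebra[OF measurable_law])
  fix n
  have "Measurable.pred (prob_algebra MT \<Otimes>\<^sub>M MH n) (\<lambda>z. (\<lambda>(p, h). hist_kernel p n h) z \<in> point_masses MA)"
    by (rule pred_sets2[OF point_masses_in_sets[OF real_retract_A] measurable_hist_kernel_joint])
  then show "Measurable.pred (prob_algebra MT \<Otimes>\<^sub>M MH n) (\<lambda>(p, h). hist_kernel p n h \<in> point_masses MA)"
    by (simp add: split_beta')
qed

text \<open>Determinism is required at each time along histories, but the policy is repaired on sets
  of views. The marginal of the mixture collects the views of all times of the class, which links
  the two.\<close>

lemma AE_view_kernel_point_mass:
  assumes p: "p \<in> deterministic_measures"
  shows "AE v in view_marginal n p. view_kernel n p v \<in> point_masses MA"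
proof -
  have p': "p \<in> space (prob_algebra MT)" using p unfolding deterministic_measures_def by blast
  let ?B = "view_kernel n p -` point_masses MA \<inter> space (MW n)"
  have "AE v in view_marginal n p. v \<in> ?B"
  proof (rule AE_view_marginalI[OF p' measurable_sets[OF measurable_view_kernel[OF p'] point_masses_in_sets[OF real_retract_A]]])
    fix m assume m: "m \<in> set_pmf (w n)"
    have "AE h in law m p. hist_kernel p m h \<in> point_masses MA" using p unfolding deterministic_measures_def by blast
    then show "AE h in law m p. view m h \<in> ?B" using AE_space
    proof eventually_elim
      case (elim h)
      then show ?case using measurable_space[OF view[OF m], of h] mixture_class(2)[OF m, of p]
        by (simp add: hist_kernel_def space_prob_algebra_cong[OF law_in[OF p']])
    qed
  qed
  then show ?thesis by eventually_elim blast
qed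

lemma strategic_measures_view_policies:
  "strategic_measures X A q view_policies = {p\<in>generated_measures. AE \<omega> in p. \<omega> \<in> \<Gamma>\<omega>}"
proof (intro equalityI subsetI)
  fix p assume "p \<in> strategic_measures X A q view_policies"
  then show "p \<in> {p\<in>generated_measures. AE \<omega> in p. \<omega> \<in> \<Gamma>\<omega>}"
    unfolding strategic_measures_def prob_measures_def generated_measures_def
    using measure_of_view_policy by blast
next
  fix p assume "p \<in> {p\<in>generated_measures. AE \<omega> in p. \<omega> \<in> \<Gamma>\<omega>}"
  then show "p \<in> strategic_measures X A q view_policies"
    using view_policy_of_measure[of p "\<lambda>_. True"]
    unfolding generated_measures_def strategic_measures_def prob_measures_def by auto
qed

lemma strategic_measures_nonrandomized_view_policies:
  "strategic_measures X A q (view_policies \<inter> nonrandomized X A) =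
    {p\<in>generated_measures \<inter> deterministic_measures. AE \<omega> in p. \<omega> \<in> \<Gamma>\<omega>}"
proof (intro equalityI subsetI)
  fix p assume "p \<in> strategic_measures X A q (view_policies \<inter> nonrandomized X A)"
  then obtain p0 \<mu> where p0: "p0 \<in> space (prob_algebra MX)" and \<mu>: "\<mu> \<in> view_policies" "\<mu> \<in> nonrandomized X A"
    and p_eq: "p = strategic_measure X A q p0 \<mu>"
    unfolding strategic_measures_def prob_measures_def by blast
  have p: "p \<in> space (prob_algebra MT)" "generated p (hist_kernel p)" "AE \<omega> in p. \<omega> \<in> \<Gamma>\<omega>"
    and ae: "\<And>n. AE h in law n p. \<mu> n h = hist_kernel p n h"
    using measure_of_view_policy[OF \<mu>(1) p0] p_eq by auto
  have "AE h in law n p. hist_kernel p n h \<in> point_masses MA" for n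
    using ae[of n] AE_space
  proof eventually_elim
    case (elim h)
    then have "h \<in> histories X A n" by (simp add: space_prob_algebra_cong[OF law_in[OF p(1)]])
    then have "\<mu> n h \<in> point_masses MA" using \<mu>(2) unfolding nonrandomized_def point_masses_def by auto
    with elim(1) show ?case by simp
  qed
  with p show "p \<in> {p\<in>generated_measures \<inter> deterministic_measures. AE \<omega> in p. \<omega> \<in> \<Gamma>\<omega>}"
    unfolding generated_measures_def deterministic_measures_def by blast
next
  fix p assume p: "p \<in> {p\<in>generated_measures \<inter> deterministic_measures. AE \<omega> in p. \<omega> \<in> \<Gamma>\<omega>}"
  then have "\<exists>p0\<in>space (prob_algebra MX). \<exists>\<mu>\<in>view_policies. strategic_measure X A q p0 \<mu> = p \<and>
      (\<forall>n. \<forall>h\<in>histories X A n. \<mu> n h \<in> point_masses MA)"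
    using AE_view_kernel_point_mass[of p]
    by (intro view_policy_of_measure) (auto simp: generated_measures_def point_masses_def)
  then obtain p0 \<mu> where *: "p0 \<in> space (prob_algebra MX)" "\<mu> \<in> view_policies" "strategic_measure X A q p0 \<mu> = p"
    "\<And>n h. h \<in> histories X A n \<Longrightarrow> \<mu> n h \<in> point_masses MA" by blast
  have "\<mu> \<in> nonrandomized X A"
    unfolding nonrandomized_def
  proof (intro CollectI allI ballI)
    fix n h assume "h \<in> histories X A n"
    from *(4)[OF this] show "\<exists>a\<in>A. \<mu> n h = return MA a" unfolding point_masses_def by auto
  qed
  with * show "p \<in> strategic_measures X A q (view_policies \<inter> nonrandomized X A)"
    unfolding strategic_measures_def prob_measures_def by blast
qed

end

section \<open>The three classes of policies\<close>

context mdp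
begin

lemma concentrated_on_\<Gamma>\<omega>:
  assumes C: "C \<in> sets (prob_algebra MT)"
  shows "analytic_in (weak_topology (trajectories X A)) {p\<in>C. AE \<omega> in p. \<omega> \<in> \<Gamma>\<omega>}"
    and "\<Gamma> \<in> sets MXA \<Longrightarrow>
      {p\<in>C. AE \<omega> in p. \<omega> \<in> \<Gamma>\<omega>} \<in> sets (borel_of (weak_topology (trajectories X A)))"
proof -
  show "analytic_in (weak_topology (trajectories X A)) {p\<in>C. AE \<omega> in p. \<omega> \<in> \<Gamma>\<omega>}"
    by (rule analytic_in_concentrated[OF trajectories_borel analytic_\<Gamma>\<omega> \<Gamma>\<omega>_subset C])
  assume \<Gamma>: "\<Gamma> \<in> sets MXA"
  have "Measurable.pred (prob_algebra MT \<Otimes>\<^sub>M MT) (\<lambda>z. snd z n \<in> \<Gamma>)" for n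
    by (rule pred_sets2[OF \<Gamma> measurable_compose[OF measurable_snd measurable_traj_XA]])
  then have "Measurable.pred (prob_algebra MT \<Otimes>\<^sub>M MT) (\<lambda>z. \<forall>n. snd z n \<in> \<Gamma>)" by measurable
  then have "{p\<in>space (prob_algebra MT). AE \<omega> in p. \<omega> \<in> \<Gamma>\<omega>} \<in> sets (prob_algebra MT)"
    by (intro sets_Collect_AE_prob_algebra[where L="\<lambda>p. p" and N=MT]) (simp_all add: \<Gamma>\<omega>_def split_beta')
  from sets.Int[OF C this]
  have "C \<inter> {p\<in>space (prob_algebra MT). AE \<omega> in p. \<omega> \<in> \<Gamma>\<omega>} \<in> sets (prob_algebra MT)" .
  also have "C \<inter> {p\<in>space (prob_algebra MT). AE \<omega> in p. \<omega> \<in> \<Gamma>\<omega>} = {p\<in>C. AE \<omega> in p. \<omega> \<in> \<Gamma>\<omega>}"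
    using sets.sets_into_space[OF C] by blast
  finally show "{p\<in>C. AE \<omega> in p. \<omega> \<in> \<Gamma>\<omega>} \<in> sets (borel_of (weak_topology (trajectories X A)))"
    unfolding sets_borel_of_weak_topology .
qed

definition strategic_measures_regular :: "('x, 'a) policy set \<Rightarrow> bool" where
  "strategic_measures_regular Pol \<longleftrightarrow>
    (\<forall>S\<in>{strategic_measures X A q Pol, strategic_measures X A q (Pol \<inter> nonrandomized X A)}.
      analytic_in (weak_topology (trajectories X A)) S \<and>
      (\<Gamma> \<in> sets MXA \<longrightarrow> S \<in> sets (borel_of (weak_topology (trajectories X A)))))"

end

lemma (in mdp_view) strategic_measures_regular_view_policies: "strategic_measures_regular view_policies"
  unfolding strategic_measures_regular_def strategic_measures_view_policies
    strategic_measures_nonrandomized_view_policies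
  using concentrated_on_\<Gamma>\<omega>[OF generated_measures_in_sets]
    concentrated_on_\<Gamma>\<omega>[OF sets.Int[OF generated_measures_in_sets deterministic_measures_in_sets]]
  by simp

context mdp
begin

lemma strategic_measures_regular_policies: "strategic_measures_regular (policies X A Adm)"
proof -
  interpret v: mdp_view X A q Adm "\<lambda>_ h. h" "histories X A" return_pmf "\<lambda>_ h. h"
    by unfold_locales (auto simp: histories_borel histories_nonempty histories_iff)
  have "v.view_policies = policies X A Adm" unfolding v.view_policies_def by auto
  then show ?thesis using v.strategic_measures_regular_view_policies by simp
qed

text \<open>The current state is encoded as a history of length 0, so that views have the type of
  histories. The section invents a past by repeating the pair (x, a), which the view
  forgets.\<close>

lemma mdp_view_state:
  assumes w: "\<And>m n. m \<in> set_pmf (w n) \<Longrightarrow> w m = w n" "\<And>n. n \<in> set_pmf (w n)"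
    and xa: "x \<in> X" "a \<in> A"
  shows "mdp_view X A q Adm (\<lambda>_ h. (\<lambda>_. undefined, snd h)) (\<lambda>_. histories X A 0) w
    (\<lambda>n v. (restrict (\<lambda>_. (x, a)) {..<n}, snd v))"
proof unfold_locales
  fix n m
  show "histories X A 0 \<in> sets borel" by (rule histories_borel)
  show "histories X A 0 \<noteq> {}" by (rule histories_nonempty)
  show "(\<lambda>h. (\<lambda>_. undefined, snd h)) \<in> MH m \<rightarrow>\<^sub>M MH 0"
    by (rule measurable_compose[OF measurable_hist_state measurable_initial_history])
  show "n \<in> set_pmf (w n)" by (rule w)
  show "m \<in> set_pmf (w n) \<Longrightarrow> w m = w n \<and> histories X A 0 = histories X A 0" using w by simp
  show "(\<lambda>v. (restrict (\<lambda>_. (x, a)) {..<n}, snd v)) \<in> MH 0 \<rightarrow>\<^sub>M MH n"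
    by (rule measurable_borel_onI, intro measurable_Pair_borel measurable_hist_snd measurable_const)
       (use xa in \<open>auto simp: histories_iff\<close>)
  show "snd v \<in> X" if "v \<in> histories X A 0" for v using that by (simp add: histories_iff)
  show "(\<lambda>_. undefined, snd (restrict (\<lambda>_. (x, a)) {..<n}, snd v)) = v" if "v \<in> histories X A 0" for v
    using that by (cases v) (simp add: histories_def)
qed simp

lemma strategic_measures_regular_markov: "strategic_measures_regular (markov_policies X A Adm)"
proof -
  obtain x a where xa: "x \<in> X" "a \<in> A" using X_nonempty A_nonempty by blast
  interpret v: mdp_view X A q Adm "\<lambda>_ h. (\<lambda>_. undefined, snd h)" "\<lambda>_. histories X A 0" return_pmf
      "\<lambda>n v. (restrict (\<lambda>_. (x, a)) {..<n}, snd v)"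
    by (rule mdp_view_state[OF _ _ xa]) auto
  have "v.view_policies = markov_policies X A Adm"
  proof (intro equalityI subsetI)
    fix \<mu> assume "\<mu> \<in> v.view_policies"
    note * = this[unfolded v.view_policies_def mem_Collect_eq]
    from * have \<mu>: "\<mu> \<in> policies X A Adm" ..
    show "\<mu> \<in> markov_policies X A Adm"
    proof (rule exE[OF *[THEN conjunct2]])
      fix \<kappa> :: "nat \<Rightarrow> ('x, 'a) history \<Rightarrow> 'a measure"
      assume \<kappa>: "\<forall>n. \<forall>m\<in>set_pmf (return_pmf n). \<forall>h\<in>histories X A m. \<mu> m h = \<kappa> n (\<lambda>_. undefined, snd h)"
      have "\<exists>\<kappa>. \<forall>h\<in>histories X A n. \<mu> n h = \<kappa> (snd h)" for n
        by (rule exI[of _ "\<lambda>x. \<kappa> n (\<lambda>_. undefined, x)"]) (use \<kappa> in simp)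
      with \<mu> show ?thesis unfolding markov_policies_def by blast
    qed
  next
    fix \<mu> assume \<mu>: "\<mu> \<in> markov_policies X A Adm"
    then have "\<forall>n. \<exists>\<kappa>. \<forall>h\<in>histories X A n. \<mu> n h = \<kappa> (snd h)" unfolding markov_policies_def by blast
    then obtain \<kappa> where "\<forall>n. \<forall>h\<in>histories X A n. \<mu> n h = \<kappa> n (snd h)" by metis
    with \<mu> show "\<mu> \<in> v.view_policies"
      unfolding v.view_policies_def markov_policies_def by (auto intro!: exI[of _ "\<lambda>n v. \<kappa> n (snd v)"])
  qed
  then show ?thesis using v.strategic_measures_regular_view_policies by simp
qed

lemma strategic_measures_regular_stationary: "strategic_measures_regular (stationary_policies X A Adm)"
proof -
  obtain x a where xa: "x \<in> X" "a \<in> A" using X_nonempty A_nonempty by blast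
  \<comment> \<open>What matters about this law is that every time has positive mass, so that a
    single class contains all times.\<close>
  have w: "set_pmf (geometric_pmf (1/2)) = UNIV" by (rule set_pmf_geometric) simp_all
  interpret v: mdp_view X A q Adm "\<lambda>_ h. (\<lambda>_. undefined, snd h)" "\<lambda>_. histories X A 0" "\<lambda>_. geometric_pmf (1/2)"
      "\<lambda>n v. (restrict (\<lambda>_. (x, a)) {..<n}, snd v)"
    by (rule mdp_view_state[OF _ _ xa]) (simp_all add: w)
  have "v.view_policies = stationary_policies X A Adm"
  proof (intro equalityI subsetI)
    fix \<mu> assume "\<mu> \<in> v.view_policies"
    note * = this[unfolded v.view_policies_def w mem_Collect_eq]
    from * have \<mu>: "\<mu> \<in> policies X A Adm" ..
    show "\<mu> \<in> stationary_policies X A Adm"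
    proof (rule exE[OF *[THEN conjunct2]])
      fix \<kappa> :: "nat \<Rightarrow> ('x, 'a) history \<Rightarrow> 'a measure"
      assume \<kappa>: "\<forall>n. \<forall>m\<in>UNIV. \<forall>h\<in>histories X A m. \<mu> m h = \<kappa> n (\<lambda>_. undefined, snd h)"
      have "\<exists>\<kappa>. \<forall>n. \<forall>h\<in>histories X A n. \<mu> n h = \<kappa> (snd h)"
        by (rule exI[of _ "\<lambda>x. \<kappa> 0 (\<lambda>_. undefined, x)"]) (use \<kappa> in simp)
      with \<mu> show ?thesis unfolding stationary_policies_def by blast
    qed
  next
    fix \<mu> assume "\<mu> \<in> stationary_policies X A Adm"
    then obtain \<kappa> where "\<mu> \<in> policies X A Adm" "\<forall>n. \<forall>h\<in>histories X A n. \<mu> n h = \<kappa> (snd h)"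
      unfolding stationary_policies_def by blast
    then show "\<mu> \<in> v.view_policies"
      unfolding v.view_policies_def by (auto intro!: exI[of _ "\<lambda>n v. \<kappa> (snd v)"])
  qed
  then show ?thesis using v.strategic_measures_regular_view_policies by simp
qed

end

theorem theorem3p1:
  fixes X :: "'x::polish_space set" and A :: "'a::polish_space set"
    and q :: "'x \<times> 'a \<Rightarrow> 'x measure" and Adm :: "'x \<Rightarrow> 'a set"
  assumes "X \<in> sets borel" and "A \<in> sets borel"
    and "q \<in> borel_on (X \<times> A) \<rightarrow>\<^sub>M prob_algebra (borel_on X)"
    and "\<And>x. x \<in> X \<Longrightarrow> Adm x \<noteq> {} \<and> Adm x \<subseteq> A"
    and "analytic_in (top_of_set (X \<times> A)) {(x, a). x \<in> X \<and> a \<in> Adm x}"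
  shows "\<forall>Pol \<in> {policies X A Adm, markov_policies X A Adm, stationary_policies X A Adm}.
    let S = strategic_measures X A q Pol;
        S' = strategic_measures X A q (Pol \<inter> nonrandomized X A);
        W = weak_topology (trajectories X A)
    in analytic_in W S \<and> analytic_in W S' \<and>
       ({(x, a). x \<in> X \<and> a \<in> Adm x} \<in> sets (borel_on (X \<times> A)) \<longrightarrow>
          S \<in> sets (borel_of W) \<and> S' \<in> sets (borel_of W))"
proof (cases "X = {}")
  case True
  \<comment> \<open>There is no probability measure on the empty space, so there is no strategic
    measure either.\<close>
  have "prob_measures X = {}"
    using prob_space.not_empty by (fastforce simp: prob_measures_def True space_prob_algebra dest: sets_eq_imp_space_eq)
  then have "strategic_measures X A q Pol = {}" for Pol by (simp add: strategic_measures_def)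
  then show ?thesis by (simp add: analytic_in_def)
next
  case False
  interpret mdp X A q Adm by unfold_locales (use assms False in auto)
  show ?thesis
    using strategic_measures_regular_policies strategic_measures_regular_markov strategic_measures_regular_stationary
    unfolding strategic_measures_regular_def Let_def \<Gamma>_def by simp
qed

end
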